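(* Let $z<\min\sigma_{\rm ess}(\mathcal{A})$ be arbitrary. Then the integral operator $T(z):\mathcal{H}_1\to\mathcal{H}_1$ is Hilbert-Schmidt and $$N(z;\mathcal{A})=n(1;T(z)).$$
   Context: Let $d\in\mathbb{N}$, $a\in(0,\infty)$, $\Omega=(-a,a)^d\subset\mathbb{R}^d$. Let $\mathcal{H}_1=L^2(\Omega,\mathbb{C})$ and $\mathcal{H}_2=L^2_{\rm sym}(\Omega^2,\mathbb{C})$ the closed subspace of $L^2(\Omega^2,\mathbb{C})$ of functions with $f(x,y)=f(y,x)$ for almost all $x,y\in\Omega$. The symbol $^*$ denotes complex conjugation for functions and the adjoint for operators; $\mathrm{cl}$ denotes closure and $\mathrm{ran}$ the range. Standing assumptions: $w_1\in L^\infty(\Omega,\mathbb{R})$; $w_2\in C(\Omega^2)\cap L^\infty(\Omega^2,\mathbb{R})$ with $w_2(x,y)=w_2(y,x)$ for $x,y\in\Omega$; and $v_1$ is a complex-valued measurable function on $\Omega^2$ such that for some $\varepsilon>0$ $$\operatorname{ess\,sup}_{x\in\Omega}\|v_1(x,\cdot)\|_{L^{2+\varepsilon}(\Omega)}<\infty,\qquad \operatorname{ess\,sup}_{y\in\Omega}\|v_1(\cdot,y)\|_{L^{2+4/\varepsilon}(\Omega)}<\infty.$$ The bounded self-adjoint operator $\mathcal{A}$ in $\mathcal{H}_1\oplus\mathcal{H}_2$ is $$\mathcal{A}=\begin{pmatrix}H_{11}&H_{12}\\ H_{12}^*&H_{22}\end{pmatrix},$$ where $(H_{11}f_1)(x)=w_1(x)f_1(x)$,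 $(H_{12}f_2)(x)=\int_\Omega v_1(x,s)f_2(x,s)\,ds$, $(H_{22}f_2)(x,y)=w_2(x,y)f_2(x,y)$ for almost all $x,y\in\Omega$, $f_1\in\mathcal{H}_1$, $f_2\in\mathcal{H}_2$. For $z\in\mathbb{R}\setminus\mathrm{cl}(\mathrm{ran}\,w_2)$ define $$\Delta(x;z):=w_1(x)-z-\frac12\int_\Omega\frac{|v_1(x,y)|^2}{w_2(x,y)-z}\,dy,\quad x\in\Omega,\qquad K(x,y;z):=-\frac12\,\frac{v_1(x,y)\,v_1(y,x)^*}{w_2(x,y)-z},\quad (x,y)\in\Omega^2.$$ For $z<\min\sigma_{\rm ess}(\mathcal{A})$ one has $z<\inf w_2$ and $\operatorname{ess\,inf}_{x\in\Omega}\Delta(x;z)>0$, and $T(z)$ is the integral operator in $\mathcal{H}_1$ with kernel $$T(x,y;z):=-\Delta(x;z)^{-1/2}K(x,y;z)\Delta(y;z)^{-1/2},\qquad (x,y)\in\Omega^2.$$ For a bounded self-adjoint operator $A$ on a Hilbert space $\mathcal{G}$ and $\lambda\in\mathbb{R}$, $n(\lambda;A):=\sup\{\dim\mathcal{L}:\ \mathcal{L}\subset\mathcal{G}\text{ a subspace},\ (Au,u)>\lambda\|u\|^2\text{ for all }0\ne u\in\mathcal{L}\}$, which equals the dimension of the spectral subspace of $A$ corresponding to $(\lambda,\infty)$. For $\lambda\le\min\sigma_{\rm ess}(A)$, $N(\lambda;A)$ denotes the number of eigenvalues of $A$ (counted with multiplicities) that are less than $\lambda$. *)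

theory Defs
  imports "HOL-Analysis.Analysis" "HOL-Probability.Essential_Supremum"
begin

section \<open>Operators in complex Hilbert spaces\<close>

text \<open>
  The record holds only the data of a complex Hilbert space; the axioms are properties of the
  particular spaces constructed below.  The inner product is linear in its first argument.
  Operators are functions on the ambient type, of which only the values on the carrier matter.
\<close>

record 'v hilbert =
  hcarrier :: "'v set"
  hzero :: 'v
  hadd :: "'v \<Rightarrow> 'v \<Rightarrow> 'v"
  hscale :: "complex \<Rightarrow> 'v \<Rightarrow> 'v"
  hinner :: "'v \<Rightarrow> 'v \<Rightarrow> complex"

definition hnorm :: "'v hilbert \<Rightarrow> 'v \<Rightarrow> real" where
  "hnorm H u = sqrt (Re (hinner H u u))"

definition hsum :: "'v hilbert \<Rightarrow> 'w hilbert \<Rightarrow> ('v \<times> 'w) hilbert" where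
  "hsum H K =
    \<lparr> hcarrier = hcarrier H \<times> hcarrier K,
      hzero = (hzero H, hzero K),
      hadd = (\<lambda>u v. (hadd H (fst u) (fst v), hadd K (snd u) (snd v))),
      hscale = (\<lambda>c u. (hscale H c (fst u), hscale K c (snd u))),
      hinner = (\<lambda>u v. hinner H (fst u) (fst v) + hinner K (snd u) (snd v)) \<rparr>"

definition hsubspace :: "'v hilbert \<Rightarrow> 'v set \<Rightarrow> bool" where
  "hsubspace H L \<longleftrightarrow>
    L \<subseteq> hcarrier H \<and> hzero H \<in> L \<and>
    (\<forall>u\<in>L. \<forall>v\<in>L. hadd H u v \<in> L) \<and> (\<forall>c. \<forall>u\<in>L. hscale H c u \<in> L)"

primrec hlincomb :: "'v hilbert \<Rightarrow> nat \<Rightarrow> (nat \<Rightarrow> complex) \<Rightarrow> (nat \<Rightarrow> 'v) \<Rightarrow> 'v" where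
  "hlincomb H 0 c u = hzero H"
| "hlincomb H (Suc n) c u = hadd H (hlincomb H n c u) (hscale H (c n) (u n))"

definition hindependent :: "'v hilbert \<Rightarrow> nat \<Rightarrow> (nat \<Rightarrow> 'v) \<Rightarrow> bool" where
  "hindependent H n u \<longleftrightarrow> (\<forall>c. hlincomb H n c u = hzero H \<longrightarrow> (\<forall>i<n. c i = 0))"

definition hdim :: "'v hilbert \<Rightarrow> 'v set \<Rightarrow> enat" where
  "hdim H L = Sup {enat n | n. \<exists>u. (\<forall>i<n. u i \<in> L) \<and> hindependent H n u}"

definition bounded_op :: "'v hilbert \<Rightarrow> 'w hilbert \<Rightarrow> ('v \<Rightarrow> 'w) \<Rightarrow> bool" where
  "bounded_op H K T \<longleftrightarrow>
    (\<forall>u\<in>hcarrier H. T u \<in> hcarrier K) \<and>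
    (\<forall>u\<in>hcarrier H. \<forall>v\<in>hcarrier H. T (hadd H u v) = hadd K (T u) (T v)) \<and>
    (\<forall>c. \<forall>u\<in>hcarrier H. T (hscale H c u) = hscale K c (T u)) \<and>
    (\<exists>C. \<forall>u\<in>hcarrier H. hnorm K (T u) \<le> C * hnorm H u)"

definition hadjoint :: "'v hilbert \<Rightarrow> 'w hilbert \<Rightarrow> ('v \<Rightarrow> 'w) \<Rightarrow> 'w \<Rightarrow> 'v" where
  "hadjoint H K T g =
    (THE h. h \<in> hcarrier H \<and> (\<forall>f\<in>hcarrier H. hinner K (T f) g = hinner H f h))"

definition shifted_op :: "'v hilbert \<Rightarrow> ('v \<Rightarrow> 'v) \<Rightarrow> complex \<Rightarrow> 'v \<Rightarrow> 'v" where
  "shifted_op H A \<mu> u = hadd H (A u) (hscale H (- \<mu>) u)"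

definition resolvent_set :: "'v hilbert \<Rightarrow> ('v \<Rightarrow> 'v) \<Rightarrow> complex set" where
  "resolvent_set H A =
    {\<mu>. \<exists>R. bounded_op H H R \<and>
      (\<forall>u\<in>hcarrier H. R (shifted_op H A \<mu> u) = u \<and> shifted_op H A \<mu> (R u) = u)}"

definition spectrum :: "'v hilbert \<Rightarrow> ('v \<Rightarrow> 'v) \<Rightarrow> complex set" where
  "spectrum H A = - resolvent_set H A"

definition eigenspace :: "'v hilbert \<Rightarrow> ('v \<Rightarrow> 'v) \<Rightarrow> complex \<Rightarrow> 'v set" where
  "eigenspace H A \<mu> = {u \<in> hcarrier H. A u = hscale H \<mu> u}"

definition eigenvalue :: "'v hilbert \<Rightarrow> ('v \<Rightarrow> 'v) \<Rightarrow> complex \<Rightarrow> bool" where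
  "eigenvalue H A \<mu> \<longleftrightarrow> (\<exists>u\<in>eigenspace H A \<mu>. u \<noteq> hzero H)"

definition discrete_spectrum :: "'v hilbert \<Rightarrow> ('v \<Rightarrow> 'v) \<Rightarrow> complex set" where
  "discrete_spectrum H A =
    {\<mu>. eigenvalue H A \<mu> \<and> hdim H (eigenspace H A \<mu>) < \<infinity> \<and> \<not> \<mu> islimpt spectrum H A}"

text \<open>
  This is the usual definition for self-adjoint operators, the only ones it is used for; it is
  not the right notion of essential spectrum in general.
\<close>

definition essential_spectrum :: "'v hilbert \<Rightarrow> ('v \<Rightarrow> 'v) \<Rightarrow> complex set" where
  "essential_spectrum H A = spectrum H A - discrete_spectrum H A"

definition eigenvalue_count :: "'v hilbert \<Rightarrow> real \<Rightarrow> ('v \<Rightarrow> 'v) \<Rightarrow> enat" where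
  "eigenvalue_count H t A =
    (\<Sum>\<^sub>\<infinity>\<mu> | eigenvalue H A (complex_of_real \<mu>) \<and> \<mu> < t.
      hdim H (eigenspace H A (complex_of_real \<mu>)))"

text \<open>
  For self-adjoint \<open>A\<close> the number \<open>(A u, u)\<close> is real, so taking its real part is harmless.
\<close>

definition form_count :: "'v hilbert \<Rightarrow> real \<Rightarrow> ('v \<Rightarrow> 'v) \<Rightarrow> enat" where
  "form_count H t A =
    Sup {hdim H L | L. hsubspace H L \<and>
      (\<forall>u\<in>L. u \<noteq> hzero H \<longrightarrow> Re (hinner H (A u) u) > t * (hnorm H u)\<^sup>2)}"

definition orthonormal_basis :: "'v hilbert \<Rightarrow> 'v set \<Rightarrow> bool" where
  "orthonormal_basis H E \<longleftrightarrow>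
    E \<subseteq> hcarrier H \<and>
    (\<forall>e\<in>E. \<forall>f\<in>E. hinner H e f = (if e = f then 1 else 0)) \<and>
    (\<forall>u\<in>hcarrier H. (\<forall>e\<in>E. hinner H u e = 0) \<longrightarrow> u = hzero H)"

definition hilbert_schmidt :: "'v hilbert \<Rightarrow> ('v \<Rightarrow> 'v) \<Rightarrow> bool" where
  "hilbert_schmidt H T \<longleftrightarrow>
    bounded_op H H T \<and>
    (\<exists>E. orthonormal_basis H E \<and> (\<lambda>e. (hnorm H (T e))\<^sup>2) summable_on E)"


section \<open>Lebesgue spaces\<close>

definition Linfty :: "'a measure \<Rightarrow> ('a \<Rightarrow> 'b::real_normed_vector) \<Rightarrow> bool" where
  "Linfty M f \<longleftrightarrow> f \<in> borel_measurable M \<and> (\<exists>C. AE x in M. norm (f x) \<le> C)"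

definition Lp_norm :: "real \<Rightarrow> 'a measure \<Rightarrow> ('a \<Rightarrow> complex) \<Rightarrow> ennreal" where
  "Lp_norm p M f =
    (let I = (\<integral>\<^sup>+ x. ennreal (norm (f x) powr p) \<partial>M)
     in if I = \<infinity> then \<infinity> else ennreal (enn2real I powr (1 / p)))"

definition square_integrable :: "'a measure \<Rightarrow> ('a \<Rightarrow> complex) \<Rightarrow> bool" where
  "square_integrable M f \<longleftrightarrow>
    f \<in> borel_measurable M \<and> integrable M (\<lambda>x. (norm (f x))\<^sup>2)"

text \<open>
  The class of a function that is not almost everywhere equal to a square integrable one is
  empty, hence not an element of \<open>L2\<close>.
\<close>

definition L2_class :: "'a measure \<Rightarrow> ('a \<Rightarrow> complex) \<Rightarrow> ('a \<Rightarrow> complex) set" where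
  "L2_class M f = {g. square_integrable M g \<and> (AE x in M. g x = f x)}"

definition L2_rep :: "('a \<Rightarrow> complex) set \<Rightarrow> 'a \<Rightarrow> complex" where
  "L2_rep X = (SOME f. f \<in> X)"

definition L2 :: "'a measure \<Rightarrow> ('a \<Rightarrow> complex) set hilbert" where
  "L2 M =
    \<lparr> hcarrier = {L2_class M f | f. square_integrable M f},
      hzero = L2_class M (\<lambda>x. 0),
      hadd = (\<lambda>X Y. L2_class M (\<lambda>x. L2_rep X x + L2_rep Y x)),
      hscale = (\<lambda>c X. L2_class M (\<lambda>x. c * L2_rep X x)),
      hinner = (\<lambda>X Y. LINT x|M. L2_rep X x * cnj (L2_rep Y x)) \<rparr>"

definition mult_op :: "'a measure \<Rightarrow> ('a \<Rightarrow> real) \<Rightarrow> ('a \<Rightarrow> complex) set \<Rightarrow> ('a \<Rightarrow> complex) set" where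
  "mult_op M w X = L2_class M (\<lambda>x. complex_of_real (w x) * L2_rep X x)"

definition integral_op ::
    "'a measure \<Rightarrow> ('a \<times> 'a \<Rightarrow> complex) \<Rightarrow> ('a \<Rightarrow> complex) set \<Rightarrow> ('a \<Rightarrow> complex) set" where
  "integral_op M k X = L2_class M (\<lambda>x. LINT y|M. k (x, y) * L2_rep X y)"

text \<open>
  The Bochner integral of a non-integrable function is \<open>0\<close>, so the convergence of the integrals
  defining \<^const>\<open>integral_op\<close> is a separate property.
\<close>

definition integral_op_defined :: "'a measure \<Rightarrow> ('a \<times> 'a \<Rightarrow> complex) \<Rightarrow> bool" where
  "integral_op_defined M k \<longleftrightarrow>
    (\<forall>f. square_integrable M f \<longrightarrow> (AE x in M. integrable M (\<lambda>y. k (x, y) * f y)))"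


section \<open>The operator matrix\<close>

type_synonym 'n pt = "real ^ 'n"
type_synonym 'n pt2 = "(real ^ 'n) \<times> (real ^ 'n)"

definition cube :: "real \<Rightarrow> ('n::finite) pt set" where
  "cube a = {x. \<forall>i. - a < x $ i \<and> x $ i < a}"

abbreviation cube_measure :: "real \<Rightarrow> ('n::finite) pt measure" where
  "cube_measure a \<equiv> lebesgue_on (cube a)"

abbreviation cube2_measure :: "real \<Rightarrow> ('n::finite) pt2 measure" where
  "cube2_measure a \<equiv> lebesgue_on (cube a \<times> cube a)"

definition space1 :: "real \<Rightarrow> (('n::finite) pt \<Rightarrow> complex) set hilbert" where
  "space1 a = L2 (cube_measure a)"

text \<open>
  The symmetry condition does not depend on the representative, since exchanging the two
  variables preserves null sets.
\<close>

definition space2 :: "real \<Rightarrow> (('n::finite) pt2 \<Rightarrow> complex) set hilbert" where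
  "space2 a = (L2 (cube2_measure a))
    \<lparr> hcarrier := {X \<in> hcarrier (L2 (cube2_measure a)).
        AE (x, y) in cube2_measure a. L2_rep X (x, y) = L2_rep X (y, x)} \<rparr>"

definition H11 :: "real \<Rightarrow> (('n::finite) pt \<Rightarrow> real) \<Rightarrow>
    ('n pt \<Rightarrow> complex) set \<Rightarrow> ('n pt \<Rightarrow> complex) set" where
  "H11 a w1 = mult_op (cube_measure a) w1"

definition H12 :: "real \<Rightarrow> (('n::finite) pt2 \<Rightarrow> complex) \<Rightarrow>
    ('n pt2 \<Rightarrow> complex) set \<Rightarrow> ('n pt \<Rightarrow> complex) set" where
  "H12 a v1 F = L2_class (cube_measure a)
    (\<lambda>x. LINT s|cube_measure a. v1 (x, s) * L2_rep F (x, s))"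

definition H22 :: "real \<Rightarrow> (('n::finite) pt2 \<Rightarrow> real) \<Rightarrow>
    ('n pt2 \<Rightarrow> complex) set \<Rightarrow> ('n pt2 \<Rightarrow> complex) set" where
  "H22 a w2 = mult_op (cube2_measure a) w2"

definition op_matrix :: "real \<Rightarrow> (('n::finite) pt \<Rightarrow> real) \<Rightarrow> ('n pt2 \<Rightarrow> real) \<Rightarrow>
    ('n pt2 \<Rightarrow> complex) \<Rightarrow>
    ('n pt \<Rightarrow> complex) set \<times> ('n pt2 \<Rightarrow> complex) set \<Rightarrow>
    ('n pt \<Rightarrow> complex) set \<times> ('n pt2 \<Rightarrow> complex) set" where
  "op_matrix a w1 w2 v1 = (\<lambda>(f1, f2).
    (hadd (space1 a) (H11 a w1 f1) (H12 a v1 f2),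
     hadd (space2 a) (hadjoint (space2 a) (space1 a) (H12 a v1) f1) (H22 a w2 f2)))"

definition Delta :: "real \<Rightarrow> (('n::finite) pt \<Rightarrow> real) \<Rightarrow> ('n pt2 \<Rightarrow> real) \<Rightarrow>
    ('n pt2 \<Rightarrow> complex) \<Rightarrow> real \<Rightarrow> 'n pt \<Rightarrow> real" where
  "Delta a w1 w2 v1 z x =
    w1 x - z - 1 / 2 * (LINT y|cube_measure a. (norm (v1 (x, y)))\<^sup>2 / (w2 (x, y) - z))"

definition kernel_K :: "(('n::finite) pt2 \<Rightarrow> real) \<Rightarrow>
    ('n pt2 \<Rightarrow> complex) \<Rightarrow> real \<Rightarrow> 'n pt2 \<Rightarrow> complex" where
  "kernel_K w2 v1 z = (\<lambda>(x, y).
    - (1 / 2) * (v1 (x, y) * cnj (v1 (y, x)) / complex_of_real (w2 (x, y) - z)))"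

definition kernel_T :: "real \<Rightarrow> (('n::finite) pt \<Rightarrow> real) \<Rightarrow> ('n pt2 \<Rightarrow> real) \<Rightarrow>
    ('n pt2 \<Rightarrow> complex) \<Rightarrow> real \<Rightarrow> 'n pt2 \<Rightarrow> complex" where
  "kernel_T a w1 w2 v1 z = (\<lambda>(x, y).
    - (complex_of_real (Delta a w1 w2 v1 z x powr (- 1 / 2)) * kernel_K w2 v1 z (x, y) *
       complex_of_real (Delta a w1 w2 v1 z y powr (- 1 / 2))))"

definition op_T :: "real \<Rightarrow> (('n::finite) pt \<Rightarrow> real) \<Rightarrow> ('n pt2 \<Rightarrow> real) \<Rightarrow>
    ('n pt2 \<Rightarrow> complex) \<Rightarrow> real \<Rightarrow>
    ('n pt \<Rightarrow> complex) set \<Rightarrow> ('n pt \<Rightarrow> complex) set" where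
  "op_T a w1 w2 v1 z = integral_op (cube_measure a) (kernel_T a w1 w2 v1 z)"

end

theory Submission
  imports Defs "HOL-Probability.Distribution_Functions"
begin

text \<open>
  Write \<open>A\<close> for the operator matrix and \<open>q\<^sub>A u = (A u, u) - z \<parallel>u\<parallel>\<^sup>2\<close>.  Both sides of the identity are
  negative indices, that is, maximal dimensions of subspaces on which a quadratic form is negative,
  and the two forms differ by a completed square.

  \<^bold>\<open>The eigenvalue count.\<close>  By hypothesis the points of the spectrum in \<open>(-\<infinity>, z]\<close> are isolated
  eigenvalues of finite multiplicity.  They cannot accumulate, so there are finitely many of them.
  If the infimum \<open>c\<close> of the form of \<open>A\<close> on the orthogonal complement of some of the eigenspaces is
  at most \<open>z\<close>, then \<open>c\<close> is a spectral point, hence isolated, and an isolated infimum is attained by an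
  eigenvector inside that complement (\<open>isolated_infimum_eigenvector\<close>).  Consequently the form is at
  least \<open>z\<close> on the complement of the eigenspaces below \<open>z\<close>, which makes \<open>N(z; A)\<close> the negative
  index of \<open>q\<^sub>A\<close>; and it is at least some \<open>c > z\<close> on a subspace of finite codimension.

  \<^bold>\<open>The Schur complement.\<close>  Completing the square in the second component
  (\<open>schur_identity\<close>) gives
  \<open>q\<^sub>A (f, h) = \<integral> \<Delta> |f|\<^sup>2 + Re \<integral>\<integral> K(x,y) f(y) f(x)\<^sup>* + \<integral>\<integral> (w\<^sub>2 - z) |h + R f|\<^sup>2\<close> where
  \<open>R f = (w\<^sub>2 - z)\<inverse> H\<^sub>1\<^sub>2\<^sup>* f\<close>.  If \<open>w\<^sub>2 > z\<close>, the last term is nonnegative and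
  vanishes for \<open>h = - R f\<close>, so \<open>q\<^sub>A\<close> has the negative index of the first two terms; with
  \<open>g = \<Delta>\<^sup>1\<^sup>/\<^sup>2 f\<close> these are \<open>\<parallel>g\<parallel>\<^sup>2 - (T g, g)\<close>, and this form has negative index \<open>n(1; T)\<close>.

  \<^bold>\<open>The two gaps.\<close>  That \<open>w\<^sub>2\<close> and \<open>\<Delta>\<close> stay away from \<open>z\<close> and from \<open>0\<close> follows from the
  bound \<open>c > z\<close> on a subspace of finite codimension, because the functions supported in a set of
  positive Lebesgue measure form an infinite-dimensional space and so meet that subspace.  For
  \<open>w\<^sub>2\<close> one concentrates the second component where \<open>w\<^sub>2 < c\<close>; for \<open>\<Delta>\<close> one takes
  \<open>(f, - R f)\<close> with \<open>f\<close> supported where \<open>\<Delta>\<close> is small, in a set so small that \<open>K\<close> hardly matters.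

  \<^bold>\<open>Integrability.\<close>  The exponents \<open>1 + \<epsilon>/2\<close> and \<open>1 + 2/\<epsilon>\<close> are conjugate, so Young's inequality
  bounds \<open>|v\<^sub>1(x,y) v\<^sub>1(y,x)|\<^sup>2\<close> by \<open>|v\<^sub>1(x,y)|\<^bsup>2+\<epsilon>\<^esup> + |v\<^sub>1(y,x)|\<^bsup>2+4/\<epsilon>\<^esup>\<close>.  Hence \<open>K\<close> and the kernel
  of \<open>T\<close> are square integrable, and Bessel's inequality makes \<open>T\<close> Hilbert-Schmidt.
\<close>

section \<open>Inner product spaces as records\<close>

text \<open>
  Induction on the number of equations, by Gaussian elimination.  It is stated for arbitrary finite
  index sets so that the eliminated unknown can simply be dropped from the index set.
\<close>

lemma underdetermined_system:
  fixes m :: "'i \<Rightarrow> 'j \<Rightarrow> complex"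
  assumes "finite I" "finite J" "card I < card J"
  shows "\<exists>c. (\<exists>j\<in>J. c j \<noteq> 0) \<and> (\<forall>i\<in>I. (\<Sum>j\<in>J. c j * m i j) = 0)"
  using assms
proof (induction I arbitrary: J m rule: finite_induct)
  case empty
  then obtain j where "j \<in> J" by fastforce
  then show ?case by (intro exI[of _ "\<lambda>_. 1"]) auto
next
  case (insert i0 I)
  show ?case
  proof (cases "\<forall>j\<in>J. m i0 j = 0")
    case True
    have "card I < card J" using insert by simp
    then obtain c where "\<exists>j\<in>J. c j \<noteq> 0" "\<forall>i\<in>I. (\<Sum>j\<in>J. c j * m i j) = 0"
      using insert.IH[of J m] insert.prems by blast
    then show ?thesis using True by (intro exI[of _ c]) auto
  next
    case False
    then obtain j0 where j0: "j0 \<in> J" "m i0 j0 \<noteq> 0" by blast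
    define J' where "J' = J - {j0}"
    have J': "finite J'" "card I < card J'" "J = insert j0 J'" "j0 \<notin> J'"
      using insert j0 by (auto simp: J'_def)
    obtain c where c: "\<exists>j\<in>J'. c j \<noteq> 0"
      and c0: "\<forall>i\<in>I. (\<Sum>j\<in>J'. c j * (m i j - m i0 j / m i0 j0 * m i j0)) = 0"
      using insert.IH[OF J'(1,2), of "\<lambda>i j. m i j - m i0 j / m i0 j0 * m i j0"] by blast
    define s where "s = (\<Sum>j\<in>J'. c j * m i0 j) / m i0 j0"
    define d where "d = (\<lambda>j. if j = j0 then - s else c j)"
    have d_sum: "(\<Sum>j\<in>J. d j * m i j) = (\<Sum>j\<in>J'. c j * m i j) - s * m i j0" for i
    proof -
      have "(\<Sum>j\<in>J'. d j * m i j) = (\<Sum>j\<in>J'. c j * m i j)"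
        using J'(4) by (intro sum.cong) (auto simp: d_def)
      then show ?thesis using J' by (simp add: d_def)
    qed
    have "(\<Sum>j\<in>J. d j * m i0 j) = 0"
      unfolding d_sum using j0 by (simp add: s_def)
    moreover have "(\<Sum>j\<in>J. d j * m i j) = 0" if "i \<in> I" for i
    proof -
      have "(\<Sum>j\<in>J'. c j * m i j) - s * m i j0
          = (\<Sum>j\<in>J'. c j * (m i j - m i0 j / m i0 j0 * m i j0))"
        by (simp add: s_def sum_divide_distrib sum_distrib_right sum_subtractf[symmetric]
            right_diff_distrib mult.assoc)
      then show ?thesis unfolding d_sum using c0 that by simp
    qed
    moreover have "\<exists>j\<in>J. d j \<noteq> 0" using c J' by (auto simp: d_def)
    ultimately show ?thesis by (intro exI[of _ d]) auto
  qed
qed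

text \<open>
  Minimise over \<open>t\<close>.  In the Cauchy-Schwarz inequality the quadratic is the value of a form at
  \<open>u - t \<sigma> v\<close>, where \<open>\<sigma>\<close> is its value at the pair \<open>(u, v)\<close> and \<open>s = |\<sigma>|\<^sup>2\<close>.
\<close>

lemma quadratic_nonneg_imp_le:
  fixes a b s :: real
  assumes "\<And>t. 0 \<le> a - 2 * t * s + t\<^sup>2 * s * b" and "b \<ge> 0" "s \<ge> 0"
  shows "s \<le> a * b"
proof (cases "b = 0")
  case True
  have "s = 0"
  proof (rule ccontr)
    assume "s \<noteq> 0"
    moreover have "0 \<le> a" using assms(1)[of 0] by simp
    ultimately show False using assms(1)[of "(a + 1) / s"] True by simp
  qed
  then show ?thesis using True by simp
next
  case False
  then have "0 \<le> a - 2 * (1/b) * s + (1/b)\<^sup>2 * s * b" using assms(1) by blast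
  then show ?thesis using False assms(2) by (simp add: field_simps power2_eq_square)
qed

definition neg_index :: "'v hilbert \<Rightarrow> ('v \<Rightarrow> real) \<Rightarrow> enat" where
  "neg_index H q =
    Sup {hdim H L | L. hsubspace H L \<and> (\<forall>u\<in>L. u \<noteq> hzero H \<longrightarrow> q u < 0)}"

lemma form_count_eq_neg_index:
  "form_count H t A = neg_index H (\<lambda>u. t * (hnorm H u)\<^sup>2 - Re (hinner H (A u) u))"
  unfolding form_count_def neg_index_def by simp

text \<open>
  The last axiom takes the place of the vector space laws and of definiteness: a vector is
  determined by its inner products, so every identity between vectors can be checked by expanding
  inner products, which is a rewriting task.
\<close>

locale inner_space =
  fixes H :: "'v hilbert"
  assumes zero_closed [simp]: "hzero H \<in> hcarrier H"
    and add_closed [simp]: "\<lbrakk>u \<in> hcarrier H; v \<in> hcarrier H\<rbrakk> \<Longrightarrow> hadd H u v \<in> hcarrier H"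
    and scale_closed [simp]: "u \<in> hcarrier H \<Longrightarrow> hscale H c u \<in> hcarrier H"
    and inner_zero [simp]: "w \<in> hcarrier H \<Longrightarrow> hinner H (hzero H) w = 0"
    and inner_add [simp]: "\<lbrakk>u \<in> hcarrier H; v \<in> hcarrier H; w \<in> hcarrier H\<rbrakk> \<Longrightarrow>
      hinner H (hadd H u v) w = hinner H u w + hinner H v w"
    and inner_scale [simp]: "\<lbrakk>u \<in> hcarrier H; w \<in> hcarrier H\<rbrakk> \<Longrightarrow>
      hinner H (hscale H c u) w = c * hinner H u w"
    and inner_commute: "\<lbrakk>u \<in> hcarrier H; v \<in> hcarrier H\<rbrakk> \<Longrightarrow> hinner H v u = cnj (hinner H u v)"
    and inner_self_nonneg [simp]: "u \<in> hcarrier H \<Longrightarrow> 0 \<le> Re (hinner H u u)"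
    and inner_ext: "\<lbrakk>u \<in> hcarrier H; v \<in> hcarrier H;
      \<And>w. w \<in> hcarrier H \<Longrightarrow> hinner H u w = hinner H v w\<rbrakk> \<Longrightarrow> u = v"
begin

abbreviation "C \<equiv> hcarrier H"
abbreviation "ip \<equiv> hinner H"
abbreviation nsq where "nsq u \<equiv> Re (hinner H u u)"

lemma ip_zero_right [simp]: "u \<in> C \<Longrightarrow> ip u (hzero H) = 0"
  by (subst inner_commute) auto

lemma ip_add_right [simp]: "\<lbrakk>u \<in> C; v \<in> C; w \<in> C\<rbrakk> \<Longrightarrow> ip w (hadd H u v) = ip w u + ip w v"
  using inner_commute[of "hadd H u v" w] inner_commute[of u w] inner_commute[of v w] by simp

lemma ip_scale_right [simp]: "\<lbrakk>u \<in> C; w \<in> C\<rbrakk> \<Longrightarrow> ip w (hscale H c u) = cnj c * ip w u"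
  using inner_commute[of "hscale H c u" w] inner_commute[of u w] by simp

lemma ip_self: "u \<in> C \<Longrightarrow> ip u u = of_real (nsq u)"
  using inner_commute[of u u] by (simp add: complex_eq_iff)

lemma hnorm_sq: "u \<in> C \<Longrightarrow> (hnorm H u)\<^sup>2 = nsq u"
  by (simp add: hnorm_def)

text \<open>
  The Cauchy-Schwarz inequality for the form \<open>(P u, v)\<close>, which may be degenerate.  The hypotheses
  mention only the two vectors concerned, because positivity will hold merely on subspaces.
\<close>
lemma form_Cauchy_Schwarz:
  assumes P: "P u \<in> C" "P v \<in> C" "u \<in> C" "v \<in> C"
    and sym: "ip (P v) u = cnj (ip (P u) v)"
    and lin: "\<And>c. P (hadd H u (hscale H c v)) = hadd H (P u) (hscale H c (P v))"
    and pos: "\<And>c. 0 \<le> Re (ip (P (hadd H u (hscale H c v))) (hadd H u (hscale H c v)))"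
    and posv: "0 \<le> Re (ip (P v) v)"
    and real: "Im (ip (P v) v) = 0"
  shows "(norm (ip (P u) v))\<^sup>2 \<le> Re (ip (P u) u) * Re (ip (P v) v)"
proof (rule quadratic_nonneg_imp_le)
  fix t :: real
  let ?s = "ip (P u) v"
  have v: "ip (P v) v = of_real (Re (ip (P v) v))" using real by (simp add: complex_eq_iff)
  have "0 \<le> Re (ip (P u) u + cnj (- of_real t * ?s) * ?s + (- of_real t * ?s) * cnj ?s
      + (- of_real t * ?s) * cnj (- of_real t * ?s) * ip (P v) v)"
    using pos[of "- of_real t * ?s"] P by (simp add: lin sym algebra_simps)
  also have "\<dots> = Re (ip (P u) u) - 2 * t * (norm ?s)\<^sup>2 + t\<^sup>2 * (norm ?s)\<^sup>2 * Re (ip (P v) v)"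
    unfolding cmod_power2 by (subst v) (simp add: algebra_simps power2_eq_square)
  finally show "0 \<le> Re (ip (P u) u) - 2 * t * (norm ?s)\<^sup>2 + t\<^sup>2 * (norm ?s)\<^sup>2 * Re (ip (P v) v)" .
qed (use posv in auto)

lemma Cauchy_Schwarz: "\<lbrakk>u \<in> C; v \<in> C\<rbrakk> \<Longrightarrow> (norm (ip u v))\<^sup>2 \<le> nsq u * nsq v"
  using form_Cauchy_Schwarz[of "\<lambda>u. u" u v] ip_self[of v]
  by (metis Im_complex_of_real add_closed inner_commute inner_self_nonneg scale_closed)

lemma Cauchy_Schwarz_sqrt: "\<lbrakk>u \<in> C; v \<in> C\<rbrakk> \<Longrightarrow> norm (ip u v) \<le> sqrt (nsq u) * sqrt (nsq v)"
  using Cauchy_Schwarz[of u v] by (metis real_le_rsqrt real_sqrt_mult)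

lemma nsq_eq_0: "u \<in> C \<Longrightarrow> nsq u = 0 \<longleftrightarrow> u = hzero H"
proof
  assume u: "u \<in> C" "nsq u = 0"
  have "ip u w = 0" if "w \<in> C" for w
    using Cauchy_Schwarz[OF u(1) that] u by simp
  then show "u = hzero H" using u by (intro inner_ext) auto
qed simp

lemma nsq_pos: "u \<in> C \<Longrightarrow> u \<noteq> hzero H \<Longrightarrow> nsq u > 0"
  using nsq_eq_0 inner_self_nonneg by (metis less_eq_real_def)

lemma hlincomb_closed [simp]: "(\<And>i. i < n \<Longrightarrow> u i \<in> C) \<Longrightarrow> hlincomb H n c u \<in> C"
  by (induction n) auto

lemma ip_hlincomb:
  "\<lbrakk>\<And>i. i < n \<Longrightarrow> u i \<in> C; w \<in> C\<rbrakk> \<Longrightarrow> ip (hlincomb H n c u) w = (\<Sum>i<n. c i * ip (u i) w)"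
  by (induction n) auto

lemma hlincomb_in_subspace: "hsubspace H L \<Longrightarrow> (\<And>i. i < n \<Longrightarrow> u i \<in> L) \<Longrightarrow> hlincomb H n c u \<in> L"
  by (induction n) (auto simp: hsubspace_def)

lemma hlincomb_eq_zero_iff:
  assumes "\<And>i. i < n \<Longrightarrow> u i \<in> C"
  shows "hlincomb H n c u = hzero H \<longleftrightarrow> (\<forall>w\<in>C. (\<Sum>i<n. c i * ip (u i) w) = 0)"
proof -
  have "(\<forall>w\<in>C. (\<Sum>i<n. c i * ip (u i) w) = 0) \<longleftrightarrow> (\<forall>w\<in>C. ip (hlincomb H n c u) w = ip (hzero H) w)"
    using assms ip_hlincomb[of n u] by simp
  then show ?thesis
    using assms inner_ext[of "hlincomb H n c u" "hzero H"] hlincomb_closed[of n u c] by auto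
qed

lemma hindependent_mono:
  assumes "hindependent H n u" "m \<le> n" "\<And>i. i < n \<Longrightarrow> u i \<in> C"
  shows "hindependent H m u"
  unfolding hindependent_def
proof safe
  fix c i assume z: "hlincomb H m c u = hzero H" and i: "i < m"
  let ?c = "\<lambda>i. if i < m then c i else 0"
  have "(\<Sum>i<n. ?c i * ip (u i) w) = (\<Sum>i<m. c i * ip (u i) w)" for w
    using assms(2) by (intro sum.mono_neutral_cong_right) auto
  moreover have "\<forall>w\<in>C. (\<Sum>i<m. c i * ip (u i) w) = 0"
    using z hlincomb_eq_zero_iff[of m u c] assms(2,3) by (meson order_less_le_trans)
  ultimately have "hlincomb H n ?c u = hzero H"
    using iffD2[OF hlincomb_eq_zero_iff[of n u ?c]] assms(3) by simp
  then have "\<forall>i<n. ?c i = 0" using assms(1) unfolding hindependent_def by blast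
  then have "i < n \<longrightarrow> ?c i = 0" by blast
  then show "c i = 0" using assms(2) i by simp
qed

lemma le_hdim_iff:
  assumes "L \<subseteq> C"
  shows "enat n \<le> hdim H L \<longleftrightarrow> (\<exists>u. (\<forall>i<n. u i \<in> L) \<and> hindependent H n u)"
proof
  assume "\<exists>u. (\<forall>i<n. u i \<in> L) \<and> hindependent H n u"
  then show "enat n \<le> hdim H L" unfolding hdim_def by (intro Sup_upper) auto
next
  assume n: "enat n \<le> hdim H L"
  show "\<exists>u. (\<forall>i<n. u i \<in> L) \<and> hindependent H n u"
  proof (cases n)
    case (Suc m)
    then have "enat m < hdim H L" using n by (metis enat_ord_simps(2) lessI less_le_trans)
    then obtain k u where u: "m < k" "\<forall>i<k. u i \<in> L" "hindependent H k u"
      unfolding hdim_def less_Sup_iff by auto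
    then show ?thesis using hindependent_mono[of k u n] assms Suc by (intro exI[of _ u]) auto
  qed (simp add: hindependent_def)
qed

lemma kernel_combination:
  assumes "hindependent H n u" "\<And>i. i < n \<Longrightarrow> u i \<in> C" "\<And>i. i < N \<Longrightarrow> b i \<in> C" "N < n"
  obtains c where "hlincomb H n c u \<noteq> hzero H" "\<And>i. i < N \<Longrightarrow> ip (hlincomb H n c u) (b i) = 0"
proof -
  obtain c where c: "\<exists>j\<in>{..<n}. c j \<noteq> 0" "\<forall>i\<in>{..<N}. (\<Sum>j\<in>{..<n}. c j * ip (u j) (b i)) = 0"
    using underdetermined_system[of "{..<N}" "{..<n}" "\<lambda>i j. ip (u j) (b i)"] assms(4) by auto
  show thesis
  proof
    show "hlincomb H n c u \<noteq> hzero H" using c(1) assms(1) by (auto simp: hindependent_def)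
    show "ip (hlincomb H n c u) (b i) = 0" if "i < N" for i
      using c(2) that assms by (subst ip_hlincomb) auto
  qed
qed

text \<open>
  This bounds the dimension of subspaces on which a form is negative, when the form is nonnegative
  on the orthogonal complement of \<open>b\<close>.
\<close>

lemma hdim_le_of_orthogonal_trivial:
  assumes L: "hsubspace H L" and b: "\<And>i. i < N \<Longrightarrow> b i \<in> C"
    and triv: "\<And>u. \<lbrakk>u \<in> L; \<And>i. i < N \<Longrightarrow> ip u (b i) = 0\<rbrakk> \<Longrightarrow> u = hzero H"
  shows "hdim H L \<le> enat N"
proof (rule ccontr)
  have LC: "L \<subseteq> C" using L by (simp add: hsubspace_def)
  assume "\<not> hdim H L \<le> enat N"
  then have "enat (Suc N) \<le> hdim H L"
    by (simp add: Suc_ile_eq)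
  then obtain u where u: "\<forall>i<Suc N. u i \<in> L" "hindependent H (Suc N) u"
    using le_hdim_iff[OF LC] by blast
  obtain c where "hlincomb H (Suc N) c u \<noteq> hzero H"
      "\<And>i. i < N \<Longrightarrow> ip (hlincomb H (Suc N) c u) (b i) = 0"
    using kernel_combination[of "Suc N" u N b] u b LC by blast
  then show False using triv hlincomb_in_subspace[OF L] u(1) by blast
qed

text \<open>
  By maximality \<open>e\<close> depends linearly on the family, and its own coefficient cannot vanish.  Thus
  orthogonality to a subspace is tested by finitely many vectors.
\<close>
lemma orthogonal_to_maximal_independent:
  assumes L: "hsubspace H L" and n: "hdim H L = enat n"
    and b: "\<And>i. i < n \<Longrightarrow> b i \<in> L" "hindependent H n b"
    and u: "u \<in> C" "\<And>i. i < n \<Longrightarrow> ip u (b i) = 0" and e: "e \<in> L"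
  shows "ip u e = 0"
proof -
  have LC: "L \<subseteq> C" using L by (simp add: hsubspace_def)
  define b' where "b' = (\<lambda>i. if i < n then b i else e)"
  have b'C: "\<And>i. i < Suc n \<Longrightarrow> b' i \<in> L" using b e by (auto simp: b'_def)
  have "\<not> enat (Suc n) \<le> hdim H L" using n by simp
  then have "\<not> hindependent H (Suc n) b'"
    using le_hdim_iff[OF LC, of "Suc n"] b'C by blast
  then obtain c j where c: "hlincomb H (Suc n) c b' = hzero H" "j < Suc n" "c j \<noteq> 0"
    by (auto simp: hindependent_def)
  have sum0: "(\<Sum>i<n. c i * ip (b i) w) + c n * ip e w = 0" if "w \<in> C" for w
  proof -
    have "(\<Sum>i<Suc n. c i * ip (b' i) w) = 0"
      using c(1) that hlincomb_eq_zero_iff[of "Suc n" b' c] b'C LC by blast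
    then show ?thesis by (simp add: b'_def)
  qed
  have cn: "c n \<noteq> 0"
  proof
    assume "c n = 0"
    then have "hlincomb H n c b = hzero H"
      using sum0 b LC by (subst hlincomb_eq_zero_iff) auto
    then have "\<forall>i<n. c i = 0" using b(2) by (simp add: hindependent_def)
    then show False using c \<open>c n = 0\<close> by (metis less_SucE)
  qed
  have "ip (b i) u = 0" if "i < n" for i
    using u(2)[OF that] u(1) b(1)[OF that] LC by (subst inner_commute) auto
  then have "c n * ip e u = 0" using sum0[OF u(1)] by simp
  then show ?thesis using cn u(1) e LC by (subst inner_commute) auto
qed

end

text \<open>
  A linear map that preserves negativity of the forms is injective on every negative subspace, since
  it cannot send a vector with negative value to \<open>0\<close>; so it maps negative subspaces to negative
  subspaces of the same dimension.
\<close>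
lemma neg_index_le:
  assumes H: "inner_space H" and K: "inner_space K"
    and closed: "\<And>u. u \<in> hcarrier H \<Longrightarrow> \<Phi> u \<in> hcarrier K"
    and add: "\<And>u v. \<lbrakk>u \<in> hcarrier H; v \<in> hcarrier H\<rbrakk> \<Longrightarrow> \<Phi> (hadd H u v) = hadd K (\<Phi> u) (\<Phi> v)"
    and scale: "\<And>c u. u \<in> hcarrier H \<Longrightarrow> \<Phi> (hscale H c u) = hscale K c (\<Phi> u)"
    and zero: "\<Phi> (hzero H) = hzero K"
    and neg: "\<And>u. \<lbrakk>u \<in> hcarrier H; qH u < 0\<rbrakk> \<Longrightarrow> qK (\<Phi> u) < 0"
    and qK0: "qK (hzero K) = 0"
  shows "neg_index H qH \<le> neg_index K qK"
  unfolding neg_index_def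
proof (rule Sup_mono, safe)
  interpret H: inner_space H by fact
  interpret K: inner_space K by fact
  fix L assume L: "hsubspace H L" and n: "\<forall>u\<in>L. u \<noteq> hzero H \<longrightarrow> qH u < 0"
  have LC: "L \<subseteq> hcarrier H" using L by (simp add: hsubspace_def)
  have LC': "\<Phi> ` L \<subseteq> hcarrier K" using LC closed by auto
  have sub: "hsubspace K (\<Phi> ` L)"
    unfolding hsubspace_def
  proof (intro conjI ballI allI)
    show "hzero K \<in> \<Phi> ` L" using L zero by (metis hsubspace_def imageI)
    fix x y c assume "x \<in> \<Phi> ` L"
    then obtain u where u: "u \<in> L" "x = \<Phi> u" by blast
    show "hscale K c x \<in> \<Phi> ` L"
      using u scale[of u c] L LC by (metis hsubspace_def imageI subsetD)
    assume "y \<in> \<Phi> ` L"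
    then obtain v where v: "v \<in> L" "y = \<Phi> v" by blast
    show "hadd K x y \<in> \<Phi> ` L"
      using u v add[of u v] L LC by (metis hsubspace_def imageI subsetD)
  qed (use LC' in auto)
  have inj: "u = hzero H" if "u \<in> L" "\<Phi> u = hzero K" for u
  proof (rule ccontr)
    assume "u \<noteq> hzero H"
    then have "qK (\<Phi> u) < 0" using n neg that LC by blast
    then show False using that qK0 by simp
  qed
  have lin: "\<Phi> (hlincomb H m c u) = hlincomb K m c (\<lambda>i. \<Phi> (u i))" if "\<And>i. i < m \<Longrightarrow> u i \<in> L" for m c u
    using that LC by (induction m) (auto simp: zero add scale subset_iff)
  have "hdim H L \<le> hdim K (\<Phi> ` L)"
    unfolding hdim_def
  proof (rule Sup_subset_mono, safe)
    fix m u assume u: "\<forall>i<m. u i \<in> L" "hindependent H m u"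
    have "hindependent K m (\<lambda>i. \<Phi> (u i))"
      unfolding hindependent_def
    proof safe
      fix c i assume "hlincomb K m c (\<lambda>i. \<Phi> (u i)) = hzero K" "i < m"
      then have "hlincomb H m c u = hzero H"
        using lin[of m u c] u inj H.hlincomb_in_subspace[OF L] by metis
      then show "c i = 0" using u(2) \<open>i < m\<close> by (simp add: hindependent_def)
    qed
    then show "\<exists>n. enat m = enat n \<and> (\<exists>u. (\<forall>i<n. u i \<in> \<Phi> ` L) \<and> hindependent K n u)"
      using u(1) by (intro exI[of _ m] conjI refl exI[of _ "\<lambda>i. \<Phi> (u i)"]) auto
  qed
  moreover have "\<forall>v\<in>\<Phi> ` L. v \<noteq> hzero K \<longrightarrow> qK v < 0"
    using n neg LC zero by (metis imageE subsetD)
  ultimately show "\<exists>a\<in>{hdim K L |L. hsubspace K L \<and> (\<forall>u\<in>L. u \<noteq> hzero K \<longrightarrow> qK u < 0)}. hdim H L \<le> a"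
    using sub by blast
qed

section \<open>Isolated infima of quadratic forms\<close>

text \<open>
  Completeness in the form used by the iteration that produces eigenvectors: its steps decrease
  geometrically, and a weak limit is enough to identify the kernel.  In this form completeness passes
  easily to direct sums and to the symmetric functions.
\<close>

definition geometrically_complete :: "'v hilbert \<Rightarrow> bool" where
  "geometrically_complete H \<longleftrightarrow>
    (\<forall>u M q. (\<forall>n. u n \<in> hcarrier H) \<and> 0 < q \<and> q < 1 \<and>
      (\<forall>n. (hnorm H (hadd H (u (Suc n)) (hscale H (- 1) (u n))))\<^sup>2 \<le> M * q ^ n) \<longrightarrow>
      (\<exists>l\<in>hcarrier H. \<forall>w\<in>hcarrier H. (\<lambda>n. hinner H (u n) w) \<longlonglongrightarrow> hinner H l w))"

context inner_space
begin

lemma hsubspaceD: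
  assumes "hsubspace H G" "u \<in> G" "v \<in> G"
  shows "u \<in> C" "hadd H u v \<in> G" "hscale H c u \<in> G" "hzero H \<in> G"
  using assms by (auto simp: hsubspace_def)

text \<open>
  Apply the Cauchy-Schwarz inequality of the form \<open>(P u, v)\<close> to \<open>u\<close> and \<open>P u\<close>.  The first conclusion
  says that \<open>P\<close> nearly annihilates vectors on which its form is nearly \<open>0\<close>; it links infima of
  forms to the spectrum.
\<close>

lemma positive_op_bound:
  assumes P: "\<And>u. u \<in> C \<Longrightarrow> P u \<in> C" and sym: "\<And>u v. \<lbrakk>u \<in> C; v \<in> C\<rbrakk> \<Longrightarrow> ip (P u) v = ip u (P v)"
    and bd: "\<And>u. u \<in> C \<Longrightarrow> nsq (P u) \<le> L\<^sup>2 * nsq u" and L: "0 \<le> L"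
    and G: "hsubspace H G" and inv: "\<And>u. u \<in> G \<Longrightarrow> P u \<in> G"
    and pos: "\<And>u. u \<in> G \<Longrightarrow> 0 \<le> Re (ip (P u) u)" and u: "u \<in> G"
  shows "nsq (P u) \<le> L * Re (ip (P u) u)"
    and "(nsq (P u))\<^sup>2 \<le> Re (ip (P u) u) * Re (ip (P (P u)) (P u))"
proof -
  note GC = hsubspaceD[OF G]
  have uC: "u \<in> C" "P u \<in> C" "P (P u) \<in> C" using GC(1)[OF u u] P by auto
  have lin: "P (hadd H x (hscale H c y)) = hadd H (P x) (hscale H c (P y))" if "x \<in> C" "y \<in> C" for x y c
    using that P by (intro inner_ext) (auto simp: sym)
  have im: "Im (ip (P v) v) = 0" if "v \<in> C" for v
    using sym[OF that that] inner_commute[of v "P v"] P[OF that] that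
    by (metis complex_cnj_cancel_iff complex_cnj_cnj Reals_cnj_iff complex_is_Real_iff)
  have "(norm (ip (P u) (P u)))\<^sup>2 \<le> Re (ip (P u) u) * Re (ip (P (P u)) (P u))"
  proof (rule form_Cauchy_Schwarz)
    show "ip (P (P u)) u = cnj (ip (P u) (P u))"
      using sym[OF uC(2,1)] inner_commute[of "P u" "P u"] uC by simp
    show "0 \<le> Re (ip (P (hadd H u (hscale H c (P u)))) (hadd H u (hscale H c (P u))))" for c
      using GC[of u u] GC[of "P u" "P u"] GC[of u "hscale H c (P u)"] u inv by (intro pos) auto
    show "0 \<le> Re (ip (P (P u)) (P u))" using pos inv u by blast
  qed (use uC im lin in auto)
  then show CS: "(nsq (P u))\<^sup>2 \<le> Re (ip (P u) u) * Re (ip (P (P u)) (P u))"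
    using ip_self[OF uC(2)] by (metis norm_of_real power2_abs)
  have "Re (ip (P (P u)) (P u)) \<le> norm (ip (P (P u)) (P u))" by (rule complex_Re_le_cmod)
  also have "\<dots> \<le> sqrt (nsq (P (P u))) * sqrt (nsq (P u))" by (rule Cauchy_Schwarz_sqrt) (use uC in auto)
  also have "\<dots> \<le> sqrt (L\<^sup>2 * nsq (P u)) * sqrt (nsq (P u))"
    using bd[OF uC(2)] uC by (intro mult_right_mono) auto
  also have "\<dots> = L * nsq (P u)" using L uC by (simp add: real_sqrt_mult)
  finally have b: "Re (ip (P (P u)) (P u)) \<le> L * nsq (P u)" .
  show "nsq (P u) \<le> L * Re (ip (P u) u)"
  proof (cases "nsq (P u) = 0")
    case True
    then show ?thesis using pos[OF u] L by simp
  next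
    case False
    then have pu: "nsq (P u) > 0" using uC inner_self_nonneg[of "P u"] by linarith
    have "(nsq (P u))\<^sup>2 \<le> Re (ip (P u) u) * (L * nsq (P u))"
      using CS mult_left_mono[OF b pos[OF u]] by linarith
    then have "nsq (P u) * nsq (P u) \<le> (L * Re (ip (P u) u)) * nsq (P u)"
      by (simp add: power2_eq_square mult_ac)
    then show ?thesis using pu by (rule mult_right_le_imp_le)
  qed
qed

lemma nsq_add_scale_le:
  assumes "u \<in> C" "v \<in> C"
  shows "nsq (hadd H u (hscale H c v)) \<le> (sqrt (nsq u) + norm c * sqrt (nsq v))\<^sup>2"
proof -
  have "nsq (hadd H u (hscale H c v)) = nsq u + Re (cnj c * ip u v) + Re (c * ip v u) + (norm c)\<^sup>2 * nsq v"
    using assms ip_self[of v] unfolding cmod_power2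
    by (simp add: algebra_simps power2_eq_square)
  also have "Re (c * ip v u) = Re (cnj c * ip u v)"
    using inner_commute[OF assms] by simp
  also have "Re (cnj c * ip u v) \<le> norm c * (sqrt (nsq u) * sqrt (nsq v))"
    using complex_Re_le_cmod[of "cnj c * ip u v"] Cauchy_Schwarz_sqrt[OF assms]
    by (smt (verit, best) complex_mod_cnj mult_left_mono norm_ge_zero norm_mult)
  finally show ?thesis using assms by (simp add: power2_sum power_mult_distrib algebra_simps)
qed

end

locale symm_op = inner_space H for H :: "'v hilbert" +
  fixes A :: "'v \<Rightarrow> 'v" and K :: real
  assumes A_closed [simp]: "u \<in> hcarrier H \<Longrightarrow> A u \<in> hcarrier H"
    and A_sym: "\<lbrakk>u \<in> hcarrier H; v \<in> hcarrier H\<rbrakk> \<Longrightarrow> hinner H (A u) v = hinner H u (A v)"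
    and A_bound: "u \<in> hcarrier H \<Longrightarrow> Re (hinner H (A u) (A u)) \<le> K\<^sup>2 * Re (hinner H u u)"
    and K_nonneg: "0 \<le> K"
begin

definition S where "S t = shifted_op H A (complex_of_real t)"
abbreviation Q where "Q u \<equiv> Re (hinner H (A u) u)"

lemma S_closed [simp]: "u \<in> C \<Longrightarrow> S t u \<in> C"
  by (simp add: S_def shifted_op_def)

lemma ip_S: "\<lbrakk>u \<in> C; w \<in> C\<rbrakk> \<Longrightarrow> ip (S t u) w = ip (A u) w - of_real t * ip u w"
  by (simp add: S_def shifted_op_def)

lemma ip_S_right: "\<lbrakk>u \<in> C; w \<in> C\<rbrakk> \<Longrightarrow> ip w (S t u) = ip w (A u) - of_real t * ip w u"
  by (simp add: S_def shifted_op_def)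

lemma S_sym: "\<lbrakk>u \<in> C; v \<in> C\<rbrakk> \<Longrightarrow> ip (S t u) v = ip u (S t v)"
  by (simp add: ip_S ip_S_right A_sym)

lemma S_bound: "u \<in> C \<Longrightarrow> nsq (S t u) \<le> (K + \<bar>t\<bar>)\<^sup>2 * nsq u"
proof -
  assume u: "u \<in> C"
  have "nsq (S t u) \<le> (sqrt (nsq (A u)) + \<bar>t\<bar> * sqrt (nsq u))\<^sup>2"
    using nsq_add_scale_le[of "A u" u "- of_real t"] u by (simp add: S_def shifted_op_def)
  also have "sqrt (nsq (A u)) \<le> K * sqrt (nsq u)"
    using A_bound[OF u] K_nonneg by (metis abs_of_nonneg real_sqrt_abs real_sqrt_le_iff real_sqrt_mult)
  then have "(sqrt (nsq (A u)) + \<bar>t\<bar> * sqrt (nsq u))\<^sup>2 \<le> (K * sqrt (nsq u) + \<bar>t\<bar> * sqrt (nsq u))\<^sup>2"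
    using u by (intro power_mono) auto
  also have "\<dots> = (K + \<bar>t\<bar>)\<^sup>2 * nsq u"
    using u by (simp add: distrib_right[symmetric] power_mult_distrib)
  finally show ?thesis .
qed

lemma S_triangle:
  "u \<in> C \<Longrightarrow> sqrt (nsq (S x u)) \<le> sqrt (nsq (S t u)) + \<bar>t - x\<bar> * sqrt (nsq u)"
proof -
  assume u: "u \<in> C"
  have "S x u = hadd H (S t u) (hscale H (of_real (t - x)) u)"
    using u by (intro inner_ext) (auto simp: ip_S algebra_simps)
  then have "nsq (S x u) \<le> (sqrt (nsq (S t u)) + \<bar>t - x\<bar> * sqrt (nsq u))\<^sup>2"
    using nsq_add_scale_le[of "S t u" u "of_real (t - x)"] u by (simp del: of_real_diff)
  then show ?thesis using u by (intro real_le_lsqrt) auto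
qed

text \<open>
  Among the two ways in which a spectral point can arise, failure of a lower bound and failure of
  surjectivity, only the first occurs for self-adjoint operators.  Working with lower bounds makes
  restrictions to invariant subspaces trivial.
\<close>

definition bounded_below :: "real \<Rightarrow> bool" where
  "bounded_below t \<longleftrightarrow> (\<exists>\<kappa>>0. \<forall>u\<in>C. \<kappa> * nsq u \<le> nsq (S t u))"

lemma not_bounded_below_imp_spectrum:
  assumes "\<not> bounded_below t"
  shows "of_real t \<in> spectrum H A"
  unfolding spectrum_def resolvent_set_def Compl_iff mem_Collect_eq
proof (rule notI, elim exE conjE)
  fix R assume R: "bounded_op H H R"
    and inv': "\<forall>u\<in>C. R (shifted_op H A (complex_of_real t) u) = u \<and> shifted_op H A (complex_of_real t) (R u) = u"
  then have inv: "\<forall>u\<in>C. R (S t u) = u" by (simp add: S_def)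
  from R obtain c where c: "\<forall>u\<in>C. hnorm H (R u) \<le> c * hnorm H u"
    by (auto simp: bounded_op_def)
  define d where "d = \<bar>c\<bar> + 1"
  have "(1 / d\<^sup>2) * nsq u \<le> nsq (S t u)" if u: "u \<in> C" for u
  proof -
    have "hnorm H u \<le> c * hnorm H (S t u)" using c inv u S_closed[of u t] by metis
    also have "\<dots> \<le> d * hnorm H (S t u)"
      using u by (intro mult_right_mono) (auto simp: d_def hnorm_def)
    finally have "(hnorm H u)\<^sup>2 \<le> (d * hnorm H (S t u))\<^sup>2"
      using u by (intro power_mono) (auto simp: hnorm_def)
    then have "nsq u \<le> d\<^sup>2 * nsq (S t u)" using u by (simp add: power_mult_distrib hnorm_sq)
    then show ?thesis by (simp add: d_def field_simps pos_divide_le_eq)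
  qed
  moreover have "1 / d\<^sup>2 > 0" by (simp add: d_def)
  ultimately show False using assms unfolding bounded_below_def by blast
qed

lemma bounded_below_open:
  assumes "bounded_below x"
  obtains d where "d > 0" "\<And>t. \<bar>t - x\<bar> < d \<Longrightarrow> bounded_below t"
proof -
  from assms obtain \<kappa> where \<kappa>: "\<kappa> > 0" "\<forall>u\<in>C. \<kappa> * nsq u \<le> nsq (S x u)"
    by (auto simp: bounded_below_def)
  have "bounded_below t" if t: "\<bar>t - x\<bar> < sqrt \<kappa> / 2" for t
    unfolding bounded_below_def
  proof (intro exI[of _ "(sqrt \<kappa> / 2)\<^sup>2"] conjI ballI)
    fix u assume u: "u \<in> C"
    have "sqrt \<kappa> * sqrt (nsq u) \<le> sqrt (nsq (S x u))"
      using \<kappa> u by (metis real_sqrt_le_iff real_sqrt_mult)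
    also have "\<dots> \<le> sqrt (nsq (S t u)) + \<bar>t - x\<bar> * sqrt (nsq u)" by (rule S_triangle[OF u])
    also have "\<dots> \<le> sqrt (nsq (S t u)) + sqrt \<kappa> / 2 * sqrt (nsq u)"
      using t u by (intro add_left_mono mult_right_mono) auto
    finally have "sqrt \<kappa> / 2 * sqrt (nsq u) \<le> sqrt (nsq (S t u))" by simp
    then have "(sqrt \<kappa> / 2 * sqrt (nsq u))\<^sup>2 \<le> (sqrt (nsq (S t u)))\<^sup>2"
      using \<kappa> u by (intro power_mono) auto
    then show "(sqrt \<kappa> / 2)\<^sup>2 * nsq u \<le> nsq (S t u)"
      using u \<kappa> by (simp add: power_mult_distrib power_divide)
  qed (use \<kappa> in simp)
  then show thesis using that[of "sqrt \<kappa> / 2"] \<kappa> by simp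
qed

lemma bounded_below_left:
  assumes "t < - K"
  shows "bounded_below t"
  unfolding bounded_below_def
proof (intro exI[of _ "(- K - t)\<^sup>2"] conjI ballI)
  fix u assume u: "u \<in> C"
  have s: "sqrt (nsq (A u)) \<le> K * sqrt (nsq u)"
    using A_bound[OF u] K_nonneg by (metis abs_of_nonneg real_sqrt_abs real_sqrt_le_iff real_sqrt_mult)
  have "hscale H (- of_real t) u = hadd H (S t u) (hscale H (- 1) (A u))"
    using u by (intro inner_ext) (auto simp: ip_S)
  then have "nsq (hscale H (- of_real t) u) \<le> (sqrt (nsq (S t u)) + sqrt (nsq (A u)))\<^sup>2"
    using nsq_add_scale_le[of "S t u" "A u" "- 1"] u by simp
  moreover have "nsq (hscale H (- of_real t) u) = (- t * sqrt (nsq u))\<^sup>2"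
    using u ip_self[of u] by (simp add: power_mult_distrib power2_eq_square)
  ultimately have "(- t * sqrt (nsq u))\<^sup>2 \<le> (sqrt (nsq (S t u)) + sqrt (nsq (A u)))\<^sup>2"
    by simp
  moreover have "0 \<le> sqrt (nsq (S t u)) + sqrt (nsq (A u))" using u by simp
  ultimately have "- t * sqrt (nsq u) \<le> sqrt (nsq (S t u)) + sqrt (nsq (A u))"
    by (rule power2_le_imp_le)
  then have "(- K - t) * sqrt (nsq u) \<le> sqrt (nsq (S t u))"
    using s by (simp add: algebra_simps)
  then have "((- K - t) * sqrt (nsq u))\<^sup>2 \<le> (sqrt (nsq (S t u)))\<^sup>2"
    using assms u by (intro power_mono) auto
  then show "(- K - t)\<^sup>2 * nsq u \<le> nsq (S t u)" using u by (simp add: power_mult_distrib)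
qed (use assms in simp)

lemma eigenspace_subspace: "hsubspace H (eigenspace H A \<mu>)"
proof -
  have "A (hadd H u v) = hscale H \<mu> (hadd H u v)"
    if "u \<in> C" "v \<in> C" "A u = hscale H \<mu> u" "A v = hscale H \<mu> v" for u v
  proof (rule inner_ext)
    fix w assume w: "w \<in> C"
    have "ip u (A w) = \<mu> * ip u w" "ip v (A w) = \<mu> * ip v w"
      using that w A_sym[of u w] A_sym[of v w] by auto
    then show "ip (A (hadd H u v)) w = ip (hscale H \<mu> (hadd H u v)) w"
      using that w by (simp add: A_sym algebra_simps)
  qed (use that in auto)
  moreover have "A (hscale H c u) = hscale H \<mu> (hscale H c u)" if "u \<in> C" "A u = hscale H \<mu> u" for u c
  proof (rule inner_ext)
    fix w assume w: "w \<in> C"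
    have "ip u (A w) = \<mu> * ip u w" using that w A_sym[of u w] by auto
    then show "ip (A (hscale H c u)) w = ip (hscale H \<mu> (hscale H c u)) w"
      using that w by (simp add: A_sym algebra_simps)
  qed (use that in auto)
  moreover have "A (hzero H) = hscale H \<mu> (hzero H)"
    by (intro inner_ext) (auto simp: A_sym)
  ultimately show ?thesis by (auto simp: hsubspace_def eigenspace_def)
qed

lemma eigenvalue_not_bounded_below:
  assumes "eigenvalue H A (of_real t)"
  shows "\<not> bounded_below t"
proof
  assume "bounded_below t"
  then obtain \<kappa> where \<kappa>: "\<kappa> > 0" "\<forall>u\<in>C. \<kappa> * nsq u \<le> nsq (S t u)"
    by (auto simp: bounded_below_def)
  from assms obtain u where u: "u \<in> C" "A u = hscale H (of_real t) u" "u \<noteq> hzero H"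
    by (auto simp: eigenvalue_def eigenspace_def)
  have "S t u = hzero H" using u by (intro inner_ext) (auto simp: ip_S)
  then have "\<kappa> * nsq u \<le> 0" using \<kappa>(2) u(1) by force
  then show False using \<kappa>(1) nsq_pos[OF u(1,3)] by (simp add: mult_le_0_iff)
qed

text \<open>
  Let \<open>B = A - c\<close>, a nonnegative operator on the invariant subspace \<open>G\<close> with \<open>(0, r)\<close> free of spectrum.
  The three gap estimates below show \<open>(B v, v) \<ge> r \<parallel>v\<parallel>\<^sup>2\<close> on the range of \<open>B\<close>.  Hence for \<open>L \<ge> \<parallel>B\<parallel>\<close> the
  iteration \<open>U \<mapsto> U - B U / L\<close> contracts \<open>B U\<close> by a fixed factor, so it converges to a vector in the
  kernel of \<open>B\<close>.  The starting vector is chosen with \<open>B u\<close> so small that the total displacement is at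
  most half of its length; therefore the limit does not vanish.
\<close>

lemma isolated_infimum_eigenvector:
  fixes E :: "'v set" and c r :: real
  defines "G \<equiv> {u \<in> hcarrier H. \<forall>e\<in>E. hinner H u e = 0}"
  assumes E: "E \<subseteq> C" and inv: "\<And>u. u \<in> G \<Longrightarrow> A u \<in> G"
    and lower: "\<And>u. u \<in> G \<Longrightarrow> c * nsq u \<le> Q u"
    and attained: "\<And>\<epsilon>. \<epsilon> > 0 \<Longrightarrow> \<exists>u\<in>G. u \<noteq> hzero H \<and> Q u < (c + \<epsilon>) * nsq u"
    and r: "r > 0" and isolated: "\<And>t. \<lbrakk>c < t; t < c + r\<rbrakk> \<Longrightarrow> bounded_below t"
    and complete: "geometrically_complete H"
  shows "\<exists>u\<in>G. u \<noteq> hzero H \<and> A u = hscale H (of_real c) u"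
proof -
  have GC: "u \<in> C" if "u \<in> G" for u using that by (simp add: G_def)
  have sub: "hsubspace H G" unfolding hsubspace_def G_def using E by auto
  note subD = hsubspaceD[OF sub]
  have SG: "S t u \<in> G" if "u \<in> G" for t u
    unfolding S_def shifted_op_def
    using subD(2)[OF inv[OF that] subD(3)[OF that that]] .
  define L where "L = K + \<bar>c\<bar> + 1 + r"
  have L: "L > 0" "r < L" using K_nonneg r by (auto simp: L_def)
  define B where "B = S c"
  have BC: "B u \<in> C" if "u \<in> C" for u using that by (simp add: B_def)
  have BG: "B u \<in> G" if "u \<in> G" for u using that SG by (simp add: B_def)
  have Bsym: "ip (B u) v = ip u (B v)" if "u \<in> C" "v \<in> C" for u v using that S_sym by (simp add: B_def)
  have Bpos: "0 \<le> Re (ip (B u) u)" if "u \<in> G" for u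
    using lower[OF that] GC[OF that] ip_self[of u] by (simp add: B_def ip_S)
  have Bbd: "nsq (B u) \<le> L\<^sup>2 * nsq u" if "u \<in> C" for u
  proof -
    have "(K + \<bar>c\<bar>)\<^sup>2 * nsq u \<le> L\<^sup>2 * nsq u"
      using K_nonneg r that by (intro mult_right_mono power_mono) (auto simp: L_def)
    then show ?thesis using S_bound[OF that, of c] by (simp add: B_def)
  qed
  note Bbound = positive_op_bound[where P = B and L = L and G = G, OF BC Bsym Bbd less_imp_le[OF L(1)] sub BG Bpos]
  define t where "t = r / 2"
  have t: "t > 0" using r by (simp add: t_def)
  \<comment> \<open>Let \<open>\<gamma>\<close> be the infimum of \<open>\<parallel>(B - t) u\<parallel>\<^sup>2\<close> over unit vectors.  If \<open>\<gamma> < t\<^sup>2\<close>, then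
    \<open>(B - t)\<^sup>2 - \<gamma> = (B - t - \<surd>\<gamma>) (B - t + \<surd>\<gamma>)\<close> is a nonnegative operator whose two factors are bounded
    below, as \<open>t \<plusminus> \<surd>\<gamma>\<close> lies in the spectral gap; so its form is bounded away from \<open>0\<close>, and \<open>\<gamma>\<close> can
    be increased.\<close>
  have gap1: "t\<^sup>2 * nsq u \<le> nsq (S (c + t) u)" if "u \<in> G" for u
  proof -
    define X where "X = {\<kappa>. 0 \<le> \<kappa> \<and> (\<forall>u\<in>G. \<kappa> * nsq u \<le> nsq (S (c + t) u))}"
    define \<gamma> where "\<gamma> = Sup X"
    have X0: "0 \<in> X" using GC by (auto simp: X_def)
    obtain u0 where u0: "u0 \<in> G" "u0 \<noteq> hzero H" using attained[of 1] by auto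
    have "\<kappa> \<le> nsq (S (c + t) u0) / nsq u0" if "\<kappa> \<in> X" for \<kappa>
      using that u0 nsq_pos[of u0] GC by (auto simp: X_def pos_le_divide_eq)
    then have bdd: "bdd_above X" by (meson bdd_aboveI)
    have g0: "0 \<le> \<gamma>" unfolding \<gamma>_def using X0 bdd by (rule cSup_upper)
    have g: "\<gamma> * nsq u \<le> nsq (S (c + t) u)" if "u \<in> G" for u
    proof (cases "nsq u = 0")
      case False
      then have p: "nsq u > 0" using inner_self_nonneg[OF GC[OF that]] by linarith
      have "\<gamma> \<le> nsq (S (c + t) u) / nsq u"
        unfolding \<gamma>_def using X0 that p
        by (intro cSup_least) (auto simp: X_def pos_le_divide_eq)
      then show ?thesis using p by (simp add: pos_le_divide_eq)
    qed (use that GC in auto)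
    have "t\<^sup>2 \<le> \<gamma>"
    proof (rule ccontr)
      assume "\<not> t\<^sup>2 \<le> \<gamma>"
      then have Ct: "sqrt \<gamma> < t" using t by (simp add: real_less_lsqrt)
      define C1 where "C1 = sqrt \<gamma>"
      have C1: "0 \<le> C1" "C1 < t" "C1\<^sup>2 = \<gamma>" using Ct g0 by (auto simp: C1_def)
      define P where "P = (\<lambda>u. S (c + t + C1) (S (c + t - C1) u))"
      have PC: "P u \<in> C" if "u \<in> C" for u using that by (simp add: P_def)
      have Pip: "ip (P u) v = ip (S (c + t) u) (S (c + t) v) - of_real \<gamma> * ip u v"
        if "u \<in> C" "v \<in> C" for u v
        unfolding P_def using that
        by (simp add: S_sym[of "S (c + t - C1) u"] C1(3)[symmetric])
          (simp add: ip_S ip_S_right A_sym algebra_simps power2_eq_square)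
      have Psym: "ip (P u) v = ip u (P v)" if "u \<in> C" "v \<in> C" for u v
        using that inner_commute[of u "P v"] inner_commute[of "S (c + t) u" "S (c + t) v"]
          inner_commute[of u v] inner_commute[of "P v" u] PC by (simp add: Pip)
      define L1 where "L1 = K + \<bar>c + t + C1\<bar>"
      define L2 where "L2 = K + \<bar>c + t - C1\<bar>"
      have L12: "0 \<le> L1" "0 \<le> L2" using K_nonneg by (auto simp: L1_def L2_def)
      have Pbd: "nsq (P u) \<le> (L1 * L2)\<^sup>2 * nsq u" if "u \<in> C" for u
      proof -
        have "nsq (P u) \<le> L1\<^sup>2 * nsq (S (c + t - C1) u)"
          unfolding P_def L1_def using that by (intro S_bound) simp
        also have "\<dots> \<le> L1\<^sup>2 * (L2\<^sup>2 * nsq u)"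
          unfolding L2_def using that by (intro mult_left_mono S_bound) auto
        finally show ?thesis by (simp add: power_mult_distrib)
      qed
      have PG: "P u \<in> G" if "u \<in> G" for u using that SG by (simp add: P_def)
      have Pre: "Re (ip (P u) u) = nsq (S (c + t) u) - \<gamma> * nsq u" if "u \<in> C" for u
        using that Pip[OF that that] by simp
      have Ppos: "0 \<le> Re (ip (P u) u)" if "u \<in> G" for u
        using g[OF that] Pre[OF GC[OF that]] by simp
      have PP: "nsq (P u) \<le> L1 * L2 * Re (ip (P u) u)" if "u \<in> G" for u
        using positive_op_bound(1)[where P = P and L = "L1 * L2" and G = G, OF PC Psym Pbd _ sub PG Ppos that] L12 by simp
      have "bounded_below (c + t + C1)" "bounded_below (c + t - C1)"
        using isolated C1 t r by (auto simp: t_def)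
      then obtain k1 k2 where k: "k1 > 0" "\<forall>u\<in>C. k1 * nsq u \<le> nsq (S (c + t + C1) u)"
          "k2 > 0" "\<forall>u\<in>C. k2 * nsq u \<le> nsq (S (c + t - C1) u)"
        by (auto simp: bounded_below_def)
      define \<delta> where "\<delta> = k1 * k2 / (L1 * L2 + 1)"
      have \<delta>: "\<delta> > 0" using k L12 by (simp add: \<delta>_def add_nonneg_pos)
      have "(\<gamma> + \<delta>) * nsq u \<le> nsq (S (c + t) u)" if u: "u \<in> G" for u
      proof -
        have "k1 * (k2 * nsq u) \<le> k1 * nsq (S (c + t - C1) u)"
          using k GC[OF u] by (intro mult_left_mono) auto
        also have "\<dots> \<le> nsq (P u)" unfolding P_def using k GC[OF u] by simp
        also have "\<dots> \<le> L1 * L2 * Re (ip (P u) u)" by (rule PP[OF u])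
        also have "\<dots> \<le> (L1 * L2 + 1) * Re (ip (P u) u)"
          using Ppos[OF u] by (intro mult_right_mono) auto
        finally have "\<delta> * nsq u \<le> Re (ip (P u) u)"
          unfolding \<delta>_def using L12 by (simp add: pos_divide_le_eq add_nonneg_pos mult_ac)
        then show ?thesis using Pre[OF GC[OF u]] by (simp add: distrib_right)
      qed
      then have "\<gamma> + \<delta> \<in> X" using g0 \<delta> by (auto simp: X_def)
      then have "\<gamma> + \<delta> \<le> \<gamma>" unfolding \<gamma>_def[symmetric] using cSup_upper[OF _ bdd] \<gamma>_def by blast
      then show False using \<delta> by simp
    qed
    then have "t\<^sup>2 * nsq u \<le> \<gamma> * nsq u" using GC[OF that] by (intro mult_right_mono) auto
    then show ?thesis using g[OF that] by linarith
  qed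
  \<comment> \<open>Expanding the square in the previous estimate, the terms \<open>t\<^sup>2 \<parallel>u\<parallel>\<^sup>2\<close> cancel.\<close>
  have gap2: "r * Re (ip (B u) u) \<le> nsq (B u)" if "u \<in> G" for u
  proof -
    have u: "u \<in> C" using GC that by blast
    have "S (c + t) u = hadd H (B u) (hscale H (- of_real t) u)"
      using u by (intro inner_ext) (auto simp: ip_S B_def algebra_simps)
    then have "nsq (S (c + t) u) = nsq (B u) - t * Re (ip (B u) u) - t * Re (ip u (B u)) + t\<^sup>2 * nsq u"
      using u BC[OF u] by (simp add: algebra_simps power2_eq_square)
    then show ?thesis using gap1[OF that] Bsym[OF u u] by (simp add: t_def)
  qed
  have gap3: "r * nsq (B u) \<le> Re (ip (B (B u)) (B u))" if u: "u \<in> G" for u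
  proof (cases "nsq (B u) = 0")
    case True
    then show ?thesis using Bpos[OF BG[OF u]] by simp
  next
    case False
    then have p: "nsq (B u) > 0" using inner_self_nonneg[OF BC[OF GC[OF u]]] by linarith
    have b: "0 \<le> Re (ip (B (B u)) (B u))" by (rule Bpos[OF BG[OF u]])
    have "nsq (B u) * (r * nsq (B u)) \<le> r * Re (ip (B u) u) * Re (ip (B (B u)) (B u))"
      using mult_left_mono[OF Bbound(2)[OF _ _ _ _ _ _ u], of r] r by (simp add: power2_eq_square mult_ac)
    also have "\<dots> \<le> nsq (B u) * Re (ip (B (B u)) (B u))"
      using gap2[OF u] b by (intro mult_right_mono)
    finally show ?thesis using p by (rule mult_left_le_imp_le)
  qed
  define q where "q = 1 - r / L"
  have q: "0 < q" "q < 1" using L r by (auto simp: q_def)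
  define sq where "sq = sqrt q"
  have sq: "0 < sq" "sq < 1" using q by (auto simp: sq_def real_less_lsqrt)
  \<comment> \<open>With this \<open>\<epsilon>\<close> the steps \<open>\<parallel>B (U k)\<parallel> / L\<close> add up to at most \<open>\<parallel>u0\<parallel> / 2\<close>.\<close>
  define \<epsilon> where "\<epsilon> = L * (1 - sq)\<^sup>2 / 4"
  have "\<epsilon> > 0" using L sq by (simp add: \<epsilon>_def)
  then obtain u0 where u0: "u0 \<in> G" "u0 \<noteq> hzero H" "Q u0 < (c + \<epsilon>) * nsq u0"
    using attained by blast
  have u0C: "u0 \<in> C" and u0p: "nsq u0 > 0" using u0 GC nsq_pos by auto
  define U where "U = rec_nat u0 (\<lambda>_ x. hadd H x (hscale H (- of_real (1 / L)) (B x)))"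
  have U0: "U 0 = u0" and US: "U (Suc k) = hadd H (U k) (hscale H (- of_real (1 / L)) (B (U k)))" for k
    by (simp_all add: U_def)
  have UG: "U k \<in> G" for k
  proof (induction k)
    case (Suc k)
    then show ?case unfolding US using subD(2)[OF Suc subD(3)[OF BG[OF Suc] BG[OF Suc]]] by blast
  qed (simp add: U0 u0)
  have UC: "U k \<in> C" "B (U k) \<in> C" for k using UG GC BC by auto
  have decay: "nsq (B (U k)) \<le> q ^ k * nsq (B u0)" for k
  proof (induction k)
    case (Suc k)
    let ?v = "B (U k)"
    have v: "?v \<in> C" "B ?v \<in> C" "?v \<in> G" using UC BC BG UG by auto
    have "B (U (Suc k)) = hadd H ?v (hscale H (- of_real (1 / L)) (B ?v))"
      using UC BC v by (intro inner_ext) (auto simp: US Bsym)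
    then have "nsq (B (U (Suc k))) = nsq ?v - 1 / L * Re (ip ?v (B ?v)) - 1 / L * Re (ip (B ?v) ?v)
        + (1 / L) * ((1 / L) * nsq (B ?v))"
      using v by (simp add: diff_divide_distrib)
    also have "\<dots> \<le> nsq ?v - 1 / L * Re (ip ?v (B ?v)) - 1 / L * Re (ip (B ?v) ?v)
        + (1 / L) * ((1 / L) * (L * Re (ip (B ?v) ?v)))"
      using L Bbound(1)[OF _ _ _ _ _ _ v(3)] by (intro add_left_mono mult_left_mono) auto
    also have "\<dots> = nsq ?v - 1 / L * Re (ip (B ?v) ?v)"
      using L Bsym[OF v(1,1)] by simp
    also have "\<dots> \<le> nsq ?v - 1 / L * (r * nsq ?v)"
      using gap3[OF UG[of k]] L by (intro diff_left_mono mult_left_mono) auto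
    also have "\<dots> = q * nsq ?v" by (simp add: q_def algebra_simps)
    also have "\<dots> \<le> q * (q ^ k * nsq (B u0))" using Suc q by (intro mult_left_mono) auto
    finally show ?case by simp
  qed (simp add: U0)
  have diff: "hadd H (U (Suc k)) (hscale H (- 1) (U k)) = hscale H (- of_real (1 / L)) (B (U k))" for k
    using UC by (intro inner_ext) (auto simp: US)
  have "(hnorm H (hadd H (U (Suc k)) (hscale H (- 1) (U k))))\<^sup>2 \<le> (1 / L)\<^sup>2 * nsq (B u0) * q ^ k" for k
  proof -
    have "(hnorm H (hadd H (U (Suc k)) (hscale H (- 1) (U k))))\<^sup>2 = (1 / L)\<^sup>2 * nsq (B (U k))"
      unfolding diff using UC by (subst hnorm_sq) (simp_all add: power2_eq_square)
    also have "\<dots> \<le> (1 / L)\<^sup>2 * (q ^ k * nsq (B u0))"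
      using decay by (intro mult_left_mono) auto
    finally show ?thesis by (simp add: mult_ac)
  qed
  then obtain l where l: "l \<in> C" "\<And>w. w \<in> C \<Longrightarrow> (\<lambda>n. ip (U n) w) \<longlonglongrightarrow> ip l w"
    using complete[unfolded geometrically_complete_def, rule_format, of U q "(1 / L)\<^sup>2 * nsq (B u0)"] UC q by blast
  have lG: "l \<in> G"
    unfolding G_def
  proof (intro CollectI conjI ballI)
    fix e assume e: "e \<in> E"
    then have "(\<lambda>n. ip (U n) e) = (\<lambda>_. 0)" using UG by (auto simp: G_def)
    then show "ip l e = 0" using l(2)[of e] e E LIMSEQ_unique[OF _ tendsto_const] by fastforce
  qed (rule l)
  have "B l = hzero H"
  proof (rule inner_ext)
    fix w assume w: "w \<in> C"
    have "(\<lambda>n. ip (B (U n)) w) \<longlonglongrightarrow> ip (B l) w"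
      using l(2)[OF BC[OF w]] UC w l(1) by (simp add: Bsym)
    moreover have "(\<lambda>n. ip (B (U n)) w) \<longlonglongrightarrow> 0"
    proof (rule Lim_null_comparison)
      show "(\<lambda>n. sqrt (q ^ n * nsq (B u0)) * sqrt (nsq w)) \<longlonglongrightarrow> 0"
      proof -
        have "(\<lambda>n. q ^ n) \<longlonglongrightarrow> 0" by (rule LIMSEQ_power_zero) (use q in simp)
        then have "(\<lambda>n. sqrt (q ^ n * nsq (B u0)) * sqrt (nsq w)) \<longlonglongrightarrow> sqrt (0 * nsq (B u0)) * sqrt (nsq w)"
          by (intro tendsto_mult tendsto_real_sqrt tendsto_const)
        then show ?thesis by simp
      qed
      have "norm (ip (B (U n)) w) \<le> sqrt (q ^ n * nsq (B u0)) * sqrt (nsq w)" for n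
      proof -
        have "norm (ip (B (U n)) w) \<le> sqrt (nsq (B (U n))) * sqrt (nsq w)"
          using UC w by (intro Cauchy_Schwarz_sqrt) auto
        also have "\<dots> \<le> sqrt (q ^ n * nsq (B u0)) * sqrt (nsq w)"
          using decay[of n] w by (intro mult_right_mono) auto
        finally show ?thesis .
      qed
      then show "\<forall>\<^sub>F n in sequentially. norm (ip (B (U n)) w) \<le> sqrt (q ^ n * nsq (B u0)) * sqrt (nsq w)"
        by simp
    qed
    ultimately show "ip (B l) w = ip (hzero H) w" using LIMSEQ_unique w by auto
  qed (use l BC in auto)
  then have eig: "A l = hscale H (of_real c) l"
  proof -
    have "ip (A l) w - of_real c * ip l w = 0" if "w \<in> C" for w
      using \<open>B l = hzero H\<close> l(1) that by (simp add: ip_S[symmetric] B_def)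
    then show ?thesis using l(1) by (intro inner_ext) auto
  qed
  have n0: "sqrt (nsq (B u0)) \<le> L * (1 - sq) / 2 * sqrt (nsq u0)"
  proof -
    have "Re (ip (B u0) u0) \<le> \<epsilon> * nsq u0"
      using u0(3) u0C by (simp add: B_def ip_S algebra_simps)
    then have "nsq (B u0) \<le> L * (\<epsilon> * nsq u0)"
      using order_trans[OF Bbound(1)[OF _ _ _ _ _ _ u0(1)] mult_left_mono[OF _ less_imp_le[OF L(1)]]] by blast
    also have "\<dots> = (L * (1 - sq) / 2 * sqrt (nsq u0))\<^sup>2"
      using u0C by (simp add: \<epsilon>_def power_mult_distrib power_divide power2_eq_square[of L])
    finally show ?thesis using L sq u0C by (intro real_le_lsqrt) auto
  qed
  have close: "norm (ip (U k) u0 - ip u0 u0) \<le> (\<Sum>j<k. sq ^ j) * ((1 - sq) / 2 * nsq u0)" for k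
  proof (induction k)
    case (Suc k)
    have "norm (ip (U (Suc k)) u0 - ip u0 u0) \<le> norm (ip (U k) u0 - ip u0 u0) + norm (of_real (1 / L) * ip (B (U k)) u0)"
      using UC u0C norm_triangle_ineq4[of "ip (U k) u0 - ip u0 u0" "of_real (1 / L) * ip (B (U k)) u0"]
      by (simp add: US algebra_simps)
    also have "norm (of_real (1 / L) * ip (B (U k)) u0) \<le> 1 / L * (sqrt (nsq (B (U k))) * sqrt (nsq u0))"
      using L Cauchy_Schwarz_sqrt[OF UC(2)[of k] u0C] by (simp add: norm_mult norm_divide divide_right_mono)
    also have "\<dots> \<le> 1 / L * (sq ^ k * sqrt (nsq (B u0)) * sqrt (nsq u0))"
    proof -
      have "sqrt (nsq (B (U k))) \<le> sqrt (q ^ k * nsq (B u0))" using decay by simp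
      also have "\<dots> = sq ^ k * sqrt (nsq (B u0))" by (simp add: sq_def real_sqrt_mult real_sqrt_power)
      finally show ?thesis using L u0C by (intro mult_left_mono mult_right_mono) auto
    qed
    also have "\<dots> \<le> 1 / L * (sq ^ k * (L * (1 - sq) / 2 * sqrt (nsq u0)) * sqrt (nsq u0))"
      using L sq u0C n0 by (intro mult_left_mono mult_right_mono) auto
    also have "\<dots> = sq ^ k * ((1 - sq) / 2 * nsq u0)"
      using L u0C by simp
    finally show ?case using Suc by (simp add: distrib_right)
  qed (simp add: U0)
  have close': "norm (ip (U k) u0 - ip u0 u0) \<le> nsq u0 / 2" for k
  proof -
    have "(\<Sum>j<k. sq ^ j) * (1 - sq) = 1 - sq ^ k"
      by (metis mult.commute one_diff_power_eq)
    then have "(\<Sum>j<k. sq ^ j) * ((1 - sq) / 2 * nsq u0) = (1 - sq ^ k) * (nsq u0 / 2)"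
      by (metis (no_types, opaque_lifting) mult.assoc times_divide_eq_left times_divide_eq_right)
    also have "\<dots> \<le> nsq u0 / 2" using sq u0p by (simp add: mult_left_le_one_le mult_le_cancel_right1)
    finally show ?thesis using close[of k] by linarith
  qed
  have "norm (ip l u0 - ip u0 u0) \<le> nsq u0 / 2"
  proof (rule LIMSEQ_le_const2)
    show "(\<lambda>k. norm (ip (U k) u0 - ip u0 u0)) \<longlonglongrightarrow> norm (ip l u0 - ip u0 u0)"
      using l(2)[OF u0C] by (intro tendsto_intros)
  qed (use close' in blast)
  moreover have "nsq u0 \<le> norm (ip u0 u0)" by (rule complex_Re_le_cmod)
  ultimately have "l \<noteq> hzero H" using u0C u0p by auto
  then show ?thesis using lG eig by blast
qed

end

section \<open>Eigenvalues below the essential spectrum\<close>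

lemma islimpt_of_real_image:
  assumes "(x::real) islimpt T"
  shows "complex_of_real x islimpt complex_of_real ` T"
  unfolding islimpt_approachable
proof (intro allI impI)
  fix e :: real assume "e > 0"
  then obtain t where "t \<in> T" "t \<noteq> x" "dist t x < e" using assms by (auto simp: islimpt_approachable)
  then show "\<exists>x'\<in>complex_of_real ` T. x' \<noteq> complex_of_real x \<and> dist x' (complex_of_real x) < e"
    by (intro bexI[of _ "complex_of_real t"]) (auto simp: dist_norm simp flip: of_real_diff)
qed

context symm_op
begin

lemma eigenspaces_orthogonal:
  assumes "x \<in> eigenspace H A (of_real \<mu>)" "y \<in> eigenspace H A (of_real \<nu>)" "\<mu> \<noteq> \<nu>"
  shows "ip x y = 0"
proof -
  have x: "x \<in> C" "A x = hscale H (of_real \<mu>) x" and y: "y \<in> C" "A y = hscale H (of_real \<nu>) y"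
    using assms by (auto simp: eigenspace_def)
  have "of_real \<mu> * ip x y = of_real \<nu> * ip x y" using A_sym[OF x(1) y(1)] x y by simp
  then show ?thesis using assms(3) by simp
qed

text \<open>
  Induction on the number of eigenvalues: eigenvectors of the new eigenvalue are orthogonal to the
  old family, so independent families can be concatenated.
  The last two clauses give the two bounds for the negative index: the span is negative for
  \<open>A - t\<close>, and finitely many conditions force a vector into the complement of the eigenspaces.
\<close>

lemma eigenvector_family:
  assumes "finite F" and fin: "\<forall>\<mu>\<in>F. hdim H (eigenspace H A (of_real \<mu>)) < \<infinity>"
  shows "\<exists>N b. (\<Sum>\<mu>\<in>F. hdim H (eigenspace H A (complex_of_real \<mu>))) = enat N
    \<and> (\<forall>i<N. \<exists>\<mu>\<in>F. b i \<in> eigenspace H A (of_real \<mu>)) \<and> hindependent H N b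
    \<and> (\<forall>u\<in>C. (\<forall>i<N. ip u (b i) = 0) \<longrightarrow> (\<forall>\<mu>\<in>F. \<forall>e\<in>eigenspace H A (of_real \<mu>). ip u e = 0))
    \<and> (\<forall>c t. (\<forall>\<mu>\<in>F. \<mu> < t) \<longrightarrow> hlincomb H N c b \<noteq> hzero H \<longrightarrow>
         Q (hlincomb H N c b) < t * nsq (hlincomb H N c b))"
  using assms
proof (induction F rule: finite_induct)
  case empty
  show ?case by (intro exI[of _ 0] exI[of _ "\<lambda>_. hzero H"]) (auto simp: hindependent_def zero_enat_def)
next
  case (insert \<mu> F)
  let ?E = "\<lambda>\<mu>. eigenspace H A (complex_of_real \<mu>)"
  have EC: "?E \<nu> \<subseteq> C" for \<nu> by (auto simp: eigenspace_def)
  obtain N b where N: "(\<Sum>\<mu>\<in>F. hdim H (?E \<mu>)) = enat N"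
    and b: "\<forall>i<N. \<exists>\<mu>\<in>F. b i \<in> ?E \<mu>" "hindependent H N b"
    and b_test: "\<forall>u\<in>C. (\<forall>i<N. ip u (b i) = 0) \<longrightarrow> (\<forall>\<mu>\<in>F. \<forall>e\<in>?E \<mu>. ip u e = 0)"
    and b_neg: "\<forall>c t. (\<forall>\<mu>\<in>F. \<mu> < t) \<longrightarrow> hlincomb H N c b \<noteq> hzero H \<longrightarrow>
         Q (hlincomb H N c b) < t * nsq (hlincomb H N c b)"
    using insert.IH insert.prems by blast
  obtain m where m: "hdim H (?E \<mu>) = enat m" using insert.prems by auto
  obtain d where d: "\<forall>i<m. d i \<in> ?E \<mu>" "hindependent H m d"
    using le_hdim_iff[OF EC[of \<mu>], of m] m by auto
  define b' where "b' = (\<lambda>i. if i < N then b i else d (i - N))"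
  have bC: "\<And>i. i < N \<Longrightarrow> b i \<in> C" and dC: "\<And>i. i < m \<Longrightarrow> d i \<in> C" using b d EC by blast+
  have b'C: "b' i \<in> C" if "i < N + m" for i using that bC dC by (auto simp: b'_def)
  have split: "hlincomb H (N + m) c b' = hadd H (hlincomb H N c b) (hlincomb H m (\<lambda>i. c (N + i)) d)" for c
  proof (rule inner_ext)
    fix w assume w: "w \<in> C"
    have "(\<Sum>i<N + m. c i * ip (b' i) w) = (\<Sum>i<N. c i * ip (b' i) w) + (\<Sum>i<m. c (N + i) * ip (b' (N + i)) w)"
      by (induction m) (simp_all add: add.assoc)
    then show "ip (hlincomb H (N + m) c b') w = ip (hadd H (hlincomb H N c b) (hlincomb H m (\<lambda>i. c (N + i)) d)) w"
      using w bC dC b'C by (simp add: ip_hlincomb) (simp add: b'_def)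
  qed (use bC dC b'C in auto)
  have dL: "hlincomb H m c d \<in> ?E \<mu>" for c
    using d(1) by (intro hlincomb_in_subspace eigenspace_subspace) auto
  have orth: "ip (hlincomb H N c b) y = 0" if "y \<in> ?E \<mu>" for c y
  proof -
    have "ip (b i) y = 0" if "i < N" for i
      using b(1) that \<open>y \<in> ?E \<mu>\<close> insert.hyps(2) eigenspaces_orthogonal by metis
    then show ?thesis using bC that EC by (subst ip_hlincomb) auto
  qed
  have "(\<Sum>\<mu>\<in>insert \<mu> F. hdim H (?E \<mu>)) = enat (N + m)"
    using insert.hyps N m by (simp add: add.commute)
  moreover have "\<forall>i<N + m. \<exists>\<mu>\<in>insert \<mu> F. b' i \<in> ?E \<mu>"
    using b(1) d(1) by (auto simp: b'_def)
  moreover have "hindependent H (N + m) b'"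
    unfolding hindependent_def
  proof (intro allI impI)
    fix c i assume z: "hlincomb H (N + m) c b' = hzero H" and i: "i < N + m"
    let ?x = "hlincomb H N c b" and ?y = "hlincomb H m (\<lambda>i. c (N + i)) d"
    have xy: "?x \<in> C" "?y \<in> C" using bC dC by auto
    have "ip (hadd H ?x ?y) ?y = 0" using z split xy by simp
    then have "nsq ?y = 0" using orth[OF dL] xy by simp
    then have y0: "?y = hzero H" using nsq_eq_0 xy by blast
    have "ip (hadd H ?x ?y) ?x = 0" using z split xy by simp
    then have "nsq ?x = 0" using y0 xy by simp
    then have x0: "?x = hzero H" using nsq_eq_0 xy by blast
    show "c i = 0"
    proof (cases "i < N")
      case True
      then show ?thesis using x0 b(2) by (simp add: hindependent_def)
    next
      case False
      then have "\<forall>j<m. c (N + j) = 0" using y0 d(2) unfolding hindependent_def by blast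
      then show ?thesis using False i by (metis add_less_cancel_left le_add_diff_inverse not_less)
    qed
  qed
  moreover have "\<forall>u\<in>C. (\<forall>i<N + m. ip u (b' i) = 0) \<longrightarrow> (\<forall>\<mu>\<in>insert \<mu> F. \<forall>e\<in>?E \<mu>. ip u e = 0)"
  proof (intro ballI impI)
    fix u \<nu> e assume u: "u \<in> C" "\<forall>i<N + m. ip u (b' i) = 0" and \<nu>: "\<nu> \<in> insert \<mu> F" and e: "e \<in> ?E \<nu>"
    have u1: "ip u (b i) = 0" if "i < N" for i using u(2)[rule_format, of i] that by (simp add: b'_def)
    have u2: "ip u (d i) = 0" if "i < m" for i using u(2)[rule_format, of "N + i"] that by (simp add: b'_def)
    show "ip u e = 0"
    proof (cases "\<nu> = \<mu>")
      case True
      then show ?thesis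
        using orthogonal_to_maximal_independent[OF eigenspace_subspace m _ d(2) u(1) u2] d(1) e by blast
    next
      case False
      then show ?thesis using b_test u(1) u1 \<nu> e by blast
    qed
  qed
  moreover have "\<forall>c t. (\<forall>\<mu>\<in>insert \<mu> F. \<mu> < t) \<longrightarrow> hlincomb H (N + m) c b' \<noteq> hzero H \<longrightarrow>
         Q (hlincomb H (N + m) c b') < t * nsq (hlincomb H (N + m) c b')"
  proof (intro allI impI)
    fix c t assume t: "\<forall>\<mu>\<in>insert \<mu> F. \<mu> < t" and nz: "hlincomb H (N + m) c b' \<noteq> hzero H"
    let ?x = "hlincomb H N c b" and ?y = "hlincomb H m (\<lambda>i. c (N + i)) d"
    have xy: "?x \<in> C" "?y \<in> C" using bC dC by auto
    have xy0: "ip ?x ?y = 0" "ip ?y ?x = 0" using orth[OF dL] xy by (auto simp: inner_commute[of ?x ?y])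
    have Ay: "A ?y = hscale H (of_real \<mu>) ?y" using dL by (simp add: eigenspace_def)
    have add: "A (hadd H ?x ?y) = hadd H (A ?x) (A ?y)"
      using xy by (intro inner_ext) (auto simp: A_sym)
    have Q: "Q (hadd H ?x ?y) = Q ?x + \<mu> * nsq ?y"
      unfolding add using xy xy0 A_sym[OF xy(1,2)] by (simp add: Ay)
    have n: "nsq (hadd H ?x ?y) = nsq ?x + nsq ?y" using xy xy0 by simp
    have Qx: "Q ?x \<le> t * nsq ?x"
    proof (cases "?x = hzero H")
      case False
      then show ?thesis using b_neg t by (meson insertI2 less_imp_le)
    qed simp
    show "Q (hlincomb H (N + m) c b') < t * nsq (hlincomb H (N + m) c b')"
    proof (cases "?y = hzero H")
      case True
      then have "?x = hadd H ?x ?y" using xy by (intro inner_ext) auto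
      then have "?x \<noteq> hzero H" using nz split by metis
      then have "Q ?x < t * nsq ?x" using b_neg t by blast
      then show ?thesis unfolding split using Q n True by (simp add: distrib_left)
    next
      case False
      then have "\<mu> * nsq ?y < t * nsq ?y" using t nsq_pos[OF xy(2)] by simp
      then show ?thesis unfolding split using Q n Qx by (simp add: distrib_left)
    qed
  qed
  ultimately show ?case by (intro exI[of _ "N + m"] exI[of _ b']) blast
qed

end

locale symm_op_below_essential = symm_op +
  fixes z :: real
  assumes complete: "geometrically_complete H"
    and below: "\<forall>\<mu>\<in>essential_spectrum H A. z < Re \<mu>"
begin

lemma discrete:
  assumes "\<not> bounded_below t" "t \<le> z"
  shows "complex_of_real t \<in> discrete_spectrum H A"
  using not_bounded_below_imp_spectrum[OF assms(1)] below assms(2)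
  by (force simp: essential_spectrum_def)

text \<open>
  The points where the lower bound fails form a closed bounded set of spectral points below \<open>z\<close>.  An
  infinite one would have a limit point, again in the set, which would not be isolated in the
  spectrum.
\<close>

lemma finite_not_bounded_below: "finite {t. t \<le> z \<and> \<not> bounded_below t}"
proof (rule ccontr)
  let ?T = "{t. t \<le> z \<and> \<not> bounded_below t}"
  assume inf: "infinite ?T"
  have "?T \<subseteq> {- K..z}" using bounded_below_left by (auto simp: not_less[symmetric])
  then obtain x where x: "x \<in> {- K..z}" "x islimpt ?T"
    using inf compact_Icc[of "- K" z] unfolding compact_eq_Bolzano_Weierstrass by blast
  have nbx: "\<not> bounded_below x"
  proof
    assume "bounded_below x"
    then obtain d where d: "d > 0" "\<And>t. \<bar>t - x\<bar> < d \<Longrightarrow> bounded_below t" using bounded_below_open by blast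
    then obtain t where "t \<in> ?T" "dist t x < d" using x(2) by (auto simp: islimpt_approachable)
    then show False using d(2) by (simp add: dist_real_def)
  qed
  have "complex_of_real ` ?T \<subseteq> spectrum H A" using not_bounded_below_imp_spectrum by auto
  then have "complex_of_real x islimpt spectrum H A"
    using islimpt_of_real_image[OF x(2)] islimpt_subset by blast
  then show False using discrete[OF nbx] x(1) by (simp add: discrete_spectrum_def)
qed

lemma isolated_right:
  assumes "\<not> bounded_below c" "c \<le> z"
  obtains r where "r > 0" "\<And>t. \<lbrakk>c < t; t < c + r\<rbrakk> \<Longrightarrow> bounded_below t"
proof -
  have "\<not> complex_of_real c islimpt spectrum H A" using discrete[OF assms] by (simp add: discrete_spectrum_def)
  then obtain r where r: "r > 0" "\<forall>\<mu>\<in>spectrum H A. \<mu> \<noteq> complex_of_real c \<longrightarrow> \<not> dist \<mu> (complex_of_real c) < r"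
    by (auto simp: islimpt_approachable)
  have "bounded_below t" if "c < t" "t < c + r" for t
  proof (rule ccontr)
    assume "\<not> bounded_below t"
    from not_bounded_below_imp_spectrum[OF this] r(2) that
    have "\<not> dist (complex_of_real t) (complex_of_real c) < r" by auto
    then show False using that by (simp add: dist_norm of_real_diff[symmetric] norm_of_real del: of_real_diff)
  qed
  then show thesis using that r(1) by blast
qed

text \<open>
  Let \<open>c\<close> be the infimum of the form over unit vectors orthogonal to the eigenspaces of \<open>\<Lambda>\<close>.
  If \<open>c \<le> z\<close>, then \<open>c\<close> is a spectral point, hence isolated, hence an eigenvalue with an eigenvector
  orthogonal to these eigenspaces; such a vector cannot belong to one of them.
\<close>

lemma form_bound_off_eigenspaces:
  fixes \<Lambda> :: "real set"
  defines "G \<equiv> {u \<in> hcarrier H. \<forall>\<mu>\<in>\<Lambda>. \<forall>e\<in>eigenspace H A (complex_of_real \<mu>). hinner H u e = 0}"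
  shows "\<exists>c. (\<forall>u\<in>G. c * nsq u \<le> Q u) \<and> (c \<le> z \<longrightarrow> eigenvalue H A (of_real c) \<and> c \<notin> \<Lambda>)"
proof (cases "\<exists>u\<in>G. u \<noteq> hzero H")
  case False
  \<comment> \<open>On the zero space every bound holds, so one above \<open>z\<close> can be taken.\<close>
  then have "\<forall>u\<in>G. (z + 1) * nsq u \<le> Q u" by auto
  then show ?thesis by (intro exI[of _ "z + 1"]) auto
next
  case True
  then obtain u0 where u0: "u0 \<in> G" "u0 \<noteq> hzero H" by blast
  define E where "E = (\<Union>\<mu>\<in>\<Lambda>. eigenspace H A (complex_of_real \<mu>))"
  have G_eq: "G = {u \<in> C. \<forall>e\<in>E. ip u e = 0}" by (auto simp: G_def E_def)
  have GC: "\<And>u. u \<in> G \<Longrightarrow> u \<in> C" by (simp add: G_def)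
  have inv: "A u \<in> G" if "u \<in> G" for u
    unfolding G_def
  proof (intro CollectI conjI ballI)
    fix \<mu> e assume \<mu>: "\<mu> \<in> \<Lambda>" and e: "e \<in> eigenspace H A (complex_of_real \<mu>)"
    then have "e \<in> C" "A e = hscale H (of_real \<mu>) e" by (auto simp: eigenspace_def)
    moreover have "ip u e = 0" using that \<mu> e by (auto simp: G_def)
    ultimately show "ip (A u) e = 0" using GC[OF that] by (simp add: A_sym)
  qed (use GC that in auto)
  define X where "X = {k. \<forall>u\<in>G. k * nsq u \<le> Q u}"
  have "k \<le> Q u0 / nsq u0" if "k \<in> X" for k
    using that u0 nsq_pos[of u0] GC by (auto simp: X_def pos_le_divide_eq)
  then have bdd: "bdd_above X" by (meson bdd_aboveI)
  have "- K \<in> X"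
    unfolding X_def
  proof (intro CollectI ballI)
    fix u assume "u \<in> G"
    then have u: "u \<in> C" by (rule GC)
    have "\<bar>Q u\<bar> \<le> norm (ip (A u) u)" by (rule abs_Re_le_cmod)
    also have "\<dots> \<le> sqrt (nsq (A u)) * sqrt (nsq u)" using u by (intro Cauchy_Schwarz_sqrt) auto
    also have "\<dots> \<le> sqrt (K\<^sup>2 * nsq u) * sqrt (nsq u)"
      using A_bound[OF u] u by (intro mult_right_mono) auto
    also have "\<dots> = K * nsq u" using K_nonneg u by (simp add: real_sqrt_mult)
    finally show "- K * nsq u \<le> Q u" by linarith
  qed
  then have ne: "X \<noteq> {}" by blast
  define c where "c = Sup X"
  have lower: "c * nsq u \<le> Q u" if "u \<in> G" for u
  proof (cases "nsq u = 0")
    case True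
    then have "u = hzero H" using nsq_eq_0 GC that by blast
    then show ?thesis by simp
  next
    case False
    then have p: "nsq u > 0" using inner_self_nonneg[OF GC[OF that]] by linarith
    have "c \<le> Q u / nsq u" unfolding c_def using ne that p
      by (intro cSup_least) (auto simp: X_def pos_le_divide_eq)
    then show ?thesis using p by (simp add: pos_le_divide_eq)
  qed
  have attained: "\<exists>u\<in>G. u \<noteq> hzero H \<and> Q u < (c + \<epsilon>) * nsq u" if "\<epsilon> > 0" for \<epsilon>
  proof -
    have "c + \<epsilon> \<notin> X" using cSup_upper[OF _ bdd, of "c + \<epsilon>"] that by (auto simp: c_def)
    then obtain u where u: "u \<in> G" "Q u < (c + \<epsilon>) * nsq u" by (auto simp: X_def not_le)
    then have "u \<noteq> hzero H" by auto
    then show ?thesis using u by blast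
  qed
  have "eigenvalue H A (of_real c) \<and> c \<notin> \<Lambda>" if cz: "c \<le> z"
  proof -
    have nb: "\<not> bounded_below c"
    proof
      assume "bounded_below c"
      then obtain k where k: "k > 0" "\<forall>u\<in>C. k * nsq u \<le> nsq (S c u)" by (auto simp: bounded_below_def)
      define L where "L = K + \<bar>c\<bar> + 1"
      have L: "L > 0" using K_nonneg by (simp add: L_def)
      have "c + k / L \<in> X"
        unfolding X_def
      proof (intro CollectI ballI)
        fix u assume u: "u \<in> G"
        have sub: "hsubspace H G" unfolding hsubspace_def G_eq E_def by (auto simp: eigenspace_def)
        note subD = hsubspaceD[OF sub]
        have "nsq (S c u) \<le> L * Re (ip (S c u) u)"
        proof (rule positive_op_bound(1)[OF _ _ _ _ sub _ _ u])
          show "nsq (S c v) \<le> L\<^sup>2 * nsq v" if "v \<in> C" for v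
          proof -
            have "(K + \<bar>c\<bar>)\<^sup>2 * nsq v \<le> L\<^sup>2 * nsq v"
              using K_nonneg that by (intro mult_right_mono power_mono) (auto simp: L_def)
            then show ?thesis using S_bound[OF that, of c] by simp
          qed
          show "S c v \<in> G" if "v \<in> G" for v
            unfolding S_def shifted_op_def using subD(2)[OF inv[OF that] subD(3)[OF that that]] .
          show "0 \<le> Re (ip (S c v) v)" if "v \<in> G" for v
            using lower[OF that] GC[OF that] by (simp add: ip_S)
        qed (use S_sym L in auto)
        then have "k * nsq u \<le> L * (Q u - c * nsq u)" using k GC[OF u] by (force simp: ip_S)
        then have "k / L * nsq u \<le> Q u - c * nsq u" using L by (simp add: pos_divide_le_eq mult.commute)
        then show "(c + k / L) * nsq u \<le> Q u" by (simp add: distrib_right)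
      qed
      then have "c + k / L \<le> c" unfolding c_def using cSup_upper[OF _ bdd] by blast
      then show False using k L by (simp add: divide_le_0_iff)
    qed
    obtain r where r: "r > 0" "\<And>t. \<lbrakk>c < t; t < c + r\<rbrakk> \<Longrightarrow> bounded_below t"
      using isolated_right[OF nb cz] by blast
    have "\<exists>u\<in>{u \<in> C. \<forall>e\<in>E. ip u e = 0}. u \<noteq> hzero H \<and> A u = hscale H (of_real c) u"
    proof (rule isolated_infimum_eigenvector[OF _ _ _ _ r complete])
      show "E \<subseteq> C" by (auto simp: E_def eigenspace_def)
    qed (use inv lower attained in \<open>auto simp: G_eq[symmetric]\<close>)
    then obtain u where u: "u \<in> G" "u \<noteq> hzero H" "A u = hscale H (of_real c) u"
      unfolding G_eq by blast
    then have ue: "u \<in> eigenspace H A (of_real c)" using GC by (simp add: eigenspace_def)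
    have "c \<notin> \<Lambda>"
    proof
      assume "c \<in> \<Lambda>"
      then have "ip u u = 0" using u ue by (auto simp: G_def)
      then show False using nsq_pos[OF GC[OF u(1)] u(2)] by simp
    qed
    then show ?thesis using ue u(2) by (auto simp: eigenvalue_def)
  qed
  then show ?thesis using lower by (intro exI[of _ c]) blast
qed

lemma eigenvalue_below:
  assumes "eigenvalue H A (of_real t)" "t \<le> z"
  shows "t \<in> {t. t \<le> z \<and> \<not> bounded_below t}" "hdim H (eigenspace H A (of_real t)) < \<infinity>"
  using eigenvalue_not_bounded_below[OF assms(1)] assms(2) discrete[of t]
  by (auto simp: discrete_spectrum_def)

lemma eigenspace_trivial:
  assumes "\<not> eigenvalue H A \<mu>" "e \<in> eigenspace H A \<mu>" "u \<in> C"
  shows "ip u e = 0"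
  using assms by (auto simp: eigenvalue_def)

text \<open>
  The eigenvectors below \<open>z\<close> span a negative subspace of the right dimension.  A larger negative
  subspace would contain a nonzero vector orthogonal to all of them, where the form is at least \<open>z\<close>.
\<close>

theorem eigenvalue_count_eq_neg_index:
  "eigenvalue_count H z A = neg_index H (\<lambda>u. Q u - z * (hnorm H u)\<^sup>2)"
proof -
  define F where "F = {t. eigenvalue H A (complex_of_real t) \<and> t < z}"
  have F: "finite F"
    using finite_subset[OF _ finite_not_bounded_below, of F] eigenvalue_below by (force simp: F_def)
  have Fd: "\<forall>t\<in>F. hdim H (eigenspace H A (of_real t)) < \<infinity>"
    using eigenvalue_below(2) by (simp add: F_def)
  obtain N b where N: "(\<Sum>\<mu>\<in>F. hdim H (eigenspace H A (complex_of_real \<mu>))) = enat N"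
    and b: "\<forall>i<N. \<exists>\<mu>\<in>F. b i \<in> eigenspace H A (of_real \<mu>)" "hindependent H N b"
    and b_test: "\<forall>u\<in>C. (\<forall>i<N. ip u (b i) = 0) \<longrightarrow> (\<forall>\<mu>\<in>F. \<forall>e\<in>eigenspace H A (of_real \<mu>). ip u e = 0)"
    and b_neg: "\<forall>c t. (\<forall>\<mu>\<in>F. \<mu> < t) \<longrightarrow> hlincomb H N c b \<noteq> hzero H \<longrightarrow>
         Q (hlincomb H N c b) < t * nsq (hlincomb H N c b)"
    using eigenvector_family[OF F Fd] by blast
  have bC: "b i \<in> C" if "i < N" for i using b(1) that by (auto simp: eigenspace_def)
  have count: "eigenvalue_count H z A = enat N"
    unfolding eigenvalue_count_def F_def[symmetric] using F N by simp
  have "neg_index H (\<lambda>u. Q u - z * (hnorm H u)\<^sup>2) \<le> enat N"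
    unfolding neg_index_def
  proof (rule Sup_least, safe)
    fix L assume L: "hsubspace H L" and neg: "\<forall>u\<in>L. u \<noteq> hzero H \<longrightarrow> Q u - z * (hnorm H u)\<^sup>2 < 0"
    have LC: "L \<subseteq> C" using L by (simp add: hsubspace_def)
    show "hdim H L \<le> enat N"
    proof (rule hdim_le_of_orthogonal_trivial[OF L bC])
      fix u assume u: "u \<in> L" "\<And>i. i < N \<Longrightarrow> ip u (b i) = 0"
      obtain c where c: "\<forall>u\<in>{u \<in> C. \<forall>\<mu>\<in>{t. t < z}. \<forall>e\<in>eigenspace H A (complex_of_real \<mu>). ip u e = 0}.
          c * nsq u \<le> Q u" "c \<le> z \<longrightarrow> eigenvalue H A (of_real c) \<and> c \<notin> {t. t < z}"
        using form_bound_off_eigenspaces[of "{t. t < z}"] by auto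
      have uC: "u \<in> C" using u LC by blast
      have "ip u e = 0" if "\<mu> < z" "e \<in> eigenspace H A (of_real \<mu>)" for \<mu> e
      proof (cases "\<mu> \<in> F")
        case True
        then show ?thesis using b_test uC u(2) that(2) by blast
      next
        case False
        then have "\<not> eigenvalue H A (of_real \<mu>)" using that(1) by (simp add: F_def)
        then show ?thesis using eigenspace_trivial that(2) uC by blast
      qed
      then have "c * nsq u \<le> Q u" using c(1) uC by auto
      moreover have "z * nsq u \<le> c * nsq u" using c(2) uC by (intro mult_right_mono) auto
      ultimately show "u = hzero H" using neg u(1) uC hnorm_sq[OF uC] by force
    qed
  qed
  moreover have "enat N \<le> neg_index H (\<lambda>u. Q u - z * (hnorm H u)\<^sup>2)"
  proof -
    define L where "L = range (\<lambda>c. hlincomb H N c b)"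
    have lC: "hlincomb H N c b \<in> C" for c using bC by simp
    have "hsubspace H L"
      unfolding hsubspace_def
    proof (intro conjI ballI allI)
      show "L \<subseteq> C" using lC by (auto simp: L_def)
      have "hzero H = hlincomb H N (\<lambda>_. 0) b" using lC bC by (intro inner_ext) (auto simp: ip_hlincomb)
      then show "hzero H \<in> L" by (auto simp: L_def)
    next
      fix u v assume "u \<in> L" "v \<in> L"
      then obtain c d where "u = hlincomb H N c b" "v = hlincomb H N d b" by (auto simp: L_def)
      then have "hadd H u v = hlincomb H N (\<lambda>i. c i + d i) b"
        using lC bC by (intro inner_ext) (auto simp: ip_hlincomb distrib_right sum.distrib)
      then show "hadd H u v \<in> L" by (auto simp: L_def)
    next
      fix k u assume "u \<in> L"
      then obtain c where "u = hlincomb H N c b" by (auto simp: L_def)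
      then have "hscale H k u = hlincomb H N (\<lambda>i. k * c i) b"
        using lC bC by (intro inner_ext) (auto simp: ip_hlincomb sum_distrib_left mult.assoc)
      then show "hscale H k u \<in> L" by (auto simp: L_def)
    qed
    moreover have "\<forall>u\<in>L. u \<noteq> hzero H \<longrightarrow> Q u - z * (hnorm H u)\<^sup>2 < 0"
    proof (intro ballI impI)
      fix u assume "u \<in> L" "u \<noteq> hzero H"
      then obtain c where c: "u = hlincomb H N c b" by (auto simp: L_def)
      have "\<forall>\<mu>\<in>F. \<mu> < z" by (auto simp: F_def)
      then have "Q u < z * nsq u" using b_neg c \<open>u \<noteq> hzero H\<close> by blast
      then show "Q u - z * (hnorm H u)\<^sup>2 < 0" using lC c by (simp add: hnorm_sq)
    qed
    moreover have "enat N \<le> hdim H L"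
    proof -
      have "b i \<in> L" if "i < N" for i
      proof -
        have "(\<Sum>j<N. (if j = i then 1 else 0) * ip (b j) w) = ip (b i) w" for w
          using that by (simp add: if_distrib[of "\<lambda>x. x * _"] sum.delta cong: if_cong)
        then have "b i = hlincomb H N (\<lambda>j. if j = i then 1 else 0) b"
          using lC bC that by (intro inner_ext) (auto simp: ip_hlincomb)
        then show ?thesis by (auto simp: L_def)
      qed
      moreover have "L \<subseteq> C" using lC by (auto simp: L_def)
      ultimately show ?thesis using le_hdim_iff b(2) by blast
    qed
    ultimately show ?thesis unfolding neg_index_def
      by (intro order_trans[OF _ Sup_upper]) auto
  qed
  ultimately show ?thesis using count by simp
qed

text \<open>
  Here the eigenspace of \<open>z\<close> itself is removed too, which makes the bound strict.
\<close>

theorem form_bound_finite_codimension: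
  "\<exists>(N::nat) b c. (\<forall>i<N. b i \<in> C) \<and> z < c \<and>
    (\<forall>u\<in>C. (\<forall>i<N. ip u (b i) = 0) \<longrightarrow> c * nsq u \<le> Q u)"
proof -
  define F where "F = {t. eigenvalue H A (complex_of_real t) \<and> t \<le> z}"
  have F: "finite F"
    using finite_subset[OF _ finite_not_bounded_below, of F] eigenvalue_below by (force simp: F_def)
  have Fd: "\<forall>t\<in>F. hdim H (eigenspace H A (of_real t)) < \<infinity>"
    using eigenvalue_below(2) by (simp add: F_def)
  have family: "\<exists>(N::nat) b. (\<forall>i<N. \<exists>\<mu>\<in>F. b i \<in> eigenspace H A (of_real \<mu>)) \<and>
    (\<forall>u\<in>C. (\<forall>i<N. ip u (b i) = 0) \<longrightarrow> (\<forall>\<mu>\<in>F. \<forall>e\<in>eigenspace H A (of_real \<mu>). ip u e = 0))"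
    using eigenvector_family[OF F Fd] by (elim exE conjE) (rule exI, rule exI, rule conjI, assumption, assumption)
  then obtain N :: nat and b where b: "\<forall>i<N. \<exists>\<mu>\<in>F. b i \<in> eigenspace H A (of_real \<mu>)"
    and b_test: "\<forall>u\<in>C. (\<forall>i<N. ip u (b i) = 0) \<longrightarrow> (\<forall>\<mu>\<in>F. \<forall>e\<in>eigenspace H A (of_real \<mu>). ip u e = 0)"
    by blast
  obtain c where c: "\<forall>u\<in>{u \<in> C. \<forall>\<mu>\<in>{t. t \<le> z}. \<forall>e\<in>eigenspace H A (complex_of_real \<mu>). ip u e = 0}.
      c * nsq u \<le> Q u" "c \<le> z \<longrightarrow> eigenvalue H A (of_real c) \<and> c \<notin> {t. t \<le> z}"
    using form_bound_off_eigenspaces[of "{t. t \<le> z}"] by auto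
  have "c * nsq u \<le> Q u" if u: "u \<in> C" "\<forall>i<N. ip u (b i) = 0" for u
  proof -
    have "ip u e = 0" if "\<mu> \<le> z" "e \<in> eigenspace H A (of_real \<mu>)" for \<mu> e
      proof (cases "\<mu> \<in> F")
        case True
        then show ?thesis using b_test u that(2) by blast
      next
        case False
        then have "\<not> eigenvalue H A (of_real \<mu>)" using that(1) by (simp add: F_def)
        then show ?thesis using eigenspace_trivial that(2) u(1) by blast
      qed
    then show ?thesis using c(1) u(1) by auto
  qed
  moreover have "z < c" using c(2) by force
  moreover have "\<forall>i<N. b i \<in> C" using b by (auto simp: eigenspace_def)
  ultimately show ?thesis by blast
qed

end

section \<open>Orthonormal bases, direct sums and \<open>L\<^sup>2\<close> spaces\<close>

context inner_space
begin

lemma inner_space_subspace: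
  assumes L: "hsubspace H L"
  shows "inner_space (H\<lparr>hcarrier := L\<rparr>)"
proof -
  have LC: "\<And>u. u \<in> L \<Longrightarrow> u \<in> C" using L by (auto simp: hsubspace_def)
  show ?thesis
  proof
    fix u v assume u: "u \<in> hcarrier (H\<lparr>hcarrier := L\<rparr>)" and v: "v \<in> hcarrier (H\<lparr>hcarrier := L\<rparr>)"
      and eq: "\<And>w. w \<in> hcarrier (H\<lparr>hcarrier := L\<rparr>) \<Longrightarrow>
        hinner (H\<lparr>hcarrier := L\<rparr>) u w = hinner (H\<lparr>hcarrier := L\<rparr>) v w"
    let ?d = "hadd H u (hscale H (- 1) v)"
    have d: "?d \<in> L" "u \<in> C" "v \<in> C" using u v L LC by (auto simp: hsubspace_def)
    have "ip ?d ?d = 0" using eq[of ?d] d LC[OF d(1)] by (simp del: ip_add_right ip_scale_right)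
    then have d0: "?d = hzero H" using nsq_eq_0[OF LC[OF d(1)]] by simp
    show "u = v"
    proof (rule inner_ext)
      fix w assume "w \<in> C"
      then have "ip ?d w = 0" using d0 by simp
      then show "ip u w = ip v w" using d \<open>w \<in> C\<close> by simp
    qed (use d in auto)
  qed (use L LC in \<open>auto simp: hsubspace_def intro: inner_commute\<close>)
qed

lemma Bessel_inequality:
  assumes "finite F" "F \<subseteq> C" and on: "\<And>e f. \<lbrakk>e \<in> F; f \<in> F\<rbrakk> \<Longrightarrow> ip e f = (if e = f then 1 else 0)"
    and u: "u \<in> C"
  shows "(\<Sum>e\<in>F. (norm (ip u e))\<^sup>2) \<le> nsq u"
proof -
  \<comment> \<open>\<open>v\<close> is \<open>u\<close> minus its projection to the span of \<open>F\<close>, described by its inner products.\<close>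
  have "\<exists>v\<in>C. nsq v = nsq u - (\<Sum>e\<in>F. (norm (ip u e))\<^sup>2)
      \<and> (\<forall>w\<in>C. (\<forall>e\<in>F. ip e w = 0) \<longrightarrow> ip v w = ip u w)"
    using assms(1,2) on
  proof (induction F rule: finite_induct)
    case empty
    then show ?case using u by (intro bexI[of _ u]) auto
  next
    case (insert e F)
    have "\<exists>v\<in>C. nsq v = nsq u - (\<Sum>e\<in>F. (norm (ip u e))\<^sup>2)
      \<and> (\<forall>w\<in>C. (\<forall>e\<in>F. ip e w = 0) \<longrightarrow> ip v w = ip u w)"
      using insert.prems by (intro insert.IH) auto
    then obtain v where v: "v \<in> C" "nsq v = nsq u - (\<Sum>e\<in>F. (norm (ip u e))\<^sup>2)"
      "\<forall>w\<in>C. (\<forall>e\<in>F. ip e w = 0) \<longrightarrow> ip v w = ip u w" by blast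
    have e: "e \<in> C" "ip e e = 1" "\<forall>f\<in>F. ip f e = 0" "\<forall>f\<in>F. ip e f = 0"
      using insert.prems insert.hyps by auto
    have ve: "ip v e = ip u e" using v(3) e by blast
    let ?v = "hadd H v (hscale H (- ip v e) e)"
    have "nsq ?v = nsq v - (norm (ip v e))\<^sup>2"
      using v(1) e(1,2) inner_commute[OF v(1) e(1)] unfolding cmod_power2
      by (simp add: algebra_simps power2_eq_square)
    moreover have "ip ?v w = ip u w" if "w \<in> C" "\<forall>f\<in>insert e F. ip f w = 0" for w
      using that v e by simp
    ultimately show ?case using v e insert.hyps ve by (intro bexI[of _ ?v]) auto
  qed
  then obtain v where "v \<in> C" "nsq v = nsq u - (\<Sum>e\<in>F. (norm (ip u e))\<^sup>2)" by blast
  then show ?thesis using inner_self_nonneg[of v] by linarith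
qed

text \<open>
  Zorn's lemma: an orthonormal set is total as soon as it is maximal, since a nonzero vector
  orthogonal to it could be normalised and added.
\<close>

lemma orthonormal_basis_exists: "\<exists>E. orthonormal_basis H E"
proof -
  define \<O> where "\<O> = {E. E \<subseteq> C \<and> (\<forall>e\<in>E. \<forall>f\<in>E. ip e f = (if e = f then 1 else 0))}"
  have "\<exists>E\<in>\<O>. \<forall>X\<in>\<O>. E \<subseteq> X \<longrightarrow> X = E"
  proof (rule Zorn_Lemma)
    show "\<forall>Z\<in>chains \<O>. \<Union>Z \<in> \<O>"
    proof
      fix Z assume Z: "Z \<in> chains \<O>"
      have "ip e f = (if e = f then 1 else 0)" if ef: "e \<in> \<Union>Z" "f \<in> \<Union>Z" for e f
      proof -
        obtain X Y where XY: "X \<in> Z" "e \<in> X" "Y \<in> Z" "f \<in> Y" using ef by blast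
        then have "X \<subseteq> Y \<or> Y \<subseteq> X" using Z by (auto simp: chains_def chain_subset_def)
        moreover have "X \<in> \<O>" "Y \<in> \<O>" using Z XY by (auto simp: chains_def)
        ultimately show ?thesis using XY unfolding \<O>_def by blast
      qed
      moreover have "\<Union>Z \<subseteq> C" using Z by (auto simp: chains_def \<O>_def)
      ultimately show "\<Union>Z \<in> \<O>" by (auto simp: \<O>_def)
    qed
  qed
  then obtain E where E: "E \<in> \<O>" "\<forall>X\<in>\<O>. E \<subseteq> X \<longrightarrow> X = E" by blast
  have EC: "E \<subseteq> C" and on: "\<And>e f. \<lbrakk>e \<in> E; f \<in> E\<rbrakk> \<Longrightarrow> ip e f = (if e = f then 1 else 0)"
    using E(1) by (auto simp: \<O>_def)
  have triv: "u = hzero H" if u: "u \<in> C" "\<forall>e\<in>E. ip u e = 0" for u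
  proof (rule ccontr)
    assume "u \<noteq> hzero H"
    then have p: "nsq u > 0" using nsq_pos u by blast
    define e where "e = hscale H (of_real (1 / sqrt (nsq u))) u"
    have e: "e \<in> C" using u by (simp add: e_def)
    have "ip e e = of_real (1 / sqrt (nsq u)) * (of_real (1 / sqrt (nsq u)) * of_real (nsq u))"
      unfolding e_def using u(1) by (simp del: of_real_divide of_real_mult flip: ip_self)
    also have "\<dots> = of_real (1 / sqrt (nsq u) * (1 / sqrt (nsq u)) * nsq u)"
      unfolding of_real_mult by (simp only: mult.assoc)
    also have "1 / sqrt (nsq u) * (1 / sqrt (nsq u)) * nsq u = 1" using p by (simp add: field_simps)
    also have "complex_of_real 1 = 1" by simp
    finally have ee: "ip e e = 1" .
    have eE: "ip e f = 0" "ip f e = 0" if "f \<in> E" for f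
    proof -
      have "f \<in> C" using that EC by blast
      then show "ip e f = 0" using u that by (simp add: e_def)
      then show "ip f e = 0" using inner_commute[OF e \<open>f \<in> C\<close>] by simp
    qed
    have "e \<notin> E" using eE(1)[of e] ee by auto
    have on': "\<forall>x\<in>insert e E. \<forall>y\<in>insert e E. ip x y = (if x = y then 1 else 0)"
    proof (intro ballI)
      fix x y assume xy: "x \<in> insert e E" "y \<in> insert e E"
      consider "x = e" "y = e" | "x = e" "y \<in> E" "x \<noteq> y" | "x \<in> E" "y = e" "x \<noteq> y" | "x \<in> E" "y \<in> E"
        using xy \<open>e \<notin> E\<close> by blast
      then show "ip x y = (if x = y then 1 else 0)"
      proof cases
        case 1 then show ?thesis by (simp only: ee if_True refl)
      next
        case 2 then show ?thesis by (simp only: eE(1) if_False)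
      next
        case 3 then show ?thesis by (simp only: eE(2) if_False)
      next
        case 4 then show ?thesis by (rule on)
      qed
    qed
    have incl: "insert e E \<subseteq> C" using EC e by blast
    have "insert e E \<in> \<O>" unfolding \<O>_def by (intro CollectI conjI incl on')
    then show False using E(2) \<open>e \<notin> E\<close> by blast
  qed
  show ?thesis
    unfolding orthonormal_basis_def
  proof (rule exI[of _ E], intro conjI)
    show "\<forall>e\<in>E. \<forall>f\<in>E. ip e f = (if e = f then 1 else 0)" by (intro ballI on)
    show "\<forall>u\<in>C. (\<forall>e\<in>E. ip u e = 0) \<longrightarrow> u = hzero H" using triv by blast
  qed (rule EC)
qed

end

lemma inner_space_hsum:
  assumes "inner_space H" "inner_space K"
  shows "inner_space (hsum H K)"
proof -
  interpret H: inner_space H by fact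
  interpret K: inner_space K by fact
  show ?thesis
  proof
    fix u v assume u: "u \<in> hcarrier (hsum H K)" "v \<in> hcarrier (hsum H K)"
      and eq: "\<And>w. w \<in> hcarrier (hsum H K) \<Longrightarrow> hinner (hsum H K) u w = hinner (hsum H K) v w"
    have "fst u = fst v"
      using eq[of "(_, hzero K)"] u by (intro H.inner_ext) (auto simp: hsum_def)
    moreover have "snd u = snd v"
      using eq[of "(hzero H, _)"] u by (intro K.inner_ext) (auto simp: hsum_def)
    ultimately show "u = v" by (rule prod_eqI)
  next
    fix u v assume "u \<in> hcarrier (hsum H K)" "v \<in> hcarrier (hsum H K)"
    then show "hinner (hsum H K) v u = cnj (hinner (hsum H K) u v)"
      using H.inner_commute[of "fst u" "fst v"] K.inner_commute[of "snd u" "snd v"] by (auto simp: hsum_def)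
  qed (auto simp: hsum_def algebra_simps)
qed

lemma geometrically_complete_hsum:
  assumes "inner_space H" "inner_space K" "geometrically_complete H" "geometrically_complete K"
  shows "geometrically_complete (hsum H K)"
  unfolding geometrically_complete_def
proof (intro allI impI, elim conjE)
  interpret H: inner_space H by fact
  interpret K: inner_space K by fact
  fix u :: "nat \<Rightarrow> 'a \<times> 'b" and M q :: real
  assume u: "\<forall>n. u n \<in> hcarrier (hsum H K)" and q: "0 < q" "q < 1"
    and le: "\<forall>n. (hnorm (hsum H K) (hadd (hsum H K) (u (Suc n)) (hscale (hsum H K) (- 1) (u n))))\<^sup>2 \<le> M * q ^ n"
  have uC: "fst (u n) \<in> hcarrier H" "snd (u n) \<in> hcarrier K" for n
    using u[rule_format, of n] by (auto simp: hsum_def)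
  let ?d1 = "\<lambda>n. hadd H (fst (u (Suc n))) (hscale H (- 1) (fst (u n)))"
  let ?d2 = "\<lambda>n. hadd K (snd (u (Suc n))) (hscale K (- 1) (snd (u n)))"
  have dC: "?d1 n \<in> hcarrier H" "?d2 n \<in> hcarrier K" for n using uC by auto
  have split: "(hnorm (hsum H K) (hadd (hsum H K) (u (Suc n)) (hscale (hsum H K) (- 1) (u n))))\<^sup>2
      = (hnorm H (?d1 n))\<^sup>2 + (hnorm K (?d2 n))\<^sup>2" for n
    using H.inner_self_nonneg[OF dC(1)[of n]] K.inner_self_nonneg[OF dC(2)[of n]]
    unfolding hnorm_def by (simp add: hsum_def)
  have "(hnorm H (?d1 n))\<^sup>2 \<le> M * q ^ n" "(hnorm K (?d2 n))\<^sup>2 \<le> M * q ^ n" for n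
    using le[rule_format, of n] split[of n] zero_le_power2[of "hnorm H (?d1 n)"] zero_le_power2[of "hnorm K (?d2 n)"]
    by linarith+
  then obtain l1 l2 where l1: "l1 \<in> hcarrier H" "\<forall>w\<in>hcarrier H. (\<lambda>n. hinner H (fst (u n)) w) \<longlonglongrightarrow> hinner H l1 w"
    and l2: "l2 \<in> hcarrier K" "\<forall>w\<in>hcarrier K. (\<lambda>n. hinner K (snd (u n)) w) \<longlonglongrightarrow> hinner K l2 w"
    using assms(3)[unfolded geometrically_complete_def, rule_format, of "\<lambda>n. fst (u n)" q M]
      assms(4)[unfolded geometrically_complete_def, rule_format, of "\<lambda>n. snd (u n)" q M] uC q by metis
  then show "\<exists>l\<in>hcarrier (hsum H K). \<forall>w\<in>hcarrier (hsum H K).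
      (\<lambda>n. hinner (hsum H K) (u n) w) \<longlonglongrightarrow> hinner (hsum H K) l w"
    by (intro bexI[of _ "(l1, l2)"]) (auto simp: hsum_def intro!: tendsto_add)
qed

lemma norm_add_sq_le: "(norm (a + b :: complex))\<^sup>2 \<le> 2 * (norm a)\<^sup>2 + 2 * (norm b)\<^sup>2"
proof -
  have "(norm (a + b))\<^sup>2 \<le> (norm a + norm b)\<^sup>2" by (intro power_mono norm_triangle_ineq) auto
  also have "\<dots> \<le> 2 * (norm a)\<^sup>2 + 2 * (norm b)\<^sup>2"
    using sum_squares_bound[of "norm a" "norm b"] by (simp add: power2_sum)
  finally show ?thesis .
qed

lemma norm_mult_le_squares: "norm (a * b :: complex) \<le> (norm a)\<^sup>2 + (norm b)\<^sup>2"
  unfolding norm_mult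
  using sum_squares_bound[of "norm a" "norm b"] mult_nonneg_nonneg[OF norm_ge_zero[of a] norm_ge_zero[of b]]
  by linarith

lemma mult_cnj_self: "(w::complex) * cnj w = of_real ((norm w)\<^sup>2)"
  by (rule complex_norm_square[symmetric])

lemma square_integrable_zero [simp]: "square_integrable M (\<lambda>x. 0)"
  by (simp add: square_integrable_def)

lemma square_integrable_measurable: "square_integrable M f \<Longrightarrow> f \<in> borel_measurable M"
  by (simp add: square_integrable_def)

lemma square_integrable_bound:
  assumes "f \<in> borel_measurable M" "integrable M g" "AE x in M. (norm (f x))\<^sup>2 \<le> g x"
  shows "square_integrable M f"
  unfolding square_integrable_def
proof
  show "integrable M (\<lambda>x. (norm (f x))\<^sup>2)"
    by (rule Bochner_Integration.integrable_bound[OF assms(2)])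
      (use assms in \<open>auto elim!: eventually_mono\<close>)
qed fact

lemma square_integrable_add:
  assumes "square_integrable M f" "square_integrable M g"
  shows "square_integrable M (\<lambda>x. f x + g x)"
  using assms norm_add_sq_le
  by (intro square_integrable_bound[where g = "\<lambda>x. 2 * (norm (f x))\<^sup>2 + 2 * (norm (g x))\<^sup>2"])
    (auto simp: square_integrable_def)

lemma square_integrable_scale: "square_integrable M f \<Longrightarrow> square_integrable M (\<lambda>x. c * f x)"
  by (auto simp: square_integrable_def norm_mult power_mult_distrib)

lemma square_integrable_bounded_mult:
  fixes w :: "'a \<Rightarrow> real"
  assumes "square_integrable M f" "w \<in> borel_measurable M" "AE x in M. \<bar>w x\<bar> \<le> B"
  shows "square_integrable M (\<lambda>x. of_real (w x) * f x)"
proof (rule square_integrable_bound)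
  show "integrable M (\<lambda>x. B\<^sup>2 * (norm (f x))\<^sup>2)" using assms by (auto simp: square_integrable_def)
  show "AE x in M. (norm (of_real (w x) * f x))\<^sup>2 \<le> B\<^sup>2 * (norm (f x))\<^sup>2"
    using assms(3)
  proof eventually_elim
    fix x assume "\<bar>w x\<bar> \<le> B"
    then have "\<bar>w x\<bar>\<^sup>2 \<le> B\<^sup>2" by (intro power_mono) auto
    then show "(norm (of_real (w x) * f x))\<^sup>2 \<le> B\<^sup>2 * (norm (f x))\<^sup>2"
      by (simp add: norm_mult power_mult_distrib mult_right_mono)
  qed
qed (use assms in \<open>auto simp: square_integrable_def\<close>)

lemma square_integrable_mult_integrable:
  assumes "square_integrable M f" "square_integrable M g"
  shows "integrable M (\<lambda>x. f x * g x)"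
proof (rule Bochner_Integration.integrable_bound)
  show "integrable M (\<lambda>x. (norm (f x))\<^sup>2 + (norm (g x))\<^sup>2)"
    using assms by (auto simp: square_integrable_def)
qed (use assms norm_mult_le_squares in \<open>auto simp: square_integrable_def\<close>)

lemma square_integrable_cnj: "square_integrable M (\<lambda>x. cnj (f x)) \<longleftrightarrow> square_integrable M f"
proof -
  have *: "square_integrable M (\<lambda>x. cnj (f x))" if "square_integrable M f" for f
  proof -
    have "(\<lambda>x. cnj (f x)) \<in> borel_measurable M"
      using that by (intro borel_measurable_continuous_on[where f=cnj and g=f])
        (auto simp: square_integrable_def intro: continuous_intros)
    then show ?thesis using that by (auto simp: square_integrable_def)
  qed
  show ?thesis using *[of f] *[of "\<lambda>x. cnj (f x)"] by auto
qed

lemma square_integrable_inner_integrable: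
  "\<lbrakk>square_integrable M f; square_integrable M g\<rbrakk> \<Longrightarrow> integrable M (\<lambda>x. f x * cnj (g x))"
  by (intro square_integrable_mult_integrable) (auto simp: square_integrable_cnj)

lemma L2_class_cong: "AE x in M. f x = g x \<Longrightarrow> L2_class M f = L2_class M g"
  unfolding L2_class_def by (auto elim!: AE_mp)

lemma L2_rep_class:
  assumes "square_integrable M f"
  shows "square_integrable M (L2_rep (L2_class M f))" "AE x in M. L2_rep (L2_class M f) x = f x"
proof -
  have "L2_rep (L2_class M f) \<in> L2_class M f"
    unfolding L2_rep_def by (rule someI[of _ f]) (use assms in \<open>simp add: L2_class_def\<close>)
  then show "square_integrable M (L2_rep (L2_class M f))" "AE x in M. L2_rep (L2_class M f) x = f x"
    by (auto simp: L2_class_def)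
qed

lemma L2_carrierI [intro]: "square_integrable M f \<Longrightarrow> L2_class M f \<in> hcarrier (L2 M)"
  by (auto simp: L2_def)

lemma L2_carrierE:
  assumes "X \<in> hcarrier (L2 M)"
  obtains f where "square_integrable M f" "X = L2_class M f"
  using assms by (auto simp: L2_def)

lemma L2_zero: "hzero (L2 M) = L2_class M (\<lambda>x. 0)"
  by (simp add: L2_def)

lemma L2_add:
  assumes "square_integrable M f" "square_integrable M g"
  shows "hadd (L2 M) (L2_class M f) (L2_class M g) = L2_class M (\<lambda>x. f x + g x)"
  unfolding L2_def using L2_rep_class(2)[OF assms(1)] L2_rep_class(2)[OF assms(2)]
  by simp (rule L2_class_cong, auto)

lemma L2_scale:
  assumes "square_integrable M f"
  shows "hscale (L2 M) c (L2_class M f) = L2_class M (\<lambda>x. c * f x)"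
  unfolding L2_def using L2_rep_class(2)[OF assms]
  by simp (rule L2_class_cong, auto)

lemma L2_inner:
  assumes "square_integrable M f" "square_integrable M g"
  shows "hinner (L2 M) (L2_class M f) (L2_class M g) = (LINT x|M. f x * cnj (g x))"
proof -
  have "(LINT x|M. L2_rep (L2_class M f) x * cnj (L2_rep (L2_class M g) x)) = (LINT x|M. f x * cnj (g x))"
  proof (rule integral_cong_AE)
    show "AE x in M. L2_rep (L2_class M f) x * cnj (L2_rep (L2_class M g) x) = f x * cnj (g x)"
      using L2_rep_class(2)[OF assms(1)] L2_rep_class(2)[OF assms(2)] by auto
  qed (use L2_rep_class(1)[OF assms(1)] L2_rep_class(1)[OF assms(2)] assms in
      \<open>auto intro!: borel_measurable_integrable square_integrable_inner_integrable\<close>)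
  then show ?thesis by (simp add: L2_def)
qed

lemma L2_hnorm_sq:
  assumes "square_integrable M f"
  shows "(hnorm (L2 M) (L2_class M f))\<^sup>2 = (LINT x|M. (norm (f x))\<^sup>2)"
proof -
  have "hinner (L2 M) (L2_class M f) (L2_class M f) = of_real (LINT x|M. (norm (f x))\<^sup>2)"
    unfolding L2_inner[OF assms assms] mult_cnj_self integral_complex_of_real ..
  then show ?thesis by (simp add: hnorm_def)
qed

lemma mult_op_class:
  assumes "square_integrable M f"
  shows "mult_op M w (L2_class M f) = L2_class M (\<lambda>x. of_real (w x) * f x)"
  unfolding mult_op_def using L2_rep_class(2)[OF assms] by (intro L2_class_cong) auto

lemma inner_space_L2: "inner_space (L2 M)"
proof
  fix u v w c
  assume u: "u \<in> hcarrier (L2 M)" and w: "w \<in> hcarrier (L2 M)"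
  then obtain f h where f: "square_integrable M f" "u = L2_class M f" and h: "square_integrable M h" "w = L2_class M h"
    by (meson L2_carrierE)
  note i = square_integrable_inner_integrable
  show "hscale (L2 M) c u \<in> hcarrier (L2 M)"
    using f by (auto simp: L2_scale intro!: square_integrable_scale)
  show "hinner (L2 M) (hzero (L2 M)) w = 0"
    unfolding L2_zero using h by (simp add: L2_inner)
  show "hinner (L2 M) (hscale (L2 M) c u) w = c * hinner (L2 M) u w"
    using f h by (simp add: L2_scale L2_inner square_integrable_scale mult.assoc)
  show "0 \<le> Re (hinner (L2 M) u u)"
    unfolding f L2_inner[OF f(1) f(1)] mult_cnj_self integral_complex_of_real by simp
  show "hinner (L2 M) w u = cnj (hinner (L2 M) u w)"
    unfolding f h L2_inner[OF f(1) h(1)] L2_inner[OF h(1) f(1)]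
    by (subst Bochner_Integration.integral_cnj[symmetric]) (simp add: mult.commute)
  assume v: "v \<in> hcarrier (L2 M)"
  then obtain g where g: "square_integrable M g" "v = L2_class M g" by (meson L2_carrierE)
  show "hadd (L2 M) u v \<in> hcarrier (L2 M)"
    using f g by (auto simp: L2_add intro!: square_integrable_add)
  show "hinner (L2 M) (hadd (L2 M) u v) w = hinner (L2 M) u w + hinner (L2 M) v w"
    using f g h Bochner_Integration.integral_add[OF i[OF f(1) h(1)] i[OF g(1) h(1)]]
    by (simp add: L2_add L2_inner square_integrable_add distrib_right)
next
  fix u v
  assume u: "u \<in> hcarrier (L2 M)" and v: "v \<in> hcarrier (L2 M)"
    and eq: "\<And>w. w \<in> hcarrier (L2 M) \<Longrightarrow> hinner (L2 M) u w = hinner (L2 M) v w"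
  then obtain f g where f: "square_integrable M f" "u = L2_class M f" and g: "square_integrable M g" "v = L2_class M g"
    by (meson L2_carrierE)
  note i = square_integrable_inner_integrable
  define d where "d = (\<lambda>x. f x + (- 1) * g x)"
  have d: "square_integrable M d" unfolding d_def using f g by (intro square_integrable_add square_integrable_scale)
  have "(LINT x|M. f x * cnj (d x)) = (LINT x|M. g x * cnj (d x))"
    using eq[of "L2_class M d"] d f g by (auto simp: L2_inner)
  then have "(LINT x|M. d x * cnj (d x)) = 0"
    using Bochner_Integration.integral_diff[OF i[OF f(1) d] i[OF g(1) d]]
    by (simp add: d_def left_diff_distrib)
  then have "(LINT x|M. (norm (d x))\<^sup>2) = 0"
    unfolding mult_cnj_self integral_complex_of_real of_real_eq_0_iff .
  then have "AE x in M. (norm (d x))\<^sup>2 = 0"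
    using d by (subst (asm) integral_nonneg_eq_0_iff_AE) (auto simp: square_integrable_def)
  then show "u = v" unfolding f g by (intro L2_class_cong) (auto simp: d_def)
qed (auto simp: L2_zero)

text \<open>
  Riesz-Fischer for geometric steps \<open>d\<^sub>n\<close>.  With \<open>\<rho> = \<surd>q\<close> the series \<open>\<Sum> |d\<^sub>n|\<^sup>2 / \<rho>\<^sup>n\<close> still has a finite
  integral, and by the Cauchy-Schwarz inequality for sums it controls \<open>(\<Sum> |d\<^sub>n|)\<^sup>2\<close>.  This gives almost
  everywhere convergence together with an integrable bound for all \<open>|f\<^sub>n|\<^sup>2\<close>.
\<close>

lemma L2_geometric_limit:
  fixes f :: "nat \<Rightarrow> 'a \<Rightarrow> complex"
  assumes f: "\<And>n. square_integrable M (f n)" and q: "0 < q" "q < 1"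
    and le: "\<And>n. (LINT x|M. (norm (f (Suc n) x - f n x))\<^sup>2) \<le> B * q ^ n"
  obtains g D where "square_integrable M g" "AE x in M. (\<lambda>n. f n x) \<longlonglongrightarrow> g x"
    "integrable M D" "AE x in M. \<forall>n. (norm (f n x))\<^sup>2 \<le> D x"
proof -
  define \<rho> where "\<rho> = sqrt q"
  have \<rho>: "0 < \<rho>" "\<rho> < 1" "\<rho> * \<rho> = q" using q by (auto simp: \<rho>_def real_less_lsqrt)
  define d where "d = (\<lambda>n x. f (Suc n) x - f n x)"
  have d: "square_integrable M (d n)" for n
    using square_integrable_add[OF f[of "Suc n"] square_integrable_scale[OF f[of n], of "- 1"]] by (simp add: d_def)
  define p where "p = (\<lambda>n x. (norm (d n x))\<^sup>2 / \<rho> ^ n)"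
  have p0: "0 \<le> p n x" for n x using \<rho> by (simp add: p_def)
  have pint: "integrable M (p n)" for n using d[of n] by (auto simp: p_def square_integrable_def)
  have ple: "(LINT x|M. p n x) \<le> B * \<rho> ^ n" for n
  proof -
    have "(LINT x|M. p n x) = (LINT x|M. (norm (d n x))\<^sup>2) / \<rho> ^ n" by (simp add: p_def)
    also have "\<dots> \<le> B * q ^ n / \<rho> ^ n" using le[of n] \<rho> by (intro divide_right_mono) (auto simp: d_def)
    also have "\<dots> = B * \<rho> ^ n" using \<rho> by (simp add: \<rho>(3)[symmetric] power_mult_distrib)
    finally show ?thesis .
  qed
  have sums: "summable (\<lambda>n. LINT x|M. p n x)"
  proof (rule summable_comparison_test')
    show "summable (\<lambda>n. B * \<rho> ^ n)" using \<rho> by (intro summable_mult summable_geometric) auto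
    show "norm (LINT x|M. p n x) \<le> B * \<rho> ^ n" if "n \<ge> 0" for n
      using ple[of n] p0 by (simp add: integral_nonneg_AE)
  qed
  have AEsum: "AE x in M. summable (\<lambda>n. p n x)"
  proof -
    have "(\<integral>\<^sup>+x. (\<Sum>n. ennreal (p n x)) \<partial>M) = (\<Sum>n. \<integral>\<^sup>+x. ennreal (p n x) \<partial>M)"
      using pint by (intro nn_integral_suminf) (auto intro: borel_measurable_integrable)
    also have "\<dots> = (\<Sum>n. ennreal (LINT x|M. p n x))"
      using pint p0 by (simp add: nn_integral_eq_integral)
    also have "\<dots> < \<infinity>"
      using sums p0 by (simp add: suminf_ennreal2 integral_nonneg_AE)
    finally have "AE x in M. (\<Sum>n. ennreal (p n x)) \<noteq> \<infinity>"
      using pint by (intro nn_integral_PInf_AE) (auto intro!: borel_measurable_suminf measurable_compose[OF borel_measurable_integrable measurable_ennreal])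
    then show ?thesis
    proof eventually_elim
      case (elim x)
      then show ?case using p0 by (intro summable_suminf_not_top) auto
    qed
  qed
  define D where "D = (\<lambda>x. 2 * (norm (f 0 x))\<^sup>2 + 2 * (1 / (1 - \<rho>) * (\<Sum>n. p n x)))"
  have Dint: "integrable M D"
  proof -
    have "integrable M (\<lambda>x. \<Sum>n. p n x)"
      using pint AEsum sums p0 by (intro integrable_suminf) auto
    then show ?thesis using f[of 0] by (auto simp: D_def square_integrable_def)
  qed
  have geo: "(\<Sum>k<n. \<rho> ^ k) \<le> 1 / (1 - \<rho>)" for n
    using \<rho> sum_le_suminf[OF summable_geometric[of \<rho>], of "{..<n}"] suminf_geometric[of \<rho>] by auto
  have bound: "\<forall>n. (norm (f n x))\<^sup>2 \<le> D x" if sx: "summable (\<lambda>n. p n x)" for x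
  proof
    fix n
    have "f n x = f 0 x + (\<Sum>k<n. d k x)" by (induction n) (auto simp: d_def)
    then have "(norm (f n x))\<^sup>2 \<le> 2 * (norm (f 0 x))\<^sup>2 + 2 * (norm (\<Sum>k<n. d k x))\<^sup>2"
      using norm_add_sq_le by metis
    also have "(norm (\<Sum>k<n. d k x))\<^sup>2 \<le> (\<Sum>k<n. norm (d k x))\<^sup>2"
      by (intro power_mono norm_sum) auto
    also have "(\<Sum>k<n. norm (d k x))\<^sup>2 = (\<Sum>k<n. sqrt (\<rho> ^ k) * (norm (d k x) / sqrt (\<rho> ^ k)))\<^sup>2"
      using \<rho> by simp
    also have "\<dots> \<le> (\<Sum>k<n. (sqrt (\<rho> ^ k))\<^sup>2) * (\<Sum>k<n. (norm (d k x) / sqrt (\<rho> ^ k))\<^sup>2)"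
      by (rule Cauchy_Schwarz_ineq_sum)
    also have "\<dots> = (\<Sum>k<n. \<rho> ^ k) * (\<Sum>k<n. p k x)"
      using \<rho> by (simp add: p_def power_divide)
    also have "\<dots> \<le> 1 / (1 - \<rho>) * (\<Sum>k. p k x)"
      using geo p0 sx \<rho> by (intro mult_mono sum_le_suminf sum_nonneg) auto
    finally show "(norm (f n x))\<^sup>2 \<le> D x" unfolding D_def by simp
  qed
  have conv: "convergent (\<lambda>n. f n x)" if sx: "summable (\<lambda>n. p n x)" for x
  proof -
    have "summable (\<lambda>n. norm (d n x))"
    proof (rule summable_comparison_test')
      show "summable (\<lambda>n. \<rho> ^ n + p n x)" using \<rho> sx by (intro summable_add summable_geometric) auto
      show "norm (norm (d n x)) \<le> \<rho> ^ n + p n x" if "n \<ge> 0" for n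
      proof -
        define s where "s = sqrt (\<rho> ^ n)"
        have s: "s > 0" "s\<^sup>2 = \<rho> ^ n" using \<rho> by (auto simp: s_def)
        have "2 * s * (norm (d n x) / s) \<le> s\<^sup>2 + (norm (d n x) / s)\<^sup>2" by (rule sum_squares_bound)
        then have "2 * norm (d n x) \<le> \<rho> ^ n + p n x" using s by (simp add: p_def power_divide)
        then have "norm (d n x) \<le> \<rho> ^ n + p n x" using norm_ge_zero[of "d n x"] by linarith
        then show ?thesis by simp
      qed
    qed
    then have "summable (\<lambda>n. d n x)" by (rule summable_norm_cancel)
    then have "convergent (\<lambda>n. \<Sum>k<n. d k x)" by (simp add: summable_iff_convergent)
    then have "convergent (\<lambda>n. f 0 x + (\<Sum>k<n. d k x))" by (simp add: convergent_add_const_iff)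
    moreover have "f 0 x + (\<Sum>k<n. d k x) = f n x" for n
      using sum_lessThan_telescope[of "\<lambda>k. f k x" n] by (simp add: d_def)
    ultimately show ?thesis by simp
  qed
  define g where "g = (\<lambda>x. lim (\<lambda>n. f n x))"
  have lim: "AE x in M. (\<lambda>n. f n x) \<longlonglongrightarrow> g x"
    using AEsum conv by (auto simp: g_def convergent_LIMSEQ_iff)
  have bd: "AE x in M. \<forall>n. (norm (f n x))\<^sup>2 \<le> D x" using AEsum bound by auto
  have "square_integrable M g"
  proof (rule square_integrable_bound[OF _ Dint])
    show "g \<in> borel_measurable M"
      unfolding g_def using f by (intro borel_measurable_lim_metric) (auto simp: square_integrable_def)
    show "AE x in M. (norm (g x))\<^sup>2 \<le> D x"
      using lim bd
    proof eventually_elim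
      case (elim x)
      then have "(\<lambda>n. (norm (f n x))\<^sup>2) \<longlonglongrightarrow> (norm (g x))\<^sup>2" by (intro tendsto_intros)
      then show ?case using elim(2) by (intro LIMSEQ_le_const2) auto
    qed
  qed
  then show thesis using that lim Dint bd by blast
qed

lemma L2_dominated_weak_limit:
  assumes f: "\<And>n. square_integrable M (f n)" and g: "square_integrable M g" and h: "square_integrable M h"
    and lim: "AE x in M. (\<lambda>n. f n x) \<longlonglongrightarrow> g x"
    and D: "integrable M D" "AE x in M. \<forall>n. (norm (f n x))\<^sup>2 \<le> D x"
  shows "(\<lambda>n. LINT x|M. f n x * cnj (h x)) \<longlonglongrightarrow> (LINT x|M. g x * cnj (h x))"
proof (rule integral_dominated_convergence)
  show "integrable M (\<lambda>x. D x + (norm (h x))\<^sup>2)" using D h by (auto simp: square_integrable_def)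
  show "AE x in M. (\<lambda>n. f n x * cnj (h x)) \<longlonglongrightarrow> g x * cnj (h x)"
    using lim by eventually_elim (intro tendsto_intros)
  show "AE x in M. norm (f n x * cnj (h x)) \<le> D x + (norm (h x))\<^sup>2" for n
    using D(2)
  proof eventually_elim
    case (elim x)
    then show ?case using norm_mult_le_squares[of "f n x" "cnj (h x)"] by (smt (verit) complex_mod_cnj)
  qed
qed (use f g h square_integrable_inner_integrable in \<open>auto intro!: borel_measurable_integrable\<close>)

lemma geometrically_complete_L2: "geometrically_complete (L2 M)"
  unfolding geometrically_complete_def
proof (intro allI impI, elim conjE)
  fix u :: "nat \<Rightarrow> ('a \<Rightarrow> complex) set" and B q :: real
  assume u: "\<forall>n. u n \<in> hcarrier (L2 M)" and q: "0 < q" "q < 1"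
    and le: "\<forall>n. (hnorm (L2 M) (hadd (L2 M) (u (Suc n)) (hscale (L2 M) (- 1) (u n))))\<^sup>2 \<le> B * q ^ n"
  have "\<forall>n. \<exists>f. square_integrable M f \<and> u n = L2_class M f" using u by (meson L2_carrierE)
  then obtain f where f: "\<And>n. square_integrable M (f n)" "\<And>n. u n = L2_class M (f n)" by metis
  have close: "(LINT x|M. (norm (f (Suc n) x - f n x))\<^sup>2) \<le> B * q ^ n" for n
  proof -
    have s: "square_integrable M (\<lambda>x. f (Suc n) x + (- 1) * f n x)"
      using f(1) by (intro square_integrable_add square_integrable_scale)
    have "hadd (L2 M) (u (Suc n)) (hscale (L2 M) (- 1) (u n)) = L2_class M (\<lambda>x. f (Suc n) x + (- 1) * f n x)"
      unfolding f(2) L2_scale[OF f(1)] by (intro L2_add f(1) square_integrable_scale)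
    then show ?thesis using le[rule_format, of n] L2_hnorm_sq[OF s] by simp
  qed
  obtain g D where g: "square_integrable M g" "AE x in M. (\<lambda>n. f n x) \<longlonglongrightarrow> g x"
    "integrable M D" "AE x in M. \<forall>n. (norm (f n x))\<^sup>2 \<le> D x"
    using L2_geometric_limit[OF f(1) q close] by blast
  show "\<exists>l\<in>hcarrier (L2 M). \<forall>w\<in>hcarrier (L2 M). (\<lambda>n. hinner (L2 M) (u n) w) \<longlonglongrightarrow> hinner (L2 M) l w"
  proof (intro bexI[of _ "L2_class M g"] ballI)
    fix w assume "w \<in> hcarrier (L2 M)"
    then obtain h where h: "square_integrable M h" "w = L2_class M h" by (meson L2_carrierE)
    then show "(\<lambda>n. hinner (L2 M) (u n) w) \<longlonglongrightarrow> hinner (L2 M) (L2_class M g) w"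
      using L2_dominated_weak_limit[OF f(1) g(1) h(1) g(2,3,4)] by (simp add: f L2_inner g(1))
  qed (use g in auto)
qed

section \<open>Fubini and Tonelli for completed product measures\<close>

context inner_space
begin

lemma orthogonal_independent:
  assumes "\<And>i. i < n \<Longrightarrow> u i \<in> C" "\<And>i. i < n \<Longrightarrow> u i \<noteq> hzero H"
    and "\<And>i j. \<lbrakk>i < n; j < n; i \<noteq> j\<rbrakk> \<Longrightarrow> ip (u i) (u j) = 0"
  shows "hindependent H n u"
  unfolding hindependent_def
proof (intro allI impI)
  fix c j assume z: "hlincomb H n c u = hzero H" and j: "j < n"
  have "(\<Sum>i<n. c i * ip (u i) (u j)) = 0"
    using z assms(1) j hlincomb_eq_zero_iff[of n u c] by blast
  also have "(\<Sum>i<n. c i * ip (u i) (u j)) = (\<Sum>i<n. if i = j then c j * ip (u j) (u j) else 0)"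
    using assms(3) j by (intro sum.cong) auto
  finally have "c j * ip (u j) (u j) = 0" using j by simp
  moreover have "ip (u j) (u j) \<noteq> 0" using nsq_pos[OF assms(1,2)[OF j]] by auto
  ultimately show "c j = 0" by simp
qed

end

text \<open>
  Infinitely many orthogonal vectors cannot all be moved by \<open>\<Phi>\<close> out of a subspace of finite
  codimension: some nonzero combination lands in it.
\<close>

lemma exists_annihilated_by_functionals:
  assumes "inner_space H" "inner_space K"
    and L: "hsubspace H L"
    and u: "\<And>n::nat. u n \<in> L" "\<And>n. u n \<noteq> hzero H" "\<And>i j. i \<noteq> j \<Longrightarrow> hinner H (u i) (u j) = 0"
    and closed: "\<And>x. x \<in> L \<Longrightarrow> \<Phi> x \<in> hcarrier K"
    and add: "\<And>x y. \<lbrakk>x \<in> L; y \<in> L\<rbrakk> \<Longrightarrow> \<Phi> (hadd H x y) = hadd K (\<Phi> x) (\<Phi> y)"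
    and scale: "\<And>c x. x \<in> L \<Longrightarrow> \<Phi> (hscale H c x) = hscale K c (\<Phi> x)"
    and zero: "\<Phi> (hzero H) = hzero K"
    and b: "\<forall>i<(N::nat). b i \<in> hcarrier K"
  shows "\<exists>x\<in>L. x \<noteq> hzero H \<and> (\<forall>i<N. hinner K (\<Phi> x) (b i) = 0)"
proof -
  interpret H: inner_space H by fact
  interpret K: inner_space K by fact
  have LC: "\<And>x. x \<in> L \<Longrightarrow> x \<in> hcarrier H" using L by (auto simp: hsubspace_def)
  obtain c where c: "\<exists>j\<in>{..<Suc N}. c j \<noteq> 0"
    "\<forall>i\<in>{..<N}. (\<Sum>j\<in>{..<Suc N}. c j * hinner K (\<Phi> (u j)) (b i)) = 0"
    using underdetermined_system[of "{..<N}" "{..<Suc N}" "\<lambda>i j. hinner K (\<Phi> (u j)) (b i)"] by auto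
  let ?x = "hlincomb H (Suc N) c u"
  have "hindependent H (Suc N) u" using u LC by (intro H.orthogonal_independent) auto
  then have nz: "?x \<noteq> hzero H" using c(1) by (auto simp: hindependent_def)
  have in_L: "hlincomb H n c u \<in> L" for n by (rule H.hlincomb_in_subspace[OF L]) (rule u)
  have \<Phi>_lin: "\<Phi> (hlincomb H n c u) = hlincomb K n c (\<lambda>i. \<Phi> (u i))" for n
  proof (induction n)
    case (Suc n)
    have "hscale H (c n) (u n) \<in> L" using L u by (auto simp: hsubspace_def)
    then show ?case using Suc add[OF in_L[of n]] scale[OF u(1)] by simp
  qed (simp add: zero)
  have "hinner K (\<Phi> ?x) (b i) = 0" if "i < N" for i
    unfolding \<Phi>_lin using c(2) that b closed[OF u(1)] by (subst K.ip_hlincomb) auto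
  then show ?thesis using in_L nz by blast
qed

lemma completion_measurable_AE:
  assumes f: "f \<in> measurable (completion N) L" and eq: "AE x in completion N. f x = g x"
    and g: "\<And>x. x \<in> space N \<Longrightarrow> g x \<in> space L"
  shows "g \<in> measurable (completion N) L"
proof (rule measurableI)
  fix A assume A: "A \<in> sets L"
  show "g -` A \<inter> space (completion N) \<in> sets (completion N)"
  proof (rule completion.in_sets_AE)
    show "f -` A \<inter> space (completion N) \<in> sets (completion N)" using f A by (rule measurable_sets)
    show "AE x in completion N. x \<in> f -` A \<inter> space (completion N) \<longleftrightarrow> x \<in> g -` A \<inter> space (completion N)"
      using eq by eventually_elim auto
  qed auto
qed (use g in simp)

lemma completion_ex_borel_measurable_complex:
  fixes g :: "'a \<Rightarrow> complex"
  assumes g: "g \<in> borel_measurable (completion N)"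
  shows "\<exists>g'\<in>borel_measurable N. AE x in N. g x = g' x"
proof -
  have "(\<lambda>x. Re (g x)) \<in> borel_measurable (completion N)" "(\<lambda>x. Im (g x)) \<in> borel_measurable (completion N)"
    using g by auto
  then obtain r i where "r \<in> borel_measurable N" "AE x in N. Re (g x) = r x"
    "i \<in> borel_measurable N" "AE x in N. Im (g x) = i x"
    using completion_ex_borel_measurable_real by metis
  then show ?thesis
    by (intro bexI[of _ "\<lambda>x. Complex (r x) (i x)"])
      (auto elim!: eventually_elim2 simp: complex_eq_iff borel_measurable_complex_iff)
qed

text \<open>
  Completing and restricting commute, so that \<open>lebesgue_on S\<close> is the completion of a measure on Borel
  sets.
\<close>

lemma restrict_space_completion:
  assumes S: "S \<in> sets N"
  shows "restrict_space (completion N) S = completion (restrict_space N S)"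
proof -
  have SN: "S \<inter> space N = S" using sets.sets_into_space[OF S] by blast
  have sets_split: thesis if A: "A \<in> sets (restrict_space (completion N) S)"
    and *: "\<And>A1 Z N2. \<lbrakk>A = A1 \<union> Z; A1 \<in> sets N; A1 \<subseteq> S; Z \<subseteq> N2; N2 \<in> null_sets N; N2 \<subseteq> S\<rbrakk> \<Longrightarrow> thesis"
    for A thesis
  proof -
    obtain A' where A': "A' \<in> sets (completion N)" "A = S \<inter> A'"
      using A by (auto simp: sets_restrict_space)
    then obtain X Z N2 where X: "A' = X \<union> Z" "Z \<subseteq> N2" "N2 \<in> null_sets N" "X \<in> sets N"
      by (auto elim!: sets_completionE)
    have "N2 \<inter> S \<in> null_sets N" using X(3) S by (simp add: null_set_Int2)
    then show thesis
      by (intro *[of "X \<inter> S" "Z \<inter> S" "N2 \<inter> S"]) (use X A' S in auto)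
  qed
  have R_sets: "A1 \<in> sets (restrict_space N S)" if "A1 \<in> sets N" "A1 \<subseteq> S" for A1
    using that S SN by (subst sets_restrict_space_iff) auto
  have R_null: "N2 \<in> null_sets (restrict_space N S)" if "N2 \<in> null_sets N" "N2 \<subseteq> S" for N2
    using that S SN R_sets[of N2] by (auto simp: null_sets_def emeasure_restrict_space)
  show ?thesis
  proof (rule measure_eqI)
    show sets_eq: "sets (restrict_space (completion N) S) = sets (completion (restrict_space N S))"
    proof (intro equalityI subsetI)
      fix A assume "A \<in> sets (restrict_space (completion N) S)"
      then obtain A1 Z N2 where "A = A1 \<union> Z" "A1 \<in> sets N" "A1 \<subseteq> S" "Z \<subseteq> N2" "N2 \<in> null_sets N" "N2 \<subseteq> S"
        by (rule sets_split)
      then show "A \<in> sets (completion (restrict_space N S))"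
        using R_sets R_null by (intro sets_completionI[of _ A1 Z N2]) simp_all
    next
      fix A assume "A \<in> sets (completion (restrict_space N S))"
      then obtain X Z N2 where X: "A = X \<union> Z" "Z \<subseteq> N2" "N2 \<in> null_sets (restrict_space N S)"
          "X \<in> sets (restrict_space N S)"
        by (auto elim!: sets_completionE)
      have XN: "X \<in> sets N" "X \<subseteq> S" "N2 \<subseteq> S" "N2 \<in> null_sets N"
        using X(3,4) S SN by (auto simp: sets_restrict_space_iff null_sets_def emeasure_restrict_space)
      then have "A \<in> sets (completion N)" using X by (intro sets_completionI[of _ X Z N2]) simp_all
      moreover have "A \<subseteq> S" using X XN by auto
      ultimately show "A \<in> sets (restrict_space (completion N) S)"
        using S by (subst sets_restrict_space_iff) (auto simp: SN)
    qed
    fix A assume A: "A \<in> sets (restrict_space (completion N) S)"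
    then obtain A1 Z N2 where A1: "A = A1 \<union> Z" "A1 \<in> sets N" "A1 \<subseteq> S" "Z \<subseteq> N2" "N2 \<in> null_sets N" "N2 \<subseteq> S"
      by (rule sets_split)
    have Z1: "Z \<in> null_sets (completion N)"
      using A1 null_sets_completionI completion.complete2 by metis
    have Z2: "Z \<in> null_sets (completion (restrict_space N S))"
      using A1 R_null null_sets_completionI completion.complete2 by metis
    have "A \<subseteq> S" using A1 by auto
    then have "emeasure (restrict_space (completion N) S) A = emeasure (completion N) A"
      using S by (intro emeasure_restrict_space) (auto simp: SN)
    also have "\<dots> = emeasure N A1"
      using A1 Z1 by (simp add: emeasure_Un_null_set)
    also have "\<dots> = emeasure (restrict_space N S) A1"
      using A1 S by (subst emeasure_restrict_space) (auto simp: SN)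
    also have "\<dots> = emeasure (completion (restrict_space N S)) A"
      using A1 Z2 R_sets[of A1] by (simp add: emeasure_Un_null_set)
    finally show "emeasure (restrict_space (completion N) S) A = emeasure (completion (restrict_space N S)) A" .
  qed
qed

lemma restrict_lborel_pair:
  fixes S :: "'a::euclidean_space set" and T :: "'b::euclidean_space set"
  assumes S: "S \<in> sets borel" and T: "T \<in> sets borel"
  shows "restrict_space lborel S \<Otimes>\<^sub>M restrict_space lborel T = restrict_space lborel (S \<times> T)"
proof (rule pair_measure_eqI)
  show "sigma_finite_measure (restrict_space lborel S)" "sigma_finite_measure (restrict_space lborel T)"
    using S T by (auto intro!: sigma_finite_measure_restrict_space sigma_finite_lborel)
  have ST: "S \<times> T \<in> sets (lborel :: ('a \<times> 'b) measure)"
    unfolding lborel_prod[symmetric] using S T by (intro pair_measureI) auto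
  have times: "A \<times> B \<in> sets (restrict_space lborel (S \<times> T))"
    if "A \<in> sets (restrict_space lborel S)" "B \<in> sets (restrict_space lborel T)" for A B
  proof -
    have "A \<in> sets lborel" "B \<in> sets lborel" "A \<subseteq> S" "B \<subseteq> T"
      using that S T by (auto simp: sets_restrict_space_iff)
    moreover from this have "A \<times> B \<in> sets (lborel :: ('a \<times> 'b) measure)"
      unfolding lborel_prod[symmetric] by (intro pair_measureI)
    ultimately show ?thesis using ST by (subst sets_restrict_space_iff) auto
  qed
  show "sets (restrict_space lborel S \<Otimes>\<^sub>M restrict_space lborel T) = sets (restrict_space lborel (S \<times> T))"
  proof (intro equalityI)
    show "sets (restrict_space lborel S \<Otimes>\<^sub>M restrict_space lborel T) \<subseteq> sets (restrict_space lborel (S \<times> T))"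
      unfolding sets_pair_measure
    proof (rule sets.sigma_sets_subset', safe)
      show "space (restrict_space lborel S) \<times> space (restrict_space lborel T) \<in> sets (restrict_space lborel (S \<times> T))"
        by (intro times) auto
    qed (rule times)
    have id: "(\<lambda>x. x) \<in> measurable (restrict_space lborel S \<Otimes>\<^sub>M restrict_space lborel T) (lborel \<Otimes>\<^sub>M lborel)"
    proof -
      have "(\<lambda>x. (fst x, snd x)) \<in> measurable (restrict_space lborel S \<Otimes>\<^sub>M restrict_space lborel T) (lborel \<Otimes>\<^sub>M lborel)"
        by (intro measurable_Pair measurable_compose[OF measurable_fst] measurable_compose[OF measurable_snd])
          (auto intro!: measurable_restrict_space1)
      then show ?thesis by simp
    qed
    show "sets (restrict_space lborel (S \<times> T)) \<subseteq> sets (restrict_space lborel S \<Otimes>\<^sub>M restrict_space lborel T)"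
    proof
      fix X assume "X \<in> sets (restrict_space lborel (S \<times> T))"
      then have "X \<in> sets (lborel \<Otimes>\<^sub>M lborel)" "X \<subseteq> S \<times> T"
        unfolding lborel_prod using ST by (auto simp: sets_restrict_space_iff)
      then show "X \<in> sets (restrict_space lborel S \<Otimes>\<^sub>M restrict_space lborel T)"
        using measurable_sets[OF id, of X] by (simp add: space_pair_measure space_restrict_space Int_absorb2)
    qed
  qed
  fix A B assume AB: "A \<in> sets (restrict_space lborel S)" "B \<in> sets (restrict_space lborel T)"
  then have "A \<in> sets lborel" "B \<in> sets lborel" "A \<subseteq> S" "B \<subseteq> T"
    using S T by (auto simp: sets_restrict_space_iff)
  then show "emeasure (restrict_space lborel S) A * emeasure (restrict_space lborel T) B
      = emeasure (restrict_space lborel (S \<times> T)) (A \<times> B)"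
    using S T ST
    by (subst (1 2 3) emeasure_restrict_space)
      (auto simp: lborel_prod[symmetric] lborel.emeasure_pair_measure_Times)
qed

text \<open>
  Lebesgue measure on a product set is the completion of the product measure, not the product of
  the completed measures.  All measurability questions are reduced to the uncompleted product by
  replacing a function by an almost everywhere equal one.
\<close>

locale completed_square = finite_measure B for B :: "'a measure" +
  fixes M :: "'a measure" and M2 :: "('a \<times> 'a) measure"
  assumes M_eq: "M = completion B" and M2_eq: "M2 = completion (B \<Otimes>\<^sub>M B)"
begin

sublocale BB: pair_sigma_finite B B ..

lemma space_M [simp]: "space M = space B" by (simp add: M_eq)

lemma finite_measure_M: "finite_measure M"
  using finite_emeasure_space by (intro finite_measureI) (simp add: M_eq)

lemma AE_M_iff: "(AE x in M. P x) \<longleftrightarrow> (AE x in B. P x)"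
  unfolding M_eq by (rule AE_completion_iff)

lemma AE_M2_iff: "(AE x in M2. P x) \<longleftrightarrow> (AE x in B \<Otimes>\<^sub>M B. P x)"
  unfolding M2_eq by (rule AE_completion_iff)

lemma measurable_AE_M: "f \<in> borel_measurable M \<Longrightarrow> AE x in M. f x = g x \<Longrightarrow> g \<in> borel_measurable M"
  unfolding M_eq by (rule completion_measurable_AE) auto

lemma measurable_AE_M2: "f \<in> borel_measurable M2 \<Longrightarrow> AE x in M2. f x = g x \<Longrightarrow> g \<in> borel_measurable M2"
  unfolding M2_eq by (rule completion_measurable_AE) auto

lemma measurable_B_M: "f \<in> borel_measurable B \<Longrightarrow> f \<in> borel_measurable M"
  by (simp add: M_eq measurable_completion)

lemma measurable_BB_M2: "f \<in> borel_measurable (B \<Otimes>\<^sub>M B) \<Longrightarrow> f \<in> borel_measurable M2"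
  by (simp add: M2_eq measurable_completion)

lemma AE_sections: "AE p in M2. P p \<Longrightarrow> AE x in M. AE y in M. P (x, y)"
  unfolding AE_M_iff AE_M2_iff by (rule BB.AE_pair)

lemma AE_swap: "AE p in M2. P p \<Longrightarrow> AE p in M2. P (prod.swap p)"
  unfolding AE_M2_iff
  by (subst (asm) BB.distr_pair_swap, drule AE_distrD[rotated]) (auto simp: prod.swap_def case_prod_beta elim: AE_mp)

lemma AE_fst: 
  assumes "AE x in M. P x" shows "AE p in M2. P (fst p)"
proof -
  obtain N where N': "{x \<in> space B. \<not> P x} \<subseteq> N" "emeasure B N = 0" "N \<in> sets B"
    using assms unfolding AE_M_iff by (rule AE_E)
  then have N: "N \<in> null_sets B" "{x \<in> space B. \<not> P x} \<subseteq> N" by auto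
  then have "emeasure (B \<Otimes>\<^sub>M B) (N \<times> space B) = 0"
    by (subst emeasure_pair_measure_Times) auto
  then have "N \<times> space B \<in> null_sets (B \<Otimes>\<^sub>M B)" using N by (auto simp: null_sets_def)
  then show ?thesis
    unfolding AE_M2_iff by (rule AE_I') (use N in \<open>auto simp: space_pair_measure\<close>)
qed

lemma AE_snd: "AE x in M. P x \<Longrightarrow> AE p in M2. P (snd p)"
  using AE_swap[OF AE_fst, of P] by simp

lemma rep_M:
  fixes f :: "'a \<Rightarrow> complex"
  assumes "f \<in> borel_measurable M"
  obtains f' where "f' \<in> borel_measurable B" "AE x in M. f x = f' x"
  using assms completion_ex_borel_measurable_complex[of f B] unfolding M_eq AE_completion_iff by blast

lemma rep_M2:
  fixes f :: "'a \<times> 'a \<Rightarrow> complex"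
  assumes "f \<in> borel_measurable M2"
  obtains f' where "f' \<in> borel_measurable (B \<Otimes>\<^sub>M B)" "AE x in M2. f x = f' x"
  using assms completion_ex_borel_measurable_complex[of f "B \<Otimes>\<^sub>M B"] unfolding M2_eq AE_completion_iff by blast

lemma measurable_fst_M2:
  fixes f :: "'a \<Rightarrow> complex"
  assumes "f \<in> borel_measurable M" shows "(\<lambda>p. f (fst p)) \<in> borel_measurable M2"
proof -
  obtain f' where f': "f' \<in> borel_measurable B" "AE x in M. f x = f' x" using rep_M[OF assms] .
  have "(\<lambda>p. f' (fst p)) \<in> borel_measurable M2" using f' by (intro measurable_BB_M2) simp
  moreover have "AE p in M2. f' (fst p) = f (fst p)" using AE_fst[OF f'(2)] by (rule AE_symmetric)
  ultimately show ?thesis by (rule measurable_AE_M2)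
qed

lemma measurable_swap:
  fixes f :: "'a \<times> 'a \<Rightarrow> complex"
  assumes "f \<in> borel_measurable M2" shows "(\<lambda>p. f (prod.swap p)) \<in> borel_measurable M2"
proof -
  obtain f' where f': "f' \<in> borel_measurable (B \<Otimes>\<^sub>M B)" "AE x in M2. f x = f' x" using rep_M2[OF assms] .
  have "(\<lambda>p. f' (prod.swap p)) \<in> borel_measurable (B \<Otimes>\<^sub>M B)"
    using f'(1) by (rule measurable_compose[rotated]) (simp add: prod.swap_def)
  then have "(\<lambda>p. f' (prod.swap p)) \<in> borel_measurable M2" by (rule measurable_BB_M2)
  moreover have "AE p in M2. f' (prod.swap p) = f (prod.swap p)" using AE_swap[OF f'(2)] by (rule AE_symmetric)
  ultimately show ?thesis by (rule measurable_AE_M2)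
qed

lemma measurable_snd_M2:
  fixes f :: "'a \<Rightarrow> complex"
  assumes "f \<in> borel_measurable M" shows "(\<lambda>p. f (snd p)) \<in> borel_measurable M2"
  using measurable_swap[OF measurable_fst_M2[OF assms]] by simp

lemma section_eq:
  assumes "f' \<in> borel_measurable (B \<Otimes>\<^sub>M B)" "AE x in M2. f x = f' x"
  shows "AE x in M. (\<lambda>y. f (x, y)) \<in> borel_measurable M \<and> (AE y in M. f (x, y) = f' (x, y))"
  using AE_sections[OF assms(2)] AE_space
proof eventually_elim
  case (elim x)
  have "(\<lambda>y. f' (x, y)) \<in> borel_measurable M"
    using assms(1) elim(2) by (intro measurable_B_M) simp
  then show ?case using elim(1) measurable_AE_M[OF _ AE_symmetric[OF elim(1)]] by simp
qed

lemma section_measurable: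
  fixes f :: "'a \<times> 'a \<Rightarrow> complex"
  assumes "f \<in> borel_measurable M2"
  shows "AE x in M. (\<lambda>y. f (x, y)) \<in> borel_measurable M"
proof -
  obtain f' where f': "f' \<in> borel_measurable (B \<Otimes>\<^sub>M B)" "AE x in M2. f x = f' x" using rep_M2[OF assms] .
  show ?thesis using section_eq[OF f'] by eventually_elim blast
qed

lemma integral_rep:
  fixes f :: "'a \<times> 'a \<Rightarrow> complex"
  assumes "f \<in> borel_measurable M2" "f' \<in> borel_measurable (B \<Otimes>\<^sub>M B)" "AE x in M2. f x = f' x"
  shows "(LINT p|M2. f p) = (LINT p|(B \<Otimes>\<^sub>M B). f' p)"
proof -
  have "(LINT p|M2. f p) = (LINT p|M2. f' p)"
    using assms(1) measurable_BB_M2[OF assms(2)] assms(3) by (rule integral_cong_AE)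
  then show ?thesis using assms(2) by (simp add: M2_eq integral_completion)
qed

lemma nn_integral_swap:
  fixes f :: "'a \<times> 'a \<Rightarrow> ennreal"
  assumes "f \<in> borel_measurable M2"
  shows "(\<integral>\<^sup>+p. f (prod.swap p) \<partial>M2) = (\<integral>\<^sup>+p. f p \<partial>M2)"
proof -
  obtain f' where f': "f' \<in> borel_measurable (B \<Otimes>\<^sub>M B)" "AE x in M2. f x = f' x"
    using assms completion_ex_borel_measurable[of f "B \<Otimes>\<^sub>M B"] unfolding M2_eq AE_completion_iff by blast
  have "(\<integral>\<^sup>+p. f (prod.swap p) \<partial>M2) = (\<integral>\<^sup>+p. f' (prod.swap p) \<partial>M2)"
    using AE_swap[OF f'(2)] by (rule nn_integral_cong_AE)
  also have "\<dots> = (\<integral>\<^sup>+p. f' (prod.swap p) \<partial>(B \<Otimes>\<^sub>M B))" by (simp add: M2_eq nn_integral_completion)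
  also have "\<dots> = (\<integral>\<^sup>+p. f' p \<partial>distr (B \<Otimes>\<^sub>M B) (B \<Otimes>\<^sub>M B) (\<lambda>(x, y). (y, x)))"
    using f'(1) by (subst nn_integral_distr) (auto simp: prod.swap_def case_prod_beta)
  also have "\<dots> = (\<integral>\<^sup>+p. f' p \<partial>M2)"
    unfolding BB.distr_pair_swap[symmetric] by (simp add: M2_eq nn_integral_completion)
  also have "\<dots> = (\<integral>\<^sup>+p. f p \<partial>M2)" using f'(2) by (intro nn_integral_cong_AE) auto
  finally show ?thesis .
qed

lemma Tonelli:
  fixes f :: "'a \<times> 'a \<Rightarrow> ennreal"
  assumes "f \<in> borel_measurable M2"
  shows "(\<lambda>x. \<integral>\<^sup>+y. f (x, y) \<partial>M) \<in> borel_measurable M"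
    and "(\<integral>\<^sup>+p. f p \<partial>M2) = (\<integral>\<^sup>+x. \<integral>\<^sup>+y. f (x, y) \<partial>M \<partial>M)"
proof -
  obtain f' where f': "f' \<in> borel_measurable (B \<Otimes>\<^sub>M B)" "AE x in M2. f x = f' x"
    using assms completion_ex_borel_measurable[of f "B \<Otimes>\<^sub>M B"] unfolding M2_eq AE_completion_iff by blast
  have eq: "AE x in M. (\<integral>\<^sup>+y. f' (x, y) \<partial>B) = (\<integral>\<^sup>+y. f (x, y) \<partial>M)"
    using section_eq[OF f']
  proof eventually_elim
    case (elim x)
    have "(\<integral>\<^sup>+y. f' (x, y) \<partial>B) = (\<integral>\<^sup>+y. f' (x, y) \<partial>M)" by (simp add: M_eq nn_integral_completion)
    also have "\<dots> = (\<integral>\<^sup>+y. f (x, y) \<partial>M)" using elim by (intro nn_integral_cong_AE) auto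
    finally show ?case .
  qed
  have "(\<lambda>x. \<integral>\<^sup>+y. f' (x, y) \<partial>B) \<in> borel_measurable M" using f' by (intro measurable_B_M) simp
  then show "(\<lambda>x. \<integral>\<^sup>+y. f (x, y) \<partial>M) \<in> borel_measurable M" using eq by (rule measurable_AE_M)
  have "(\<integral>\<^sup>+p. f p \<partial>M2) = (\<integral>\<^sup>+p. f' p \<partial>(B \<Otimes>\<^sub>M B))"
    using nn_integral_cong_AE[OF f'(2)] by (simp add: M2_eq nn_integral_completion)
  also have "\<dots> = (\<integral>\<^sup>+x. \<integral>\<^sup>+y. f' (x, y) \<partial>B \<partial>B)" using nn_integral_fst[OF f'(1)] by simp
  also have "\<dots> = (\<integral>\<^sup>+x. \<integral>\<^sup>+y. f' (x, y) \<partial>B \<partial>M)" by (simp add: M_eq nn_integral_completion)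
  also have "\<dots> = (\<integral>\<^sup>+x. \<integral>\<^sup>+y. f (x, y) \<partial>M \<partial>M)" using eq by (rule nn_integral_cong_AE)
  finally show "(\<integral>\<^sup>+p. f p \<partial>M2) = (\<integral>\<^sup>+x. \<integral>\<^sup>+y. f (x, y) \<partial>M \<partial>M)" .
qed

lemma Fubini:
  fixes f :: "'a \<times> 'a \<Rightarrow> complex"
  assumes "integrable M2 f"
  shows "AE x in M. integrable M (\<lambda>y. f (x, y))"
    and "integrable M (\<lambda>x. LINT y|M. f (x, y))"
    and "(LINT p|M2. f p) = (LINT x|M. LINT y|M. f (x, y))"
proof -
  have fm: "f \<in> borel_measurable M2" using assms by auto
  then obtain f' where f': "f' \<in> borel_measurable (B \<Otimes>\<^sub>M B)" "AE x in M2. f x = f' x" by (rule rep_M2)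
  have "integrable M2 f'"
    using assms f' fm measurable_BB_M2[OF f'(1)] by (subst integrable_cong_AE[of _ _ f]) auto
  then have int: "integrable (B \<Otimes>\<^sub>M B) f'" using f'(1) by (simp add: M2_eq integrable_completion)
  have eq: "AE x in M. integrable M (\<lambda>y. f (x, y)) \<and> (LINT y|B. f' (x, y)) = (LINT y|M. f (x, y))"
    using section_eq[OF f'] AE_M_iff[THEN iffD2, OF BB.AE_integrable_fst'[OF int]] AE_space
  proof eventually_elim
    case (elim x)
    have m: "(\<lambda>y. f' (x, y)) \<in> borel_measurable B" using f'(1) elim(3) by simp
    have i: "integrable M (\<lambda>y. f' (x, y))" using elim(2) m by (simp add: M_eq integrable_completion)
    have "integrable M (\<lambda>y. f (x, y))"
      using i elim(1) by (subst integrable_cong_AE[of _ _ "\<lambda>y. f' (x, y)"]) auto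
    moreover have "(LINT y|M. f (x, y)) = (LINT y|M. f' (x, y))"
      using i elim(1) by (intro integral_cong_AE) auto
    ultimately show ?case using m by (simp add: M_eq integral_completion)
  qed
  show "AE x in M. integrable M (\<lambda>y. f (x, y))" using eq by (auto elim: AE_mp)
  have i1: "integrable B (\<lambda>x. LINT y|B. f' (x, y))" by (rule BB.integrable_fst'[OF int])
  then have m1: "(\<lambda>x. LINT y|B. f' (x, y)) \<in> borel_measurable B" by auto
  have i2: "integrable M (\<lambda>x. LINT y|B. f' (x, y))" using i1 m1 by (simp add: M_eq integrable_completion)
  have eq2: "AE x in M. (LINT y|B. f' (x, y)) = (LINT y|M. f (x, y))" using eq by (auto elim: AE_mp)
  have m2: "(\<lambda>x. LINT y|M. f (x, y)) \<in> borel_measurable M"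
    by (rule measurable_AE_M[OF measurable_B_M[OF m1] eq2])
  show "integrable M (\<lambda>x. LINT y|M. f (x, y))"
    using i2 m2 eq2 by (subst integrable_cong_AE[of _ _ "\<lambda>x. LINT y|B. f' (x, y)"]) (auto elim: AE_mp)
  have "(LINT p|M2. f p) = (LINT p|(B \<Otimes>\<^sub>M B). f' p)" using fm f' by (rule integral_rep)
  also have "\<dots> = (LINT x|B. LINT y|B. f' (x, y))" using BB.integral_fst'[OF int] by simp
  also have "\<dots> = (LINT x|M. LINT y|B. f' (x, y))" using m1 by (simp add: M_eq integral_completion)
  also have "\<dots> = (LINT x|M. LINT y|M. f (x, y))"
    using measurable_B_M[OF m1] m2 eq2 by (rule integral_cong_AE)
  finally show "(LINT p|M2. f p) = (LINT x|M. LINT y|M. f (x, y))" .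
qed

lemma integral_swap:
  fixes f :: "'a \<times> 'a \<Rightarrow> complex"
  assumes "integrable M2 f"
  shows "integrable M2 (\<lambda>p. f (prod.swap p))" "(LINT p|M2. f (prod.swap p)) = (LINT p|M2. f p)"
proof -
  have fm: "f \<in> borel_measurable M2" using assms by auto
  then obtain f' where f': "f' \<in> borel_measurable (B \<Otimes>\<^sub>M B)" "AE x in M2. f x = f' x" by (rule rep_M2)
  have "(\<integral>\<^sup>+p. ennreal (norm (f (prod.swap p))) \<partial>M2) = (\<integral>\<^sup>+p. ennreal (norm (f p)) \<partial>M2)"
    using fm by (intro nn_integral_swap) auto
  then show "integrable M2 (\<lambda>p. f (prod.swap p))"
    using assms measurable_swap[OF fm] by (simp add: integrable_iff_bounded)
  have sm: "(\<lambda>p. f' (prod.swap p)) \<in> borel_measurable (B \<Otimes>\<^sub>M B)"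
    using f'(1) by (rule measurable_compose[rotated]) (simp add: prod.swap_def)
  have "(LINT p|M2. f (prod.swap p)) = (LINT p|M2. f' (prod.swap p))"
    using measurable_swap[OF fm] measurable_BB_M2[OF sm] AE_swap[OF f'(2)] by (rule integral_cong_AE)
  also have "\<dots> = (LINT p|(B \<Otimes>\<^sub>M B). f' (prod.swap p))" using sm by (simp add: M2_eq integral_completion)
  also have "\<dots> = (LINT p|distr (B \<Otimes>\<^sub>M B) (B \<Otimes>\<^sub>M B) (\<lambda>(x, y). (y, x)). f' p)"
    using f'(1) by (subst integral_distr) (auto simp: prod.swap_def case_prod_beta)
  also have "\<dots> = (LINT p|M2. f p)"
    unfolding BB.distr_pair_swap[symmetric] using integral_rep[OF fm f'] by simp
  finally show "(LINT p|M2. f (prod.swap p)) = (LINT p|M2. f p)" .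
qed

end

text \<open>
  The distribution function of \<open>\<phi>\<close> on \<open>W\<close> is continuous because the level sets of \<open>\<phi>\<close> are null sets;
  hence it takes the values \<open>|W|/2, |W|/4, \<dots>\<close> by the intermediate value theorem.
\<close>

lemma halving_levels:
  assumes K: "finite_measure K" and \<phi>: "\<phi> \<in> borel_measurable K"
    and levels: "\<And>t. measure K {x \<in> space K. \<phi> x = t} = 0"
    and W: "W \<in> sets K" and pos: "measure K W > 0"
  obtains t :: "nat \<Rightarrow> real" where "\<And>n. t (Suc n) < t n"
    "\<And>n. measure K (W \<inter> {x \<in> space K. \<phi> x \<le> t n}) = measure K W / 2 ^ Suc n"
proof -
  interpret K: finite_measure K by fact
  let ?R = "restrict_space K W"
  have WK: "W \<subseteq> space K" using W by (rule sets.sets_into_space)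
  have \<phi>R: "\<phi> \<in> borel_measurable ?R" using \<phi> by (rule measurable_restrict_space1)
  have fR: "finite_measure ?R" using W by (intro finite_measure_restrict_space K) simp
  define \<nu> where "\<nu> = distr ?R borel \<phi>"
  interpret \<nu>: finite_borel_measure \<nu>
  proof -
    interpret finite_measure ?R by fact
    have "finite_measure \<nu>" unfolding \<nu>_def using \<phi>R by (rule finite_measure_distr)
    then show "finite_borel_measure \<nu>" by (simp add: finite_borel_measure_def finite_borel_measure_axioms_def \<nu>_def)
  qed
  have \<nu>_measure: "measure \<nu> A = measure K (W \<inter> {x \<in> space K. \<phi> x \<in> A})" if "A \<in> sets borel" for A
  proof -
    have "measure \<nu> A = measure ?R (\<phi> -` A \<inter> space ?R)"
      unfolding \<nu>_def using \<phi>R that by (rule measure_distr)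
    also have "\<phi> -` A \<inter> space ?R = W \<inter> {x \<in> space K. \<phi> x \<in> A}" using WK by (auto simp: space_restrict_space)
    also have "measure ?R \<dots> = measure K (W \<inter> {x \<in> space K. \<phi> x \<in> A})"
      using W WK by (intro measure_restrict_space) auto
    finally show ?thesis .
  qed
  define g where "g = cdf \<nu>"
  have g: "g t = measure K (W \<inter> {x \<in> space K. \<phi> x \<le> t})" for t
    unfolding g_def cdf_def by (subst \<nu>_measure) auto
  have cont: "isCont g t" for t
  proof -
    have "measure \<nu> {t} \<le> measure K {x \<in> space K. \<phi> x = t}"
      using \<phi> by (subst \<nu>_measure) (auto intro!: K.finite_measure_mono)
    then show ?thesis unfolding g_def using levels[of t] by (simp add: \<nu>.isCont_cdf measure_le_0_iff)
  qed
  have space: "measure \<nu> (space \<nu>) = measure K W"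
  proof -
    have "W \<inter> {x \<in> space K. \<phi> x \<in> UNIV} = W" using WK by auto
    then show ?thesis using \<nu>_measure[of UNIV] by (simp add: \<nu>_def)
  qed
  have "\<exists>t. g t = measure K W / 2 ^ Suc n" for n
  proof -
    let ?m = "measure K W / 2 ^ Suc n"
    have m: "0 < ?m" "?m < measure K W"
      using pos by (auto simp: field_simps intro: order_less_le_trans[of _ 2])
    have "\<forall>\<^sub>F t in at_bot. g t < ?m"
      using \<nu>.cdf_lim_at_bot m(1) unfolding g_def by (rule order_tendstoD)
    then obtain a where a: "g a < ?m" by (meson eventually_happens' trivial_limit_at_bot_linorder)
    have "\<forall>\<^sub>F t in at_top. ?m < g t"
      using \<nu>.cdf_lim_at_top m(2) unfolding g_def space by (rule order_tendstoD)
    then obtain b where b: "?m < g b" by (meson eventually_happens' trivial_limit_at_top_linorder)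
    have "a \<le> b"
    proof (rule ccontr)
      assume "\<not> a \<le> b"
      then have "g b \<le> g a" unfolding g_def by (intro \<nu>.cdf_nondecreasing) auto
      then show False using a b by simp
    qed
    then show ?thesis using IVT[of g a ?m b] a b cont by auto
  qed
  then obtain t where t: "\<And>n. g (t n) = measure K W / 2 ^ Suc n" by metis
  show thesis
  proof
    show "t (Suc n) < t n" for n
    proof (rule ccontr)
      assume "\<not> t (Suc n) < t n"
      then have "g (t n) \<le> g (t (Suc n))" unfolding g_def by (intro \<nu>.cdf_nondecreasing) auto
      then show False using pos by (simp add: t field_simps)
    qed
  qed (use t g in auto)
qed

section \<open>Integral operators and the completed square\<close>

lemma square_integrableI_nn:
  assumes "f \<in> borel_measurable M" "(\<integral>\<^sup>+x. ennreal ((norm (f x))\<^sup>2) \<partial>M) < \<infinity>"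
  shows "square_integrable M f"
  using assms by (auto simp: square_integrable_def integrable_iff_bounded)

lemma square_integrable_nn_integral:
  "square_integrable M f \<Longrightarrow> (\<integral>\<^sup>+x. ennreal ((norm (f x))\<^sup>2) \<partial>M) = ennreal (LINT x|M. (norm (f x))\<^sup>2)"
  by (rule nn_integral_eq_integral) (auto simp: square_integrable_def)

lemma L2_Cauchy_Schwarz:
  assumes "square_integrable M f" "square_integrable M g"
  shows "(norm (LINT x|M. f x * cnj (g x)))\<^sup>2 \<le> (LINT x|M. (norm (f x))\<^sup>2) * (LINT x|M. (norm (g x))\<^sup>2)"
proof -
  interpret inner_space "L2 M" by (rule inner_space_L2)
  show ?thesis
    using Cauchy_Schwarz[OF L2_carrierI[OF assms(1)] L2_carrierI[OF assms(2)]]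
    unfolding L2_inner[OF assms]
    by (simp only: L2_hnorm_sq[OF assms(1), symmetric] L2_hnorm_sq[OF assms(2), symmetric]
        hnorm_sq[OF L2_carrierI[OF assms(1)]] hnorm_sq[OF L2_carrierI[OF assms(2)]])
qed

lemma L2_Cauchy_Schwarz_mult:
  assumes "square_integrable M f" "square_integrable M g"
  shows "(norm (LINT x|M. f x * g x))\<^sup>2 \<le> (LINT x|M. (norm (f x))\<^sup>2) * (LINT x|M. (norm (g x))\<^sup>2)"
  using L2_Cauchy_Schwarz[OF assms(1), of "\<lambda>x. cnj (g x)"] assms(2) by (simp add: square_integrable_cnj)

lemma integral_combination:
  fixes f g :: "'a \<Rightarrow> real" and h :: "'a \<Rightarrow> complex"
  assumes "integrable M f" "integrable M g" "integrable M h"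
  shows "(LINT x|M. a * f x + b * g x - Re (h x))
    = a * (LINT x|M. f x) + b * (LINT x|M. g x) - Re (LINT x|M. h x)"
  using assms by (simp add: integral_Re)

lemma integral_combination_Re:
  fixes f g :: "'a \<Rightarrow> real" and h :: "'a \<Rightarrow> complex"
  assumes "integrable M f" "integrable M h" "integrable M g"
  shows "(LINT x|M. f x + 2 * Re (h x) + g x)
    = (LINT x|M. f x) + 2 * Re (LINT x|M. h x) + (LINT x|M. g x)"
  using assms by (simp add: integral_Re)

context completed_square
begin

lemma space_M2 [simp]: "space M2 = space B \<times> space B"
  by (simp add: M2_eq space_pair_measure)

lemma Fubini_real:
  fixes f :: "'a \<times> 'a \<Rightarrow> real"
  assumes "integrable M2 f"
  shows "AE x in M. integrable M (\<lambda>y. f (x, y))"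
    and "integrable M (\<lambda>x. LINT y|M. f (x, y))"
    and "(LINT p|M2. f p) = (LINT x|M. LINT y|M. f (x, y))"
proof -
  have i: "integrable M2 (\<lambda>p. complex_of_real (f p))" using assms by simp
  note F = Fubini[OF i]
  show "AE x in M. integrable M (\<lambda>y. f (x, y))" using F(1) by (simp add: complex_of_real_integrable_eq)
  show "integrable M (\<lambda>x. LINT y|M. f (x, y))" using F(2) by (simp add: integral_complex_of_real complex_of_real_integrable_eq)
  show "(LINT p|M2. f p) = (LINT x|M. LINT y|M. f (x, y))"
    using F(3) unfolding integral_complex_of_real of_real_eq_iff .
qed

lemma square_integrable_sections:
  assumes "square_integrable M2 f"
  shows "AE x in M. square_integrable M (\<lambda>y. f (x, y))"
    and "integrable M (\<lambda>x. LINT y|M. (norm (f (x, y)))\<^sup>2)"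
    and "(LINT p|M2. (norm (f p))\<^sup>2) = (LINT x|M. LINT y|M. (norm (f (x, y)))\<^sup>2)"
proof -
  have i: "integrable M2 (\<lambda>p. (norm (f p))\<^sup>2)" and m: "f \<in> borel_measurable M2"
    using assms by (auto simp: square_integrable_def)
  show "AE x in M. square_integrable M (\<lambda>y. f (x, y))"
    using section_measurable[OF m] Fubini_real(1)[OF i]
    by eventually_elim (simp add: square_integrable_def)
qed (use assms in \<open>auto intro!: Fubini_real simp: square_integrable_def\<close>)

lemma square_integrable_swap:
  assumes "square_integrable M2 f"
  shows "square_integrable M2 (\<lambda>p. f (prod.swap p))"
proof (rule square_integrableI_nn)
  have m: "f \<in> borel_measurable M2" using assms by (rule square_integrable_measurable)
  then show "(\<lambda>p. f (prod.swap p)) \<in> borel_measurable M2" by (rule measurable_swap)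
  have "(\<integral>\<^sup>+p. ennreal ((norm (f (prod.swap p)))\<^sup>2) \<partial>M2) = (\<integral>\<^sup>+p. ennreal ((norm (f p))\<^sup>2) \<partial>M2)"
    using m by (intro nn_integral_swap) simp
  then show "(\<integral>\<^sup>+p. ennreal ((norm (f (prod.swap p)))\<^sup>2) \<partial>M2) < \<infinity>"
    using assms by (simp add: square_integrable_nn_integral)
qed

lemma norm_sq_integral_swap:
  assumes "square_integrable M2 f"
  shows "(LINT p|M2. (norm (f (prod.swap p)))\<^sup>2) = (LINT p|M2. (norm (f p))\<^sup>2)"
proof -
  have "integrable M2 (\<lambda>p. complex_of_real ((norm (f p))\<^sup>2))"
    using assms by (simp add: square_integrable_def del: of_real_power)
  from integral_swap(2)[OF this] show ?thesis
    unfolding integral_complex_of_real of_real_eq_iff .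
qed

text \<open>
  Exchanging the variables leaves the integral of \<open>f\<close> against \<open>g\<close> unchanged when \<open>f\<close> is symmetric.
\<close>

lemma integral_against_symmetrisation:
  assumes f: "square_integrable M2 f" and sym: "AE p in M2. f (prod.swap p) = f p"
    and g: "square_integrable M2 g"
  shows "(LINT p|M2. f p * cnj ((g p + g (prod.swap p)) / 2)) = (LINT p|M2. f p * cnj (g p))"
proof -
  note gs = square_integrable_swap[OF g] and fs = square_integrable_swap[OF f]
  note i = square_integrable_inner_integrable
  have "(LINT p|M2. f p * cnj (g (prod.swap p))) = (LINT p|M2. f (prod.swap p) * cnj (g p))"
    using integral_swap(2)[OF i[OF fs g]] by simp
  also have "\<dots> = (LINT p|M2. f p * cnj (g p))"
    using sym i[OF fs g] i[OF f g] by (intro integral_cong_AE) auto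
  finally have eq: "(LINT p|M2. f p * cnj (g (prod.swap p))) = (LINT p|M2. f p * cnj (g p))" .
  have "(LINT p|M2. f p * cnj ((g p + g (prod.swap p)) / 2))
      = (LINT p|M2. (f p * cnj (g p) + f p * cnj (g (prod.swap p))) / 2)"
    by (simp add: distrib_left add_divide_distrib)
  also have "\<dots> = ((LINT p|M2. f p * cnj (g p)) + (LINT p|M2. f p * cnj (g (prod.swap p)))) / 2"
    using i[OF f g] i[OF f gs] by simp
  finally show ?thesis using eq by simp
qed

lemma square_integrable_tensor:
  assumes f: "square_integrable M f" and g: "square_integrable M g"
  shows "square_integrable M2 (\<lambda>p. f (snd p) * g (fst p))"
proof (rule square_integrableI_nn)
  have m: "(\<lambda>p. f (snd p)) \<in> borel_measurable M2" "(\<lambda>p. g (fst p)) \<in> borel_measurable M2"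
    using measurable_snd_M2[OF square_integrable_measurable[OF f]] measurable_fst_M2[OF square_integrable_measurable[OF g]] .
  then show fg: "(\<lambda>p. f (snd p) * g (fst p)) \<in> borel_measurable M2" by simp
  have "(\<integral>\<^sup>+p. ennreal ((norm (f (snd p) * g (fst p)))\<^sup>2) \<partial>M2)
      = (\<integral>\<^sup>+x. \<integral>\<^sup>+y. ennreal ((norm (f (snd (x, y)) * g (fst (x, y))))\<^sup>2) \<partial>M \<partial>M)"
    by (rule Tonelli(2)) (use fg in simp)
  also have "\<dots> = (\<integral>\<^sup>+x. \<integral>\<^sup>+y. ennreal ((norm (g x))\<^sup>2) * ennreal ((norm (f y))\<^sup>2) \<partial>M \<partial>M)"
    by (simp add: norm_mult power_mult_distrib ennreal_mult' mult.commute)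
  also have "\<dots> = (\<integral>\<^sup>+x. ennreal ((norm (g x))\<^sup>2) * (\<integral>\<^sup>+y. ennreal ((norm (f y))\<^sup>2) \<partial>M) \<partial>M)"
    using f by (subst nn_integral_cmult) (auto simp: square_integrable_def)
  also have "\<dots> = (\<integral>\<^sup>+x. ennreal ((norm (g x))\<^sup>2) \<partial>M) * (\<integral>\<^sup>+y. ennreal ((norm (f y))\<^sup>2) \<partial>M)"
    using g by (subst nn_integral_multc) (auto simp: square_integrable_def)
  also have "\<dots> < \<infinity>"
    using f g by (simp add: square_integrable_nn_integral ennreal_mult_less_top)
  finally show "(\<integral>\<^sup>+p. ennreal ((norm (f (snd p) * g (fst p)))\<^sup>2) \<partial>M2) < \<infinity>" .
qed

lemma square_integrable_one: "square_integrable M (\<lambda>x. 1)"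
  using finite_measure.integrable_const[OF finite_measure_M, of "1::real"] by (simp add: square_integrable_def)

lemma square_integrable_fst: "square_integrable M f \<Longrightarrow> square_integrable M2 (\<lambda>p. f (fst p))"
  using square_integrable_tensor[OF square_integrable_one] by simp

lemma square_integrable_snd: "square_integrable M f \<Longrightarrow> square_integrable M2 (\<lambda>p. f (snd p))"
  using square_integrable_tensor[OF _ square_integrable_one] by simp

text \<open>
  Everything follows from the Cauchy-Schwarz inequality on almost every section of \<open>k\<close>.
\<close>

lemma Hilbert_Schmidt_integral:
  assumes k: "square_integrable M2 k" and f: "square_integrable M f"
  shows "AE x in M. integrable M (\<lambda>y. k (x, y) * f y)"
    and "square_integrable M (\<lambda>x. LINT y|M. k (x, y) * f y)"
    and "(LINT x|M. (norm (LINT y|M. k (x, y) * f y))\<^sup>2)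
      \<le> (LINT p|M2. (norm (k p))\<^sup>2) * (LINT x|M. (norm (f x))\<^sup>2)"
    and "square_integrable M g \<Longrightarrow> (LINT x|M. (LINT y|M. k (x, y) * f y) * cnj (g x))
      = (LINT p|M2. k p * (f (snd p) * cnj (g (fst p))))"
proof -
  note fs = square_integrable_snd[OF f]
  have i: "integrable M2 (\<lambda>p. k p * f (snd p))" using k fs by (rule square_integrable_mult_integrable)
  show "AE x in M. integrable M (\<lambda>y. k (x, y) * f y)" using Fubini(1)[OF i] by simp
  have m: "(\<lambda>x. LINT y|M. k (x, y) * f y) \<in> borel_measurable M"
    using Fubini(2)[OF i] by simp
  note ks = square_integrable_sections[OF k]
  have bd: "AE x in M. (norm (LINT y|M. k (x, y) * f y))\<^sup>2
      \<le> (LINT y|M. (norm (k (x, y)))\<^sup>2) * (LINT x|M. (norm (f x))\<^sup>2)"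
    using ks(1) by eventually_elim (rule L2_Cauchy_Schwarz_mult[OF _ f])
  have ib: "integrable M (\<lambda>x. (LINT y|M. (norm (k (x, y)))\<^sup>2) * (LINT x|M. (norm (f x))\<^sup>2))"
    using ks(2) by simp
  show sq: "square_integrable M (\<lambda>x. LINT y|M. k (x, y) * f y)"
    by (rule square_integrable_bound[OF m ib bd])
  have "(LINT x|M. (norm (LINT y|M. k (x, y) * f y))\<^sup>2)
      \<le> (LINT x|M. (LINT y|M. (norm (k (x, y)))\<^sup>2) * (LINT x|M. (norm (f x))\<^sup>2))"
    using sq ib bd by (intro integral_mono_AE) (auto simp: square_integrable_def)
  then show "(LINT x|M. (norm (LINT y|M. k (x, y) * f y))\<^sup>2)
      \<le> (LINT p|M2. (norm (k p))\<^sup>2) * (LINT x|M. (norm (f x))\<^sup>2)"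
    unfolding ks(3) by simp
  assume g: "square_integrable M g"
  have "integrable M2 (\<lambda>p. k p * (f (snd p) * cnj (g (fst p))))"
    using k square_integrable_tensor[OF f, of "\<lambda>x. cnj (g x)"] g
    by (intro square_integrable_mult_integrable) (auto simp: square_integrable_cnj)
  from Fubini(3)[OF this]
  have "(LINT p|M2. k p * (f (snd p) * cnj (g (fst p))))
      = (LINT x|M. LINT y|M. (k (x, y) * f y) * cnj (g x))" by (simp add: mult.assoc)
  then show "(LINT x|M. (LINT y|M. k (x, y) * f y) * cnj (g x))
      = (LINT p|M2. k p * (f (snd p) * cnj (g (fst p))))" by simp
qed

text \<open>
  At almost every \<open>x\<close> the values at \<open>x\<close> of the images of the \<open>e i\<close> are Fourier coefficients of the section \<open>k (x, \<cdot>)\<close>, so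
  Bessel's inequality bounds the sum of their squares; then integrate over \<open>x\<close>.
\<close>

lemma Hilbert_Schmidt_basis_sum:
  assumes k: "square_integrable M2 k" and F: "finite F"
    and e: "\<And>i. i \<in> F \<Longrightarrow> square_integrable M (e i)"
    and on: "\<And>i j. \<lbrakk>i \<in> F; j \<in> F\<rbrakk> \<Longrightarrow> (LINT x|M. e i x * cnj (e j x)) = (if i = j then 1 else 0)"
  shows "(\<Sum>i\<in>F. LINT x|M. (norm (LINT y|M. k (x, y) * e i y))\<^sup>2) \<le> (LINT p|M2. (norm (k p))\<^sup>2)"
proof -
  interpret X: inner_space "L2 M" by (rule inner_space_L2)
  note ks = square_integrable_sections[OF k]
  note HS = Hilbert_Schmidt_integral[OF k e]
  have inj: "inj_on (\<lambda>i. L2_class M (e i)) F"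
  proof (rule inj_onI, rule ccontr)
    fix i j assume ij: "i \<in> F" "j \<in> F" "L2_class M (e i) = L2_class M (e j)" "i \<noteq> j"
    have "hinner (L2 M) (L2_class M (e i)) (L2_class M (e j)) = 0"
      "hinner (L2 M) (L2_class M (e j)) (L2_class M (e j)) = 1"
      unfolding L2_inner[OF e[OF ij(1)] e[OF ij(2)]] L2_inner[OF e[OF ij(2)] e[OF ij(2)]]
      using on[OF ij(1,2)] on[OF ij(2,2)] ij(4) by simp_all
    then show False using ij(3) by simp
  qed
  have bd: "AE x in M. (\<Sum>i\<in>F. (norm (LINT y|M. k (x, y) * e i y))\<^sup>2) \<le> (LINT y|M. (norm (k (x, y)))\<^sup>2)"
    using ks(1)
  proof eventually_elim
    case (elim x)
    \<comment> \<open>The inner product conjugates its second argument, hence the conjugated section.\<close>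
    let ?u = "\<lambda>y. cnj (k (x, y))"
    have u: "square_integrable M ?u" using elim by (simp add: square_integrable_cnj)
    have "(\<Sum>v\<in>(\<lambda>i. L2_class M (e i)) ` F. (norm (hinner (L2 M) (L2_class M ?u) v))\<^sup>2)
        \<le> Re (hinner (L2 M) (L2_class M ?u) (L2_class M ?u))"
    proof (rule X.Bessel_inequality)
      fix v w assume "v \<in> (\<lambda>i. L2_class M (e i)) ` F" "w \<in> (\<lambda>i. L2_class M (e i)) ` F"
      then obtain i j where "i \<in> F" "v = L2_class M (e i)" "j \<in> F" "w = L2_class M (e j)" by blast
      then show "hinner (L2 M) v w = (if v = w then 1 else 0)"
        using on[of i j] inj_onD[OF inj, of i j] by (cases "i = j") (auto simp: L2_inner e)
    qed (use F u e in auto)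
    also have "Re (hinner (L2 M) (L2_class M ?u) (L2_class M ?u)) = (LINT y|M. (norm (k (x, y)))\<^sup>2)"
      using L2_hnorm_sq[OF u] X.hnorm_sq[OF L2_carrierI[OF u]] by simp
    also have "(\<Sum>v\<in>(\<lambda>i. L2_class M (e i)) ` F. (norm (hinner (L2 M) (L2_class M ?u) v))\<^sup>2)
        = (\<Sum>i\<in>F. (norm (LINT y|M. k (x, y) * e i y))\<^sup>2)"
    proof (subst sum.reindex[OF inj], rule sum.cong)
      fix i assume i: "i \<in> F"
      have "hinner (L2 M) (L2_class M ?u) (L2_class M (e i)) = (LINT y|M. cnj (k (x, y) * e i y))"
        using L2_inner[OF u e[OF i]] by simp
      also have "\<dots> = cnj (LINT y|M. k (x, y) * e i y)" by (rule Bochner_Integration.integral_cnj)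
      finally show "((\<lambda>v. (norm (hinner (L2 M) (L2_class M ?u) v))\<^sup>2) \<circ> (\<lambda>i. L2_class M (e i))) i
          = (norm (LINT y|M. k (x, y) * e i y))\<^sup>2" by simp
    qed simp
    finally show ?case .
  qed
  have int: "integrable M (\<lambda>x. (norm (LINT y|M. k (x, y) * e i y))\<^sup>2)" if "i \<in> F" for i
    using HS(2)[OF that] by (simp add: square_integrable_def)
  have "(\<Sum>i\<in>F. LINT x|M. (norm (LINT y|M. k (x, y) * e i y))\<^sup>2)
      = (LINT x|M. (\<Sum>i\<in>F. (norm (LINT y|M. k (x, y) * e i y))\<^sup>2))"
    using int by simp
  also have "\<dots> \<le> (LINT x|M. LINT y|M. (norm (k (x, y)))\<^sup>2)"
    using int ks(2) bd by (intro integral_mono_AE) auto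
  finally show ?thesis by (simp add: ks(3))
qed

end

locale section_bounded = completed_square B M M2
  for B :: "'a measure" and M M2 +
  fixes v :: "'a \<times> 'a \<Rightarrow> complex" and Cv :: real
  assumes v_measurable: "v \<in> borel_measurable M2"
    and v_sections: "AE x in M. (\<integral>\<^sup>+y. ennreal ((norm (v (x, y)))\<^sup>2) \<partial>M) \<le> ennreal Cv"
    and Cv: "0 \<le> Cv"
begin

text \<open>
  \<open>annih\<close> is the operator \<open>H\<^sub>1\<^sub>2\<close> on functions, which integrates one particle out, and \<open>creat\<close> will be its
  adjoint with respect to symmetric functions; \<open>creat0\<close> is the adjoint without symmetrisation.
\<close>

definition annih :: "('a \<times> 'a \<Rightarrow> complex) \<Rightarrow> 'a \<Rightarrow> complex" where
  "annih f x = (LINT s|M. v (x, s) * f (x, s))"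

definition creat0 :: "('a \<Rightarrow> complex) \<Rightarrow> 'a \<times> 'a \<Rightarrow> complex" where
  "creat0 g p = cnj (v p) * g (fst p)"

definition creat :: "('a \<Rightarrow> complex) \<Rightarrow> 'a \<times> 'a \<Rightarrow> complex" where
  "creat g p = (creat0 g p + creat0 g (prod.swap p)) / 2"

lemma nn_creat0:
  assumes g: "square_integrable M g"
  shows "(\<integral>\<^sup>+p. ennreal ((norm (creat0 g p))\<^sup>2) \<partial>M2) \<le> ennreal (Cv * (LINT x|M. (norm (g x))\<^sup>2))"
    and "creat0 g \<in> borel_measurable M2"
proof -
  have "(\<lambda>p. g (fst p)) \<in> borel_measurable M2"
    using g by (intro measurable_fst_M2 square_integrable_measurable)
  moreover have "(\<lambda>p. cnj (v p)) \<in> borel_measurable M2"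
    using v_measurable by (simp add: borel_measurable_complex_iff)
  ultimately show m: "creat0 g \<in> borel_measurable M2" unfolding creat0_def[abs_def] by simp
  have "(\<integral>\<^sup>+p. ennreal ((norm (creat0 g p))\<^sup>2) \<partial>M2)
      = (\<integral>\<^sup>+x. \<integral>\<^sup>+y. ennreal ((norm (creat0 g (x, y)))\<^sup>2) \<partial>M \<partial>M)"
    by (rule Tonelli(2)) (use m in simp)
  also have "\<dots> \<le> (\<integral>\<^sup>+x. ennreal Cv * ennreal ((norm (g x))\<^sup>2) \<partial>M)"
  proof (rule nn_integral_mono_AE, use v_sections section_measurable[OF v_measurable] in eventually_elim)
    case (elim x)
    have "(\<integral>\<^sup>+y. ennreal ((norm (creat0 g (x, y)))\<^sup>2) \<partial>M)
        = (\<integral>\<^sup>+y. ennreal ((norm (v (x, y)))\<^sup>2) * ennreal ((norm (g x))\<^sup>2) \<partial>M)"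
      by (simp add: creat0_def norm_mult power_mult_distrib ennreal_mult')
    also have "\<dots> = (\<integral>\<^sup>+y. ennreal ((norm (v (x, y)))\<^sup>2) \<partial>M) * ennreal ((norm (g x))\<^sup>2)"
      using elim(2) by (intro nn_integral_multc) simp
    also have "\<dots> \<le> ennreal Cv * ennreal ((norm (g x))\<^sup>2)"
      using elim(1) by (rule mult_right_mono) simp
    finally show ?case .
  qed
  also have "\<dots> = ennreal Cv * (\<integral>\<^sup>+x. ennreal ((norm (g x))\<^sup>2) \<partial>M)"
    using g by (intro nn_integral_cmult) (auto simp: square_integrable_def)
  also have "\<dots> = ennreal (Cv * (LINT x|M. (norm (g x))\<^sup>2))"
    using g Cv by (simp add: square_integrable_nn_integral ennreal_mult')
  finally show "(\<integral>\<^sup>+p. ennreal ((norm (creat0 g p))\<^sup>2) \<partial>M2) \<le> ennreal (Cv * (LINT x|M. (norm (g x))\<^sup>2))" .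
qed

lemma square_integrable_creat0:
  assumes g: "square_integrable M g"
  shows "square_integrable M2 (creat0 g)"
    and "(LINT p|M2. (norm (creat0 g p))\<^sup>2) \<le> Cv * (LINT x|M. (norm (g x))\<^sup>2)"
proof -
  show sq: "square_integrable M2 (creat0 g)"
    using nn_creat0[OF g] by (intro square_integrableI_nn) (auto intro: order_le_less_trans)
  have "ennreal (LINT p|M2. (norm (creat0 g p))\<^sup>2) \<le> ennreal (Cv * (LINT x|M. (norm (g x))\<^sup>2))"
    using nn_creat0(1)[OF g] sq by (simp add: square_integrable_nn_integral)
  then show "(LINT p|M2. (norm (creat0 g p))\<^sup>2) \<le> Cv * (LINT x|M. (norm (g x))\<^sup>2)"
    using Cv by (subst (asm) ennreal_le_iff) auto
qed

lemma square_integrable_v: "square_integrable M2 v"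
proof -
  have "square_integrable M2 (\<lambda>p. cnj (creat0 (\<lambda>_. 1) p))"
    unfolding square_integrable_cnj by (rule square_integrable_creat0[OF square_integrable_one])
  then show ?thesis by (simp add: creat0_def)
qed

lemma square_integrable_creat:
  assumes g: "square_integrable M g"
  shows "square_integrable M2 (creat g)"
    and "(LINT p|M2. (norm (creat g p))\<^sup>2) \<le> Cv * (LINT x|M. (norm (g x))\<^sup>2)"
proof -
  note s = square_integrable_creat0(1)[OF g]
  note ss = square_integrable_swap[OF s]
  have "square_integrable M2 (\<lambda>p. (1 / 2) * (creat0 g p + creat0 g (prod.swap p)))"
    using s ss by (intro square_integrable_scale square_integrable_add)
  then show sq: "square_integrable M2 (creat g)" by (simp add: creat_def[abs_def])
  have "(LINT p|M2. (norm (creat g p))\<^sup>2)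
      \<le> (LINT p|M2. ((norm (creat0 g p))\<^sup>2 + (norm (creat0 g (prod.swap p)))\<^sup>2) / 2)"
  proof (rule integral_mono)
    show "(norm (creat g p))\<^sup>2 \<le> ((norm (creat0 g p))\<^sup>2 + (norm (creat0 g (prod.swap p)))\<^sup>2) / 2" for p
      using norm_add_sq_le[of "creat0 g p" "creat0 g (prod.swap p)"]
      by (simp add: creat_def norm_divide power_divide)
  qed (use sq s ss in \<open>auto simp: square_integrable_def\<close>)
  also have "\<dots> = ((LINT p|M2. (norm (creat0 g p))\<^sup>2) + (LINT p|M2. (norm (creat0 g (prod.swap p)))\<^sup>2)) / 2"
    using s ss by (simp add: square_integrable_def)
  also have "\<dots> = (LINT p|M2. (norm (creat0 g p))\<^sup>2)" using norm_sq_integral_swap[OF s] by simp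
  also have "\<dots> \<le> Cv * (LINT x|M. (norm (g x))\<^sup>2)" by (rule square_integrable_creat0(2)[OF g])
  finally show "(LINT p|M2. (norm (creat g p))\<^sup>2) \<le> Cv * (LINT x|M. (norm (g x))\<^sup>2)" .
qed

lemma creat_symmetric: "creat g (prod.swap p) = creat g p"
  by (simp add: creat_def add.commute)

lemma square_integrable_annih:
  assumes f: "square_integrable M2 f"
  shows "AE x in M. integrable M (\<lambda>s. v (x, s) * f (x, s))"
    and "square_integrable M (annih f)"
    and "(LINT x|M. (norm (annih f x))\<^sup>2) \<le> Cv * (LINT p|M2. (norm (f p))\<^sup>2)"
proof -
  note vs = square_integrable_sections[OF square_integrable_v]
  note fs = square_integrable_sections[OF f]
  have i: "integrable M2 (\<lambda>p. v p * f p)" using square_integrable_v f by (rule square_integrable_mult_integrable)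
  show "AE x in M. integrable M (\<lambda>s. v (x, s) * f (x, s))" by (rule Fubini(1)[OF i])
  have m: "annih f \<in> borel_measurable M" unfolding annih_def[abs_def] using Fubini(2)[OF i] by simp
  have bd: "AE x in M. (norm (annih f x))\<^sup>2 \<le> Cv * (LINT y|M. (norm (f (x, y)))\<^sup>2)"
    using vs(1) fs(1) v_sections
  proof eventually_elim
    case (elim x)
    have "ennreal (LINT y|M. (norm (v (x, y)))\<^sup>2) \<le> ennreal Cv"
      using elim(3) square_integrable_nn_integral[OF elim(1)] by simp
    then have "(LINT y|M. (norm (v (x, y)))\<^sup>2) \<le> Cv" using Cv by (subst (asm) ennreal_le_iff)
    then have "(LINT y|M. (norm (v (x, y)))\<^sup>2) * (LINT y|M. (norm (f (x, y)))\<^sup>2) \<le> Cv * (LINT y|M. (norm (f (x, y)))\<^sup>2)"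
      by (intro mult_right_mono) auto
    then show ?case unfolding annih_def
      using L2_Cauchy_Schwarz_mult[OF elim(1,2)] by (rule order_trans[rotated])
  qed
  have ib: "integrable M (\<lambda>x. Cv * (LINT y|M. (norm (f (x, y)))\<^sup>2))" using fs(2) by simp
  show sq: "square_integrable M (annih f)" by (rule square_integrable_bound[OF m ib bd])
  have "(LINT x|M. (norm (annih f x))\<^sup>2) \<le> (LINT x|M. Cv * (LINT y|M. (norm (f (x, y)))\<^sup>2))"
    using sq ib bd by (intro integral_mono_AE) (auto simp: square_integrable_def)
  then show "(LINT x|M. (norm (annih f x))\<^sup>2) \<le> Cv * (LINT p|M2. (norm (f p))\<^sup>2)"
    unfolding fs(3) by simp
qed

lemma annih_adjoint:
  assumes f: "square_integrable M2 f" and sym: "AE p in M2. f (prod.swap p) = f p"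
    and g: "square_integrable M g"
  shows "(LINT x|M. annih f x * cnj (g x)) = (LINT p|M2. f p * cnj (creat g p))"
proof -
  note s = square_integrable_creat0(1)[OF g]
  have "(LINT p|M2. f p * cnj (creat g p)) = (LINT p|M2. f p * cnj (creat0 g p))"
    unfolding creat_def by (rule integral_against_symmetrisation[OF f sym s])
  also have "\<dots> = (LINT x|M. LINT y|M. f (x, y) * cnj (creat0 g (x, y)))"
    by (rule Fubini(3)[OF square_integrable_inner_integrable[OF f s]])
  also have "\<dots> = (LINT x|M. LINT y|M. (v (x, y) * f (x, y)) * cnj (g x))"
    by (simp add: creat0_def mult_ac)
  also have "\<dots> = (LINT x|M. annih f x * cnj (g x))"
    by (simp add: annih_def)
  finally show ?thesis by simp
qed

end

locale schur_form = section_bounded +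
  fixes w1 :: "'a \<Rightarrow> real" and w2 :: "'a \<times> 'a \<Rightarrow> real" and z \<delta> C1 C2 :: real
  assumes w1_measurable: "w1 \<in> borel_measurable M" and w1_bound: "AE x in M. \<bar>w1 x\<bar> \<le> C1"
    and w2_measurable: "w2 \<in> borel_measurable M2" and w2_bound: "AE p in M2. \<bar>w2 p\<bar> \<le> C2"
    and w2_sym: "\<And>p. p \<in> space B \<times> space B \<Longrightarrow> w2 (prod.swap p) = w2 p"
    and v_cross: "(\<integral>\<^sup>+p. ennreal ((norm (v p * v (prod.swap p)))\<^sup>2) \<partial>M2) < \<infinity>"
    and \<delta>: "0 < \<delta>" and gap: "AE p in M2. z + \<delta> \<le> w2 p"
begin

definition rate :: "'a \<Rightarrow> real" where
  "rate x = (LINT y|M. (norm (v (x, y)))\<^sup>2 / (w2 (x, y) - z))"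

text \<open>
  \<open>eff\<close> and \<open>ker\<close> are \<open>\<Delta>\<close> and \<open>K\<close> over an abstract measure space.
\<close>

definition eff :: "'a \<Rightarrow> real" where
  "eff x = w1 x - z - 1 / 2 * rate x"

definition ker :: "'a \<times> 'a \<Rightarrow> complex" where
  "ker p = - (1 / 2) * (v p * cnj (v (prod.swap p)) / complex_of_real (w2 p - z))"

lemma gap_inverse: "AE p in M2. 0 < w2 p - z \<and> 1 / (w2 p - z) \<le> 1 / \<delta>"
  using gap
proof eventually_elim
  case (elim p)
  then have "\<delta> \<le> w2 p - z" by simp
  then show ?case using \<delta> by (auto intro!: divide_left_mono mult_pos_pos)
qed

lemma divide_gap_integrable:
  assumes "integrable M2 h"
  shows "integrable M2 (\<lambda>p. h p / (w2 p - z))"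
proof (rule Bochner_Integration.integrable_bound)
  show "integrable M2 (\<lambda>p. h p / \<delta>)" using assms by simp
  show "AE p in M2. norm (h p / (w2 p - z)) \<le> norm (h p / \<delta>)"
    using gap_inverse
  proof eventually_elim
    case (elim p)
    then have "\<bar>h p\<bar> * (1 / (w2 p - z)) \<le> \<bar>h p\<bar> * (1 / \<delta>)" by (intro mult_left_mono) auto
    then show ?case using elim \<delta> by simp
  qed
qed (use assms w2_measurable in auto)

lemma square_integrable_divide_gap:
  assumes "square_integrable M2 f"
  shows "square_integrable M2 (\<lambda>p. f p / of_real (w2 p - z))"
proof -
  have "square_integrable M2 (\<lambda>p. of_real (1 / (w2 p - z)) * f p)"
  proof (rule square_integrable_bounded_mult[OF assms])
    show "AE p in M2. \<bar>1 / (w2 p - z)\<bar> \<le> 1 / \<delta>" using gap_inverse by eventually_elim simp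
  qed (use w2_measurable in simp)
  then show ?thesis by simp
qed

lemma square_integrable_ker: "square_integrable M2 ker"
proof -
  have "square_integrable M2 (\<lambda>p. v p * cnj (v (prod.swap p)))"
  proof (rule square_integrableI_nn)
    have "(\<lambda>p. cnj (v (prod.swap p))) \<in> borel_measurable M2"
      using measurable_swap[OF v_measurable] by (simp add: borel_measurable_complex_iff)
    then show "(\<lambda>p. v p * cnj (v (prod.swap p))) \<in> borel_measurable M2" using v_measurable by simp
  qed (use v_cross in \<open>simp add: norm_mult\<close>)
  from square_integrable_scale[OF square_integrable_divide_gap[OF this], of "- (1 / 2)"]
  show ?thesis by (simp add: ker_def[abs_def])
qed

lemma v_sq_integrable: "integrable M2 (\<lambda>p. (norm (v p))\<^sup>2)"
  using square_integrable_v by (simp add: square_integrable_def)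

lemma rate_bound: "rate \<in> borel_measurable M" "AE x in M. \<bar>rate x\<bar> \<le> Cv / \<delta>"
proof -
  note i = divide_gap_integrable[OF v_sq_integrable]
  show "rate \<in> borel_measurable M" unfolding rate_def[abs_def] using Fubini_real(2)[OF i] by simp
  show "AE x in M. \<bar>rate x\<bar> \<le> Cv / \<delta>"
    using Fubini_real(1)[OF i] square_integrable_sections(1)[OF square_integrable_v] v_sections
      AE_sections[OF gap_inverse]
  proof eventually_elim
    case (elim x)
    have iv: "integrable M (\<lambda>y. (norm (v (x, y)))\<^sup>2)" using elim(2) by (simp add: square_integrable_def)
    have "ennreal (LINT y|M. (norm (v (x, y)))\<^sup>2) \<le> ennreal Cv"
      using elim(3) square_integrable_nn_integral[OF elim(2)] by simp
    then have le: "(LINT y|M. (norm (v (x, y)))\<^sup>2) \<le> Cv" using Cv by (subst (asm) ennreal_le_iff)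
    have "AE y in M. (norm (v (x, y)))\<^sup>2 / (w2 (x, y) - z) \<le> (norm (v (x, y)))\<^sup>2 / \<delta>"
      using elim(4)
    proof eventually_elim
      case (elim y)
      then have "(norm (v (x, y)))\<^sup>2 * (1 / (w2 (x, y) - z)) \<le> (norm (v (x, y)))\<^sup>2 * (1 / \<delta>)"
        by (intro mult_left_mono) auto
      then show ?case by simp
    qed
    then have "rate x \<le> (LINT y|M. (norm (v (x, y)))\<^sup>2 / \<delta>)"
      unfolding rate_def using elim(1) iv by (intro integral_mono_AE) auto
    also have "\<dots> \<le> Cv / \<delta>" using le \<delta> by (simp add: divide_right_mono)
    finally have "rate x \<le> Cv / \<delta>" .
    moreover have "0 \<le> rate x"
      unfolding rate_def using elim(4) by (intro integral_nonneg_AE) (auto elim!: eventually_mono)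
    ultimately show ?case by simp
  qed
qed

lemma eff_measurable: "eff \<in> borel_measurable M"
  unfolding eff_def[abs_def] using w1_measurable rate_bound(1) by simp

lemma eff_bound: "AE x in M. \<bar>eff x\<bar> \<le> C1 + \<bar>z\<bar> + Cv / \<delta>"
  using w1_bound rate_bound(2) by eventually_elim (auto simp: eff_def)

lemma bounded_weight_integrable:
  fixes w :: "'b \<Rightarrow> real"
  assumes "square_integrable N f" "w \<in> borel_measurable N" "AE x in N. \<bar>w x\<bar> \<le> K"
  shows "integrable N (\<lambda>x. w x * (norm (f x))\<^sup>2)"
proof (rule Bochner_Integration.integrable_bound)
  show "integrable N (\<lambda>x. K * (norm (f x))\<^sup>2)" using assms(1) by (simp add: square_integrable_def)
  show "AE x in N. norm (w x * (norm (f x))\<^sup>2) \<le> norm (K * (norm (f x))\<^sup>2)"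
    using assms(3)
  proof eventually_elim
    case (elim x)
    then have "\<bar>w x\<bar> * (norm (f x))\<^sup>2 \<le> \<bar>K\<bar> * (norm (f x))\<^sup>2" by (intro mult_right_mono) auto
    then show ?case by (simp add: abs_mult)
  qed
qed (use assms in \<open>auto simp: square_integrable_def\<close>)

lemma rate_integral:
  assumes g: "square_integrable M g"
  shows "(LINT p|M2. (norm (creat0 g p))\<^sup>2 / (w2 p - z)) = (LINT x|M. rate x * (norm (g x))\<^sup>2)"
proof -
  have i: "integrable M2 (\<lambda>p. (norm (creat0 g p))\<^sup>2 / (w2 p - z))"
    using square_integrable_creat0(1)[OF g] by (intro divide_gap_integrable) (simp add: square_integrable_def)
  have "(norm (creat0 g (x, y)))\<^sup>2 / (w2 (x, y) - z) = (norm (v (x, y)))\<^sup>2 / (w2 (x, y) - z) * (norm (g x))\<^sup>2" for x y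
    by (simp add: creat0_def norm_mult power_mult_distrib)
  then have "(LINT p|M2. (norm (creat0 g p))\<^sup>2 / (w2 p - z))
      = (LINT x|M. LINT y|M. (norm (v (x, y)))\<^sup>2 / (w2 (x, y) - z) * (norm (g x))\<^sup>2)"
    unfolding Fubini_real(3)[OF i] by presburger
  also have "\<dots> = (LINT x|M. rate x * (norm (g x))\<^sup>2)"
    unfolding rate_def by (intro Bochner_Integration.integral_cong refl integral_mult_left_zero)
  finally show ?thesis .
qed

text \<open>
  Expanding \<open>|a + b|\<^sup>2\<close> for the two summands of \<open>creat g\<close>, which are exchanged by the swap: the squares
  contribute equally and give the integral term of \<open>\<Delta>\<close>, the cross term gives \<open>K\<close>.
\<close>

lemma creat_weighted_integral:
  assumes g: "square_integrable M g"
  shows "(LINT p|M2. (norm (creat g p))\<^sup>2 / (w2 p - z))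
    = 1 / 2 * (LINT x|M. rate x * (norm (g x))\<^sup>2)
      - Re (LINT p|M2. ker p * (g (snd p) * cnj (g (fst p))))"
proof -
  let ?d = "\<lambda>p. w2 p - z"
  note s = square_integrable_creat0(1)[OF g]
  note ss = square_integrable_swap[OF s]
  have i1: "integrable M2 (\<lambda>p. (norm (creat0 g p))\<^sup>2 / ?d p)"
    using s by (intro divide_gap_integrable) (simp add: square_integrable_def)
  have i2: "integrable M2 (\<lambda>p. (norm (creat0 g (prod.swap p)))\<^sup>2 / ?d p)"
    using ss by (intro divide_gap_integrable) (simp add: square_integrable_def)
  have i3: "integrable M2 (\<lambda>p. ker p * (g (snd p) * cnj (g (fst p))))"
    using square_integrable_tensor[OF g, of "\<lambda>x. cnj (g x)"] g square_integrable_ker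
    by (intro square_integrable_mult_integrable) (auto simp: square_integrable_cnj)
  have swap: "(LINT p|M2. (norm (creat0 g (prod.swap p)))\<^sup>2 / ?d p) = (LINT p|M2. (norm (creat0 g p))\<^sup>2 / ?d p)"
  proof -
    have "(LINT p|M2. (norm (creat0 g (prod.swap p)))\<^sup>2 / ?d p)
        = (LINT p|M2. (norm (creat0 g (prod.swap p)))\<^sup>2 / ?d (prod.swap p))"
      using w2_sym by (intro Bochner_Integration.integral_cong refl) auto
    also have "\<dots> = (LINT p|M2. (norm (creat0 g p))\<^sup>2 / ?d p)"
    proof -
      have "integrable M2 (\<lambda>p. complex_of_real ((norm (creat0 g p))\<^sup>2 / ?d p))" using i1 by (simp only: complex_of_real_integrable_eq)
      from integral_swap(2)[OF this] show ?thesis unfolding integral_complex_of_real of_real_eq_iff .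
    qed
    finally show ?thesis .
  qed
  have pt: "(norm (creat g p))\<^sup>2 / ?d p = 1 / 4 * ((norm (creat0 g p))\<^sup>2 / ?d p)
      + 1 / 4 * ((norm (creat0 g (prod.swap p)))\<^sup>2 / ?d p) - Re (ker p * (g (snd p) * cnj (g (fst p))))" for p
  proof -
    let ?A = "creat0 g p" and ?B = "creat0 g (prod.swap p)"
    have "(norm (?A + ?B))\<^sup>2 = (norm ?A)\<^sup>2 + (norm ?B)\<^sup>2 + 2 * Re (?B * cnj ?A)"
      unfolding cmod_power2 by (simp add: power2_eq_square algebra_simps)
    then have n: "(norm (creat g p))\<^sup>2 = 1 / 4 * (norm ?A)\<^sup>2 + 1 / 4 * (norm ?B)\<^sup>2 + 1 / 2 * Re (?B * cnj ?A)"
      by (simp add: creat_def norm_divide power_divide)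
    have "ker p * (g (snd p) * cnj (g (fst p))) = of_real (- 1 / (2 * ?d p)) * (?B * cnj ?A)"
      by (simp add: ker_def creat0_def mult_ac)
    then have "Re (ker p * (g (snd p) * cnj (g (fst p)))) = - 1 / (2 * ?d p) * Re (?B * cnj ?A)"
      by (simp only: Re_complex_of_real Im_complex_of_real times_complex.sel mult_zero_left diff_zero)
    then show ?thesis unfolding n by (simp add: add_divide_distrib)
  qed
  have "(LINT p|M2. (norm (creat g p))\<^sup>2 / ?d p)
     = 1 / 4 * (LINT p|M2. (norm (creat0 g p))\<^sup>2 / ?d p) + 1 / 4 * (LINT p|M2. (norm (creat0 g (prod.swap p)))\<^sup>2 / ?d p)
       - Re (LINT p|M2. ker p * (g (snd p) * cnj (g (fst p))))"
    unfolding pt using i1 i2 i3 by (rule integral_combination)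
  then show ?thesis unfolding swap rate_integral[OF g] by simp
qed

text \<open>
  The cross term \<open>2 Re (H\<^sub>1\<^sub>2 f, g)\<close> equals \<open>2 Re (f, H\<^sub>1\<^sub>2\<^sup>* g)\<close> and is absorbed by completing the square in \<open>f\<close>.
  What has to be subtracted, the integral of \<open>|H\<^sub>1\<^sub>2\<^sup>* g|\<^sup>2 / (w\<^sub>2 - z)\<close>, turns \<open>w\<^sub>1 - z\<close> into \<open>\<Delta>\<close> and leaves the form of \<open>K\<close>.
\<close>

theorem schur_identity:
  assumes f: "square_integrable M2 f" and sym: "AE p in M2. f (prod.swap p) = f p"
    and g: "square_integrable M g"
  shows "(LINT x|M. (w1 x - z) * (norm (g x))\<^sup>2) + 2 * Re (LINT x|M. annih f x * cnj (g x))
      + (LINT p|M2. (w2 p - z) * (norm (f p))\<^sup>2)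
    = (LINT x|M. eff x * (norm (g x))\<^sup>2) + Re (LINT p|M2. ker p * (g (snd p) * cnj (g (fst p))))
      + (LINT p|M2. (w2 p - z) * (norm (f p + creat g p / of_real (w2 p - z)))\<^sup>2)"
proof -
  let ?d = "\<lambda>p. w2 p - z"
  note c = square_integrable_creat(1)[OF g]
  have i1: "integrable M2 (\<lambda>p. ?d p * (norm (f p))\<^sup>2)"
    using w2_bound w2_measurable
    by (intro bounded_weight_integrable[OF f, of _ "C2 + \<bar>z\<bar>"]) (auto elim!: eventually_mono)
  have i2: "integrable M2 (\<lambda>p. f p * cnj (creat g p))" by (rule square_integrable_inner_integrable[OF f c])
  have i3: "integrable M2 (\<lambda>p. (norm (creat g p))\<^sup>2 / ?d p)"
    using c by (intro divide_gap_integrable) (simp add: square_integrable_def)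
  have pt: "?d p * (norm (f p + creat g p / of_real (?d p)))\<^sup>2
      = ?d p * (norm (f p))\<^sup>2 + 2 * Re (f p * cnj (creat g p)) + (norm (creat g p))\<^sup>2 / ?d p" if "0 < ?d p" for p
  proof -
    let ?c = "creat g p"
    have "(norm (f p + ?c / of_real (?d p)))\<^sup>2 = (norm (f p))\<^sup>2 + 2 * Re (f p * cnj (?c / of_real (?d p))) + (norm (?c / of_real (?d p)))\<^sup>2"
      unfolding cmod_power2 by (simp only: plus_complex.sel times_complex.sel complex_cnj power2_eq_square) (simp add: algebra_simps)
    moreover have "f p * cnj (?c / of_real (?d p)) = of_real (1 / ?d p) * (f p * cnj ?c)" by simp
    then have "Re (f p * cnj (?c / of_real (?d p))) = 1 / ?d p * Re (f p * cnj ?c)"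
      by (simp only: Re_complex_of_real Im_complex_of_real times_complex.sel mult_zero_left diff_zero)
    moreover have "norm (?c / of_real (?d p)) = norm ?c / ?d p" using that by (simp only: norm_divide norm_of_real abs_of_pos)
    ultimately have e: "(norm (f p + ?c / of_real (?d p)))\<^sup>2
        = (norm (f p))\<^sup>2 + 2 * (1 / ?d p * Re (f p * cnj ?c)) + (norm ?c / ?d p)\<^sup>2" by simp
    define D where "D = ?d p"
    show ?thesis using that unfolding e unfolding D_def[symmetric]
      by (simp add: field_simps power2_eq_square)
  qed
  have "(LINT p|M2. ?d p * (norm (f p + creat g p / of_real (?d p)))\<^sup>2)
      = (LINT p|M2. ?d p * (norm (f p))\<^sup>2 + 2 * Re (f p * cnj (creat g p)) + (norm (creat g p))\<^sup>2 / ?d p)"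
  proof (rule integral_cong_AE)
    show "AE p in M2. ?d p * (norm (f p + creat g p / of_real (?d p)))\<^sup>2
      = ?d p * (norm (f p))\<^sup>2 + 2 * Re (f p * cnj (creat g p)) + (norm (creat g p))\<^sup>2 / ?d p"
      using gap_inverse by eventually_elim (rule pt, simp)
    have "f \<in> borel_measurable M2" "creat g \<in> borel_measurable M2"
      using f c by (auto simp: square_integrable_def)
    then show "(\<lambda>p. ?d p * (norm (f p + creat g p / of_real (?d p)))\<^sup>2) \<in> borel_measurable M2"
      using w2_measurable by measurable
    show "(\<lambda>p. ?d p * (norm (f p))\<^sup>2 + 2 * Re (f p * cnj (creat g p)) + (norm (creat g p))\<^sup>2 / ?d p) \<in> borel_measurable M2"
      by (intro borel_measurable_integrable Bochner_Integration.integrable_add integrable_mult_right integrable_Re i1 i2 i3)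
  qed
  also have "\<dots> = (LINT p|M2. ?d p * (norm (f p))\<^sup>2) + 2 * Re (LINT p|M2. f p * cnj (creat g p))
      + (LINT p|M2. (norm (creat g p))\<^sup>2 / ?d p)"
    using i1 i2 i3 by (rule integral_combination_Re)
  finally have square: "(LINT p|M2. ?d p * (norm (f p + creat g p / of_real (?d p)))\<^sup>2)
     = (LINT p|M2. ?d p * (norm (f p))\<^sup>2) + 2 * Re (LINT x|M. annih f x * cnj (g x))
      + (1 / 2 * (LINT x|M. rate x * (norm (g x))\<^sup>2)
      - Re (LINT p|M2. ker p * (g (snd p) * cnj (g (fst p)))))"
    unfolding creat_weighted_integral[OF g] annih_adjoint[OF f sym g] .
  have "(LINT x|M. eff x * (norm (g x))\<^sup>2) = (LINT x|M. (w1 x - z) * (norm (g x))\<^sup>2) - 1 / 2 * (LINT x|M. rate x * (norm (g x))\<^sup>2)"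
  proof -
    have j1: "integrable M (\<lambda>x. (w1 x - z) * (norm (g x))\<^sup>2)"
      using w1_bound w1_measurable
      by (intro bounded_weight_integrable[OF g, of _ "C1 + \<bar>z\<bar>"]) (auto elim!: eventually_mono)
    have j2: "integrable M (\<lambda>x. rate x * (norm (g x))\<^sup>2)"
      using rate_bound by (intro bounded_weight_integrable[OF g])
    have "(LINT x|M. eff x * (norm (g x))\<^sup>2) = (LINT x|M. (w1 x - z) * (norm (g x))\<^sup>2 - 1 / 2 * (rate x * (norm (g x))\<^sup>2))"
      by (simp add: eff_def algebra_simps)
    then show ?thesis using j1 j2 by simp
  qed
  then show ?thesis unfolding square by simp
qed

end

section \<open>The operator matrix on the cube\<close>

lemma open_cube: "open (cube a :: ('n::finite) pt set)"
proof -
  have "cube a = (\<Inter>i\<in>(UNIV::'n set). {x. - a < x $ i} \<inter> {x. x $ i < a})"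
    by (auto simp: cube_def)
  moreover have "open ({x::'n pt. - a < x $ i} \<inter> {x. x $ i < a})" for i
    by (intro open_Int open_Collect_less continuous_intros)
  ultimately show ?thesis by (simp add: open_INT)
qed

lemma bounded_cube: "bounded (cube a :: ('n::finite) pt set)"
proof (rule bounded_subset[OF bounded_cbox])
  show "cube a \<subseteq> cbox (\<chi> i. - a) (\<chi> i. a)" by (auto simp: cube_def mem_box_cart less_imp_le)
qed

lemma completed_square_cube:
  "completed_square (restrict_space lborel (cube a)) (cube_measure a) (cube2_measure a :: ('n::finite) pt2 measure)"
proof -
  have S: "cube a \<in> sets (borel :: 'n pt measure)" by (simp add: open_cube)
  have S2: "cube a \<times> cube a \<in> sets (borel :: 'n pt2 measure)" by (simp add: open_cube open_Times)
  have "finite_measure (restrict_space lborel (cube a :: 'n pt set))"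
    using S emeasure_bounded_finite[OF bounded_cube[of a, where 'n = 'n]]
    by (intro finite_measureI) (simp add: emeasure_restrict_space space_restrict_space)
  then show ?thesis
  proof (rule completed_square.intro, intro completed_square_axioms.intro)
    show "cube_measure a = completion (restrict_space lborel (cube a :: 'n pt set))"
      by (rule restrict_space_completion) (use S in simp)
    show "cube2_measure a = completion (restrict_space lborel (cube a :: 'n pt set) \<Otimes>\<^sub>M restrict_space lborel (cube a))"
      unfolding restrict_lborel_pair[OF S S] by (rule restrict_space_completion) (use S2 in simp)
  qed
qed

text \<open>
  Linear functionals are the functions to which \<open>halving_levels\<close> will be applied.
\<close>

lemma hyperplane_null_lebesgue_on:
  fixes e :: "'a::euclidean_space"
  assumes "e \<noteq> 0" "S \<in> sets borel"
  shows "measure (lebesgue_on S) {x \<in> space (lebesgue_on S). e \<bullet> x = t} = 0"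
proof -
  have "negligible ({x. e \<bullet> x = t} \<inter> S)"
    by (rule negligible_subset[OF negligible_hyperplane[of e t]]) (use assms(1) in simp_all)
  then have "measure lebesgue ({x. e \<bullet> x = t} \<inter> S) = 0" by (rule negligible_imp_measure0)
  moreover have "{x \<in> space (lebesgue_on S). e \<bullet> x = t} = {x. e \<bullet> x = t} \<inter> S"
    by (auto simp: space_restrict_space)
  ultimately show ?thesis using assms(2) by (simp add: measure_restrict_space)
qed

locale cube_model =
  section_bounded "restrict_space lborel (cube a)" "cube_measure a" "cube2_measure a" v Cv
  for a :: real and v :: "('n::finite) pt2 \<Rightarrow> complex" and Cv :: real +
  fixes w1 :: "'n pt \<Rightarrow> real" and w2 :: "'n pt2 \<Rightarrow> real" and C1 C2 :: real
  assumes w1_measurable: "w1 \<in> borel_measurable (cube_measure a)"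
    and w1_bound: "AE x in cube_measure a. \<bar>w1 x\<bar> \<le> C1"
    and w2_continuous: "continuous_on (cube a \<times> cube a) w2"
    and w2_measurable: "w2 \<in> borel_measurable (cube2_measure a)"
    and w2_bound: "AE p in cube2_measure a. \<bar>w2 p\<bar> \<le> C2"
    and w2_sym: "\<And>p. p \<in> space (restrict_space lborel (cube a)) \<times> space (restrict_space lborel (cube a)) \<Longrightarrow>
      w2 (prod.swap p) = w2 p"
    and v_cross: "(\<integral>\<^sup>+p. ennreal ((norm (v p * v (prod.swap p)))\<^sup>2) \<partial>cube2_measure a) < \<infinity>"
begin

abbreviation M where "M \<equiv> (cube_measure a :: 'n pt measure)"
abbreviation M2 where "M2 \<equiv> (cube2_measure a :: 'n pt2 measure)"
abbreviation X1 where "X1 \<equiv> (space1 a :: ('n pt \<Rightarrow> complex) set hilbert)"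
abbreviation X2 where "X2 \<equiv> (space2 a :: ('n pt2 \<Rightarrow> complex) set hilbert)"
abbreviation X where "X \<equiv> hsum X1 X2"
abbreviation cls1 where "cls1 \<equiv> L2_class M"
abbreviation cls2 where "cls2 \<equiv> L2_class M2"
abbreviation opA where "opA \<equiv> op_matrix a w1 w2 v"

text \<open>
  Classes are handled through representatives: every vector of the two spaces is the class of a
  function satisfying \<open>sq1\<close> or \<open>sq2\<close>.
\<close>

definition sq1 :: "('n pt \<Rightarrow> complex) \<Rightarrow> bool" where
  "sq1 f \<longleftrightarrow> square_integrable M f"

definition sq2 :: "('n pt2 \<Rightarrow> complex) \<Rightarrow> bool" where
  "sq2 f \<longleftrightarrow> square_integrable M2 f \<and> (AE p in M2. f (prod.swap p) = f p)"

lemma sq2_D: "sq2 f \<Longrightarrow> square_integrable M2 f" "sq2 f \<Longrightarrow> AE p in M2. f (prod.swap p) = f p"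
  by (simp_all add: sq2_def)

lemma sq2_add: assumes "sq2 f" "sq2 g" shows "sq2 (\<lambda>p. f p + g p)"
  unfolding sq2_def
proof
  show "square_integrable M2 (\<lambda>p. f p + g p)" using assms by (intro square_integrable_add sq2_D)
  show "AE p in M2. f (prod.swap p) + g (prod.swap p) = f p + g p"
    using sq2_D(2)[OF assms(1)] sq2_D(2)[OF assms(2)] by eventually_elim simp
qed

lemma sq2_scale: assumes "sq2 f" shows "sq2 (\<lambda>p. c * f p)"
  unfolding sq2_def
proof
  show "square_integrable M2 (\<lambda>p. c * f p)" using assms by (intro square_integrable_scale sq2_D)
  show "AE p in M2. c * f (prod.swap p) = c * f p"
    using sq2_D(2)[OF assms] by eventually_elim simp
qed

lemma AE_M2_in_cube: "AE p in M2. p \<in> space (restrict_space lborel (cube a)) \<times> space (restrict_space lborel (cube a))"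
  using AE_space[of M2] by (simp only: space_M2)

lemma sq2_w2: assumes "sq2 f" shows "sq2 (\<lambda>p. of_real (w2 p) * f p)"
  unfolding sq2_def
proof
  show "square_integrable M2 (\<lambda>p. of_real (w2 p) * f p)"
    using w2_measurable w2_bound by (rule square_integrable_bounded_mult[OF sq2_D(1)[OF assms]])
  show "AE p in M2. of_real (w2 (prod.swap p)) * f (prod.swap p) = of_real (w2 p) * f p"
    using sq2_D(2)[OF assms] AE_M2_in_cube by eventually_elim (simp add: w2_sym)
qed

lemma sq2_creat: "sq1 g \<Longrightarrow> sq2 (creat g)"
  by (simp add: sq2_def sq1_def square_integrable_creat creat_symmetric)

lemma sq1_add: "sq1 f \<Longrightarrow> sq1 g \<Longrightarrow> sq1 (\<lambda>x. f x + g x)"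
  by (simp add: sq1_def square_integrable_add)

lemma sq1_scale: "sq1 f \<Longrightarrow> sq1 (\<lambda>x. c * f x)"
  by (simp add: sq1_def square_integrable_scale)

lemma sq1_w1: "sq1 f \<Longrightarrow> sq1 (\<lambda>x. of_real (w1 x) * f x)"
  unfolding sq1_def using w1_measurable w1_bound by (rule square_integrable_bounded_mult[rotated])

lemma sq1_annih: "sq2 f \<Longrightarrow> sq1 (annih f)"
  by (simp add: sq2_def sq1_def square_integrable_annih)

lemma X1_eq: "X1 = L2 M" by (simp add: space1_def)

lemma X2_ops: "hadd X2 = hadd (L2 M2)" "hscale X2 = hscale (L2 M2)" "hzero X2 = hzero (L2 M2)"
  "hinner X2 = hinner (L2 M2)" "hnorm X2 = hnorm (L2 M2)"
  by (simp_all add: space2_def hnorm_def[abs_def])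

lemma X1_carrierE:
  assumes "u \<in> hcarrier X1" obtains f where "sq1 f" "u = cls1 f"
  using assms L2_carrierE unfolding X1_eq sq1_def by metis

lemma X1_carrierI: "sq1 f \<Longrightarrow> cls1 f \<in> hcarrier X1"
  by (auto simp: X1_eq sq1_def)

lemma X2_carrierI:
  assumes "sq2 f" shows "cls2 f \<in> hcarrier X2"
proof -
  note f = sq2_D[OF assms]
  have "AE p in M2. L2_rep (cls2 f) p = L2_rep (cls2 f) (prod.swap p)"
    using L2_rep_class(2)[OF f(1)] AE_swap[OF L2_rep_class(2)[OF f(1)]] f(2) by eventually_elim simp
  then show ?thesis using f(1) by (auto simp: space2_def case_prod_beta prod.swap_def)
qed

lemma X2_carrierE:
  assumes "u \<in> hcarrier X2" obtains f where "sq2 f" "u = cls2 f"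
proof -
  from assms have u: "u \<in> hcarrier (L2 M2)" and s: "AE p in M2. L2_rep u p = L2_rep u (prod.swap p)"
    by (auto simp: space2_def case_prod_beta prod.swap_def)
  obtain f where f: "square_integrable M2 f" "u = cls2 f" using L2_carrierE[OF u] .
  have "AE p in M2. f (prod.swap p) = f p"
    using L2_rep_class(2)[OF f(1)] AE_swap[OF L2_rep_class(2)[OF f(1)]] s unfolding f(2) by eventually_elim simp
  then show thesis using that f by (simp add: sq2_def)
qed

lemma X1_add: "sq1 f \<Longrightarrow> sq1 g \<Longrightarrow> hadd X1 (cls1 f) (cls1 g) = cls1 (\<lambda>x. f x + g x)"
  unfolding X1_eq sq1_def by (rule L2_add)

lemma X1_scale: "sq1 f \<Longrightarrow> hscale X1 c (cls1 f) = cls1 (\<lambda>x. c * f x)"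
  unfolding X1_eq sq1_def by (rule L2_scale)

lemma X1_inner: "sq1 f \<Longrightarrow> sq1 g \<Longrightarrow> hinner X1 (cls1 f) (cls1 g) = (LINT x|M. f x * cnj (g x))"
  unfolding X1_eq sq1_def by (rule L2_inner)

lemma X2_add: "sq2 f \<Longrightarrow> sq2 g \<Longrightarrow> hadd X2 (cls2 f) (cls2 g) = cls2 (\<lambda>x. f x + g x)"
  unfolding X2_ops by (intro L2_add sq2_D)

lemma X2_scale: "sq2 f \<Longrightarrow> hscale X2 c (cls2 f) = cls2 (\<lambda>x. c * f x)"
  unfolding X2_ops by (intro L2_scale sq2_D)

lemma X2_inner: "sq2 f \<Longrightarrow> sq2 g \<Longrightarrow> hinner X2 (cls2 f) (cls2 g) = (LINT x|M2. f x * cnj (g x))"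
  unfolding X2_ops by (intro L2_inner sq2_D)

lemma inner_space_X1: "inner_space X1" unfolding X1_eq by (rule inner_space_L2)

lemma inner_space_X2: "inner_space X2"
proof -
  interpret L: inner_space "L2 M2" by (rule inner_space_L2)
  have "hsubspace (L2 M2) (hcarrier X2)"
    unfolding hsubspace_def
  proof (intro conjI ballI allI)
    show "hcarrier X2 \<subseteq> hcarrier (L2 M2)" by (auto simp: space2_def)
    have "sq2 (\<lambda>_. 0)" by (simp add: sq2_def)
    then show "hzero (L2 M2) \<in> hcarrier X2" unfolding L2_zero by (rule X2_carrierI)
    fix u w c assume "u \<in> hcarrier X2"
    then obtain f where f: "sq2 f" "u = cls2 f" by (rule X2_carrierE)
    show "hscale (L2 M2) c u \<in> hcarrier X2"
      unfolding f X2_ops[symmetric] X2_scale[OF f(1)] by (intro X2_carrierI sq2_scale f)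
    assume "w \<in> hcarrier X2"
    then obtain g where g: "sq2 g" "w = cls2 g" by (rule X2_carrierE)
    show "hadd (L2 M2) u w \<in> hcarrier X2"
      unfolding f g X2_ops[symmetric] X2_add[OF f(1) g(1)] by (intro X2_carrierI sq2_add f g)
  qed
  from L.inner_space_subspace[OF this] show ?thesis by (simp add: space2_def)
qed

lemma inner_space_X: "inner_space X"
  by (intro inner_space_hsum inner_space_X1 inner_space_X2)

text \<open>
  Symmetry survives the almost everywhere limit, because exchanging the variables preserves null sets.
\<close>

lemma complete_X2: "geometrically_complete X2"
  unfolding geometrically_complete_def
proof (intro allI impI, elim conjE)
  fix u :: "nat \<Rightarrow> ('n pt2 \<Rightarrow> complex) set" and K q :: real
  assume u: "\<forall>n. u n \<in> hcarrier X2" and q: "0 < q" "q < 1"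
    and le: "\<forall>n. (hnorm X2 (hadd X2 (u (Suc n)) (hscale X2 (- 1) (u n))))\<^sup>2 \<le> K * q ^ n"
  have "\<exists>f. sq2 f \<and> u n = cls2 f" for n
    by (rule X2_carrierE[OF u[rule_format, of n]]) (intro exI conjI, assumption+)
  then obtain f where f: "\<And>n. sq2 (f n)" "\<And>n. u n = cls2 (f n)" by metis
  note f' = sq2_D[OF f(1)]
  have close: "(LINT x|M2. (norm (f (Suc n) x - f n x))\<^sup>2) \<le> K * q ^ n" for n
  proof -
    have s: "sq2 (\<lambda>x. f (Suc n) x + (- 1) * f n x)" using f(1) by (intro sq2_add sq2_scale)
    have "hadd X2 (u (Suc n)) (hscale X2 (- 1) (u n)) = cls2 (\<lambda>x. f (Suc n) x + (- 1) * f n x)"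
      unfolding f(2) X2_scale[OF f(1)] by (intro X2_add f(1) sq2_scale)
    then show ?thesis using le[rule_format, of n] L2_hnorm_sq[OF sq2_D(1)[OF s]] by (simp add: X2_ops)
  qed
  obtain g D where g: "square_integrable M2 g" "AE x in M2. (\<lambda>n. f n x) \<longlonglongrightarrow> g x"
    "integrable M2 D" "AE x in M2. \<forall>n. (norm (f n x))\<^sup>2 \<le> D x"
    using L2_geometric_limit[OF f'(1) q close] by blast
  have sym: "AE p in M2. \<forall>n. f n (prod.swap p) = f n p" using f'(2) by (simp add: AE_all_countable)
  have "AE p in M2. g (prod.swap p) = g p"
    using g(2) AE_swap[OF g(2)] sym by eventually_elim (simp add: LIMSEQ_unique)
  then have g2: "sq2 g" using g(1) by (simp add: sq2_def)
  show "\<exists>l\<in>hcarrier X2. \<forall>w\<in>hcarrier X2. (\<lambda>n. hinner X2 (u n) w) \<longlonglongrightarrow> hinner X2 l w"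
  proof (intro bexI[of _ "cls2 g"] ballI)
    fix w assume "w \<in> hcarrier X2"
    then obtain h where h: "sq2 h" "w = cls2 h" by (rule X2_carrierE)
    show "(\<lambda>n. hinner X2 (u n) w) \<longlonglongrightarrow> hinner X2 (cls2 g) w"
      unfolding f(2) h(2) X2_inner[OF f(1) h(1)] X2_inner[OF g2 h(1)]
      by (rule L2_dominated_weak_limit[OF f'(1) g(1) sq2_D(1)[OF h(1)] g(2,3,4)])
  qed (rule X2_carrierI[OF g2])
qed

lemma complete_X: "geometrically_complete X"
  by (intro geometrically_complete_hsum inner_space_X1 inner_space_X2 complete_X2)
    (simp add: X1_eq geometrically_complete_L2)

lemma H12_class:
  assumes "sq2 f" shows "H12 a v (cls2 f) = cls1 (annih f)"
  unfolding H12_def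
proof (rule L2_class_cong)
  note f = sq2_D(1)[OF assms]
  note r = L2_rep_class[OF f]
  show "AE x in M. (LINT s|M. v (x, s) * L2_rep (cls2 f) (x, s)) = annih f x"
    using AE_sections[OF r(2)] square_integrable_annih(1)[OF f] square_integrable_annih(1)[OF r(1)]
  proof eventually_elim
    case (elim x)
    show ?case
      unfolding annih_def using elim by (intro integral_cong_AE borel_measurable_integrable) auto
  qed
qed

text \<open>
  Existence is the explicit formula \<open>annih_adjoint\<close>; uniqueness holds because vectors are determined by
  their inner products.
\<close>

lemma hadjoint_class:
  assumes g: "sq1 g" shows "hadjoint X2 X1 (H12 a v) (cls1 g) = cls2 (creat g)"
  unfolding hadjoint_def
proof (rule the_equality)
  interpret X2: inner_space X2 by (rule inner_space_X2)
  have adj: "hinner X1 (H12 a v f) (cls1 g) = hinner X2 f (cls2 (creat g))" if f: "f \<in> hcarrier X2" for f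
  proof -
    obtain f' where f': "sq2 f'" "f = cls2 f'" using X2_carrierE[OF f] .
    show ?thesis
      unfolding f' H12_class[OF f'(1)] X1_inner[OF sq1_annih[OF f'(1)] g] X2_inner[OF f'(1) sq2_creat[OF g]]
      using annih_adjoint[OF sq2_D[OF f'(1)]] g by (simp add: sq1_def)
  qed
  then show "cls2 (creat g) \<in> hcarrier X2 \<and> (\<forall>f\<in>hcarrier X2. hinner X1 (H12 a v f) (cls1 g) = hinner X2 f (cls2 (creat g)))"
    using X2_carrierI[OF sq2_creat[OF g]] by blast
  fix h assume h: "h \<in> hcarrier X2 \<and> (\<forall>f\<in>hcarrier X2. hinner X1 (H12 a v f) (cls1 g) = hinner X2 f h)"
  show "h = cls2 (creat g)"
  proof (rule X2.inner_ext)
    fix w assume w: "w \<in> hcarrier X2"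
    have "hinner X2 w h = hinner X2 w (cls2 (creat g))" using h adj w by metis
    then show "hinner X2 h w = hinner X2 (cls2 (creat g)) w"
      using X2.inner_commute[of w h] X2.inner_commute[of w "cls2 (creat g)"] w h
        X2_carrierI[OF sq2_creat[OF g]] by simp
  qed (use h X2_carrierI[OF sq2_creat[OF g]] in auto)
qed

lemma opA_class:
  assumes g: "sq1 g" and f: "sq2 f"
  shows "opA (cls1 g, cls2 f) =
    (cls1 (\<lambda>x. of_real (w1 x) * g x + annih f x), cls2 (\<lambda>p. creat g p + of_real (w2 p) * f p))"
proof -
  have "H11 a w1 (cls1 g) = cls1 (\<lambda>x. of_real (w1 x) * g x)"
    unfolding H11_def using g by (intro mult_op_class) (simp add: sq1_def)
  moreover have "H22 a w2 (cls2 f) = cls2 (\<lambda>p. of_real (w2 p) * f p)"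
    unfolding H22_def by (intro mult_op_class sq2_D f)
  ultimately show ?thesis
    unfolding op_matrix_def using f g
    by (simp add: H12_class hadjoint_class X1_add sq1_w1 sq1_annih X2_add sq2_creat sq2_w2)
qed

lemma X_carrierE:
  assumes "u \<in> hcarrier X" obtains g f where "sq1 g" "sq2 f" "u = (cls1 g, cls2 f)"
proof -
  have "fst u \<in> hcarrier X1" "snd u \<in> hcarrier X2" using assms by (auto simp: hsum_def)
  then show thesis using that X1_carrierE X2_carrierE by (metis prod.collapse)
qed

lemma X_carrierI: "sq1 g \<Longrightarrow> sq2 f \<Longrightarrow> (cls1 g, cls2 f) \<in> hcarrier X"
  by (simp add: hsum_def X1_carrierI X2_carrierI)

lemma X_inner:
  assumes "sq1 g" "sq2 f" "sq1 g'" "sq2 f'"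
  shows "hinner X (cls1 g, cls2 f) (cls1 g', cls2 f') = (LINT x|M. g x * cnj (g' x)) + (LINT p|M2. f p * cnj (f' p))"
  using assms by (simp add: hsum_def X1_inner X2_inner)

lemma integrable1: "sq1 f \<Longrightarrow> sq1 g \<Longrightarrow> integrable M (\<lambda>x. f x * cnj (g x))"
  unfolding sq1_def by (rule square_integrable_inner_integrable)

lemma integrable2: "sq2 f \<Longrightarrow> sq2 g \<Longrightarrow> integrable M2 (\<lambda>x. f x * cnj (g x))"
  by (intro square_integrable_inner_integrable sq2_D)

lemma annih_adj: "sq2 f \<Longrightarrow> sq1 g \<Longrightarrow> (LINT x|M. annih f x * cnj (g x)) = (LINT p|M2. f p * cnj (creat g p))"
  unfolding sq1_def by (intro annih_adjoint sq2_D)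

lemma annih_adj':
  assumes "sq2 f" "sq1 g"
  shows "(LINT p|M2. creat g p * cnj (f p)) = (LINT x|M. g x * cnj (annih f x))"
proof -
  have "(LINT p|M2. creat g p * cnj (f p)) = cnj (LINT p|M2. f p * cnj (creat g p))"
    by (subst Bochner_Integration.integral_cnj[symmetric]) (simp add: mult.commute)
  also have "\<dots> = (LINT x|M. cnj (annih f x * cnj (g x)))"
    unfolding annih_adj[OF assms, symmetric] by (rule Bochner_Integration.integral_cnj[symmetric])
  also have "\<dots> = (LINT x|M. g x * cnj (annih f x))" by (simp add: mult.commute)
  finally show ?thesis .
qed

lemma hnorm_X1: "sq1 g \<Longrightarrow> (hnorm X1 (cls1 g))\<^sup>2 = (LINT x|M. (norm (g x))\<^sup>2)"
  unfolding X1_eq sq1_def by (rule L2_hnorm_sq)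

lemma inner_self1: "sq1 g \<Longrightarrow> (LINT x|M. g x * cnj (g x)) = of_real (LINT x|M. (norm (g x))\<^sup>2)"
  unfolding mult_cnj_self integral_complex_of_real ..

lemma inner_self2: "(LINT x|M2. g x * cnj (g x)) = of_real (LINT x|M2. (norm (g x))\<^sup>2)"
  unfolding mult_cnj_self integral_complex_of_real ..

lemma weighted_norm_le:
  fixes w :: "'b \<Rightarrow> real"
  assumes "square_integrable N f" "w \<in> borel_measurable N" "AE x in N. \<bar>w x\<bar> \<le> K"
  shows "(LINT x|N. (norm (of_real (w x) * f x))\<^sup>2) \<le> K\<^sup>2 * (LINT x|N. (norm (f x))\<^sup>2)"
proof -
  have "(LINT x|N. (norm (of_real (w x) * f x))\<^sup>2) \<le> (LINT x|N. K\<^sup>2 * (norm (f x))\<^sup>2)"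
  proof (rule integral_mono_AE)
    show "AE x in N. (norm (of_real (w x) * f x))\<^sup>2 \<le> K\<^sup>2 * (norm (f x))\<^sup>2"
      using assms(3)
    proof eventually_elim
      case (elim x)
      then have "\<bar>w x\<bar>\<^sup>2 \<le> K\<^sup>2" by (intro power_mono) auto
      then show ?case by (simp add: norm_mult power_mult_distrib mult_right_mono)
    qed
  qed (use square_integrable_bounded_mult[OF assms] assms(1) in \<open>auto simp: square_integrable_def\<close>)
  then show ?thesis by simp
qed

lemma norm_add_le:
  assumes "square_integrable N f" "square_integrable N g"
  shows "(LINT x|N. (norm (f x + g x))\<^sup>2) \<le> 2 * (LINT x|N. (norm (f x))\<^sup>2) + 2 * (LINT x|N. (norm (g x))\<^sup>2)"
proof -
  have "(LINT x|N. (norm (f x + g x))\<^sup>2) \<le> (LINT x|N. 2 * (norm (f x))\<^sup>2 + 2 * (norm (g x))\<^sup>2)"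
    using square_integrable_add[OF assms] assms norm_add_sq_le
    by (intro integral_mono) (auto simp: square_integrable_def)
  also have "\<dots> = 2 * (LINT x|N. (norm (f x))\<^sup>2) + 2 * (LINT x|N. (norm (g x))\<^sup>2)"
    using assms by (simp add: square_integrable_def)
  finally show ?thesis .
qed

lemma symm_op_X: "symm_op X opA (sqrt (2 * C1\<^sup>2 + 2 * C2\<^sup>2 + 4 * Cv))"
proof -
  interpret X: inner_space X by (rule inner_space_X)
  show ?thesis
  proof
    fix u assume "u \<in> hcarrier X"
    then obtain g f where u: "sq1 g" "sq2 f" "u = (cls1 g, cls2 f)" by (rule X_carrierE)
    note o1 = sq1_add[OF sq1_w1[OF u(1)] sq1_annih[OF u(2)]]
    note o2 = sq2_add[OF sq2_creat[OF u(1)] sq2_w2[OF u(2)]]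
    show "opA u \<in> hcarrier X"
      unfolding u(3) opA_class[OF u(1,2)] by (intro X_carrierI o1 o2)
    define ng where "ng = (LINT x|M. (norm (g x))\<^sup>2)"
    define nf where "nf = (LINT p|M2. (norm (f p))\<^sup>2)"
    have n0: "0 \<le> ng" "0 \<le> nf" by (simp_all add: ng_def nf_def)
    have "(LINT x|M. (norm (of_real (w1 x) * g x + annih f x))\<^sup>2)
        \<le> 2 * (LINT x|M. (norm (of_real (w1 x) * g x))\<^sup>2) + 2 * (LINT x|M. (norm (annih f x))\<^sup>2)"
      using sq1_w1[OF u(1)] sq1_annih[OF u(2)] unfolding sq1_def by (rule norm_add_le)
    also have "\<dots> \<le> 2 * (C1\<^sup>2 * ng) + 2 * (Cv * nf)"
      unfolding ng_def nf_def
      using weighted_norm_le[OF u(1)[unfolded sq1_def] w1_measurable w1_bound] square_integrable_annih(3)[OF sq2_D(1)[OF u(2)]]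
      by (intro add_mono mult_left_mono) auto
    finally have b1: "(LINT x|M. (norm (of_real (w1 x) * g x + annih f x))\<^sup>2) \<le> 2 * (C1\<^sup>2 * ng) + 2 * (Cv * nf)" .
    have "(LINT p|M2. (norm (creat g p + of_real (w2 p) * f p))\<^sup>2)
        \<le> 2 * (LINT p|M2. (norm (creat g p))\<^sup>2) + 2 * (LINT p|M2. (norm (of_real (w2 p) * f p))\<^sup>2)"
      using sq2_creat[OF u(1)] sq2_w2[OF u(2)] by (intro norm_add_le sq2_D)
    also have "\<dots> \<le> 2 * (Cv * ng) + 2 * (C2\<^sup>2 * nf)"
      unfolding ng_def nf_def
      using weighted_norm_le[OF sq2_D(1)[OF u(2)] w2_measurable w2_bound] square_integrable_creat(2)[OF u(1)[unfolded sq1_def]]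
      by (intro add_mono mult_left_mono) auto
    finally have b2: "(LINT p|M2. (norm (creat g p + of_real (w2 p) * f p))\<^sup>2) \<le> 2 * (Cv * ng) + 2 * (C2\<^sup>2 * nf)" .
    have "Re (hinner X (opA u) (opA u)) = (LINT x|M. (norm (of_real (w1 x) * g x + annih f x))\<^sup>2)
        + (LINT p|M2. (norm (creat g p + of_real (w2 p) * f p))\<^sup>2)"
      unfolding u(3) opA_class[OF u(1,2)] X_inner[OF o1 o2 o1 o2] inner_self1[OF o1] inner_self2 by simp
    also have "\<dots> \<le> 2 * (C1\<^sup>2 * ng) + 2 * (Cv * nf) + (2 * (Cv * ng) + 2 * (C2\<^sup>2 * nf))"
      using b1 b2 by linarith
    also have "\<dots> \<le> (2 * C1\<^sup>2 + 2 * C2\<^sup>2 + 4 * Cv) * (ng + nf)"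
      using n0 Cv mult_nonneg_nonneg[of "C1\<^sup>2" nf] mult_nonneg_nonneg[of "C2\<^sup>2" ng]
        mult_nonneg_nonneg[of Cv nf] mult_nonneg_nonneg[of Cv ng]
      by (simp add: algebra_simps)
    also have "\<dots> = (sqrt (2 * C1\<^sup>2 + 2 * C2\<^sup>2 + 4 * Cv))\<^sup>2 * Re (hinner X u u)"
      unfolding u(3) X_inner[OF u(1,2,1,2)] inner_self1[OF u(1)] inner_self2
      using Cv by (simp add: ng_def nf_def)
    finally show "Re (hinner X (opA u) (opA u)) \<le> (sqrt (2 * C1\<^sup>2 + 2 * C2\<^sup>2 + 4 * Cv))\<^sup>2 * Re (hinner X u u)" .
    fix v' assume "v' \<in> hcarrier X"
    then obtain g' f' where v': "sq1 g'" "sq2 f'" "v' = (cls1 g', cls2 f')" by (rule X_carrierE)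
    note o1' = sq1_add[OF sq1_w1[OF v'(1)] sq1_annih[OF v'(2)]]
    note o2' = sq2_add[OF sq2_creat[OF v'(1)] sq2_w2[OF v'(2)]]
    have "hinner X (opA u) v' = (LINT x|M. of_real (w1 x) * g x * cnj (g' x)) + (LINT x|M. annih f x * cnj (g' x))
        + ((LINT p|M2. creat g p * cnj (f' p)) + (LINT p|M2. of_real (w2 p) * f p * cnj (f' p)))"
      unfolding u(3) v'(3) opA_class[OF u(1,2)] X_inner[OF o1 o2 v'(1,2)]
      using Bochner_Integration.integral_add[OF integrable1[OF sq1_w1[OF u(1)] v'(1)] integrable1[OF sq1_annih[OF u(2)] v'(1)]]
        Bochner_Integration.integral_add[OF integrable2[OF sq2_creat[OF u(1)] v'(2)] integrable2[OF sq2_w2[OF u(2)] v'(2)]]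
      by (simp add: distrib_right)
    moreover have "hinner X u (opA v') = (LINT x|M. g x * cnj (of_real (w1 x) * g' x)) + (LINT x|M. g x * cnj (annih f' x))
        + ((LINT p|M2. f p * cnj (creat g' p)) + (LINT p|M2. f p * cnj (of_real (w2 p) * f' p)))"
      unfolding u(3) v'(3) opA_class[OF v'(1,2)] X_inner[OF u(1,2) o1' o2']
      using Bochner_Integration.integral_add[OF integrable1[OF u(1) sq1_w1[OF v'(1)]] integrable1[OF u(1) sq1_annih[OF v'(2)]]]
        Bochner_Integration.integral_add[OF integrable2[OF u(2) sq2_creat[OF v'(1)]] integrable2[OF u(2) sq2_w2[OF v'(2)]]]
      by (simp only: complex_cnj_add distrib_left)
    ultimately show "hinner X (opA u) v' = hinner X u (opA v')"
      unfolding annih_adj[OF u(2) v'(1)] annih_adj'[OF v'(2) u(1)] by (simp add: mult_ac)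
  qed (use Cv in simp)
qed

lemma form_opA:
  assumes g: "sq1 g" and f: "sq2 f"
  shows "Re (hinner X (opA (cls1 g, cls2 f)) (cls1 g, cls2 f)) - z * Re (hinner X (cls1 g, cls2 f) (cls1 g, cls2 f))
    = (LINT x|M. (w1 x - z) * (norm (g x))\<^sup>2) + 2 * Re (LINT x|M. annih f x * cnj (g x))
      + (LINT p|M2. (w2 p - z) * (norm (f p))\<^sup>2)"
proof -
  note o1 = sq1_add[OF sq1_w1[OF g] sq1_annih[OF f]]
  note o2 = sq2_add[OF sq2_creat[OF g] sq2_w2[OF f]]
  have w: "of_real r * c * cnj c = of_real (r * (norm c)\<^sup>2)" for r :: real and c :: complex
    by (simp only: mult.assoc mult_cnj_self of_real_mult)
  have i1: "integrable M (\<lambda>x. w1 x * (norm (g x))\<^sup>2)"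
    using integrable1[OF sq1_w1[OF g] g] unfolding w complex_of_real_integrable_eq .
  have i2: "integrable M2 (\<lambda>p. w2 p * (norm (f p))\<^sup>2)"
    using integrable2[OF sq2_w2[OF f] f] unfolding w complex_of_real_integrable_eq .
  have i1': "integrable M (\<lambda>x. (norm (g x))\<^sup>2)" using g by (simp add: sq1_def square_integrable_def)
  have i2': "integrable M2 (\<lambda>x. (norm (f x))\<^sup>2)" using sq2_D(1)[OF f] by (simp add: square_integrable_def)
  have "hinner X (opA (cls1 g, cls2 f)) (cls1 g, cls2 f)
      = (LINT x|M. of_real (w1 x) * g x * cnj (g x)) + (LINT x|M. annih f x * cnj (g x))
        + ((LINT p|M2. creat g p * cnj (f p)) + (LINT p|M2. of_real (w2 p) * f p * cnj (f p)))"
    unfolding opA_class[OF g f] X_inner[OF o1 o2 g f]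
    using Bochner_Integration.integral_add[OF integrable1[OF sq1_w1[OF g] g] integrable1[OF sq1_annih[OF f] g]]
      Bochner_Integration.integral_add[OF integrable2[OF sq2_creat[OF g] f] integrable2[OF sq2_w2[OF f] f]]
    by (simp add: distrib_right)
  also have "(LINT p|M2. creat g p * cnj (f p)) = cnj (LINT x|M. annih f x * cnj (g x))"
    unfolding annih_adj'[OF f g] by (subst Bochner_Integration.integral_cnj[symmetric]) (simp add: mult.commute)
  finally have "Re (hinner X (opA (cls1 g, cls2 f)) (cls1 g, cls2 f))
      = (LINT x|M. w1 x * (norm (g x))\<^sup>2) + 2 * Re (LINT x|M. annih f x * cnj (g x)) + (LINT p|M2. w2 p * (norm (f p))\<^sup>2)"
    unfolding w integral_complex_of_real by simp
  moreover have "Re (hinner X (cls1 g, cls2 f) (cls1 g, cls2 f)) = (LINT x|M. (norm (g x))\<^sup>2) + (LINT p|M2. (norm (f p))\<^sup>2)"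
    unfolding X_inner[OF g f g f] inner_self1[OF g] inner_self2 by simp
  moreover have "(LINT x|M. (w1 x - z) * (norm (g x))\<^sup>2) = (LINT x|M. w1 x * (norm (g x))\<^sup>2) - z * (LINT x|M. (norm (g x))\<^sup>2)"
    using i1 i1' by (simp add: left_diff_distrib)
  moreover have "(LINT p|M2. (w2 p - z) * (norm (f p))\<^sup>2) = (LINT p|M2. w2 p * (norm (f p))\<^sup>2) - z * (LINT p|M2. (norm (f p))\<^sup>2)"
    using i2 i2' by (simp add: left_diff_distrib)
  ultimately show ?thesis by (simp add: distrib_left)
qed

end

section \<open>Lower bounds for the potential and the effective potential\<close>

lemma square_integrable_indicator:
  assumes "finite_measure K" "D \<in> sets K"
  shows "square_integrable K (indicator D :: 'a \<Rightarrow> complex)"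
    and "(LINT x|K. (norm (indicator D x :: complex))\<^sup>2) = measure K D"
proof -
  interpret finite_measure K by fact
  have eq: "(norm (indicator D x :: complex))\<^sup>2 = indicator D x" for x by (simp add: indicator_def)
  have "integrable K (indicator D :: 'a \<Rightarrow> real)" using assms(2) emeasure_finite[of D]
    by (simp add: less_top[symmetric])
  then show "square_integrable K (indicator D :: 'a \<Rightarrow> complex)"
    unfolding square_integrable_def eq using assms(2) by simp
  show "(LINT x|K. (norm (indicator D x :: complex))\<^sup>2) = measure K D"
    unfolding eq using assms(2) by (simp add: sets.Int_space_eq2)
qed

text \<open>
  The sets \<open>V n\<close> localise functions in ever smaller parts of \<open>W\<close>, while the disjoint sets \<open>D n\<close>, through
  their indicator functions, show that each \<open>V n\<close> still carries an infinite-dimensional space of functions.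
\<close>

lemma shrinking_positive_pieces:
  assumes K: "finite_measure K" and \<phi>: "\<phi> \<in> borel_measurable K"
    and levels: "\<And>t. measure K {x \<in> space K. \<phi> x = t} = 0"
    and W: "W \<in> sets K" and pos: "measure K W > 0"
  obtains V D :: "nat \<Rightarrow> 'a set" and t :: "nat \<Rightarrow> real" where
    "\<And>n. V n = W \<inter> {x \<in> space K. \<phi> x \<le> t n}" "\<And>n. V n \<in> sets K" "\<And>n. V (Suc n) \<subseteq> V n"
    "\<And>n. measure K (V n) = measure K W / 2 ^ Suc n"
    "\<And>n. D n = V n - V (Suc n)" "\<And>n. D n \<in> sets K" "\<And>n. measure K (D n) > 0"
    "\<And>i j. i \<noteq> j \<Longrightarrow> D i \<inter> D j = {}"
proof -
  interpret finite_measure K by fact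
  obtain t :: "nat \<Rightarrow> real" where t: "\<And>n. t (Suc n) < t n"
    "\<And>n. measure K (W \<inter> {x \<in> space K. \<phi> x \<le> t n}) = measure K W / 2 ^ Suc n"
    using halving_levels[OF K \<phi> levels W pos] by blast
  define V where "V = (\<lambda>n. W \<inter> {x \<in> space K. \<phi> x \<le> t n})"
  define D where "D = (\<lambda>n. V n - V (Suc n))"
  have V: "V n \<in> sets K" for n unfolding V_def using W \<phi> by auto
  have mono: "V (Suc n) \<subseteq> V n" for n using t(1)[of n] by (auto simp: V_def)
  have anti: "V j \<subseteq> V i" if "i \<le> j" for i j using mono that by (rule lift_Suc_antimono_le)
  have mD: "measure K (D n) > 0" for n
  proof -
    have "measure K (D n) = measure K (V n) - measure K (V (Suc n))"
      unfolding D_def using V mono by (intro finite_measure_Diff)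
    also have "\<dots> = measure K W / 2 ^ Suc (Suc n)" unfolding V_def t(2) by (simp add: field_simps)
    finally show ?thesis using pos by simp
  qed
  have disj: "D i \<inter> D j = {}" if "i < j" for i j
    using anti[of "Suc i" j] that by (auto simp: D_def)
  show thesis
  proof (rule that[of V t D])
    show "D i \<inter> D j = {}" if "i \<noteq> j" for i j
      using disj[of i j] disj[of j i] that by (cases "i < j") auto
  qed (use V mono mD t(2) in \<open>auto simp: V_def D_def\<close>)
qed

lemma L2_class_eq_zero:
  assumes "square_integrable M f" "(LINT x|M. (norm (f x))\<^sup>2) \<le> 0"
  shows "L2_class M f = hzero (L2 M)"
proof -
  interpret inner_space "L2 M" by (rule inner_space_L2)
  have "nsq (L2_class M f) \<le> 0" using assms hnorm_sq[OF L2_carrierI[OF assms(1)]] L2_hnorm_sq[OF assms(1)] by simp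
  then show ?thesis using nsq_pos[OF L2_carrierI[OF assms(1)]] by fastforce
qed

lemma integral_indicator_disjoint:
  assumes "D \<inter> E = {}"
  shows "(LINT x|K. indicator D x * cnj (indicator E x :: complex)) = 0"
proof -
  have "(\<lambda>x. indicator D x * cnj (indicator E x :: complex)) = (\<lambda>x. 0)"
    using assms by (auto simp: indicator_def fun_eq_iff)
  then show ?thesis by simp
qed

locale cube_model_below = cube_model a v Cv w1 w2 C1 C2
  for a :: real and v :: "('n::finite) pt2 \<Rightarrow> complex" and Cv w1 w2 C1 C2 +
  fixes z :: real
  assumes below_essential: "\<forall>\<mu>\<in>essential_spectrum (hsum (space1 a) (space2 a)) (op_matrix a w1 w2 v). z < Re \<mu>"
begin

sublocale spectral: symm_op_below_essential X opA "sqrt (2 * C1\<^sup>2 + 2 * C2\<^sup>2 + 4 * Cv)" z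
  by (intro symm_op_below_essential.intro symm_op_X symm_op_below_essential_axioms.intro complete_X below_essential)

lemma finite_codimension_bound:
  obtains N :: nat and b c where "\<forall>i<N. b i \<in> hcarrier X" "z < c"
    "\<And>g f. \<lbrakk>sq1 g; sq2 f; \<forall>i<N. hinner X (cls1 g, cls2 f) (b i) = 0\<rbrakk> \<Longrightarrow>
      c * Re (hinner X (cls1 g, cls2 f) (cls1 g, cls2 f)) \<le> Re (hinner X (opA (cls1 g, cls2 f)) (cls1 g, cls2 f))"
proof -
  obtain N :: nat and b c where b: "\<forall>i<N. b i \<in> hcarrier X" "z < c"
    "\<forall>u\<in>hcarrier X. (\<forall>i<N. hinner X u (b i) = 0) \<longrightarrow> c * Re (hinner X u u) \<le> Re (hinner X (opA u) u)"
    using spectral.form_bound_finite_codimension by blast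
  show thesis
    by (rule that[OF b(1,2)]) (use b(3) X_carrierI in blast)
qed

lemma zero_sq: "sq1 (\<lambda>_. 0)" "sq2 (\<lambda>_. 0)"
  by (simp_all add: sq1_def sq2_def)

lemma X1_zero: "hzero X1 = cls1 (\<lambda>_. 0)"
  by (simp add: X1_eq L2_zero)

lemma X_zero: "hzero X = (cls1 (\<lambda>_. 0), cls2 (\<lambda>_. 0))"
  by (simp add: hsum_def X2_ops X1_eq L2_zero)

lemma cube_sets: "cube a \<in> sets (borel :: 'n pt measure)" "cube a \<times> cube a \<in> sets (borel :: 'n pt2 measure)"
  by (simp_all add: open_cube open_Times)

lemma finite_M2: "finite_measure M2"
proof -
  interpret finite_measure M by (rule finite_measure_M)
  have "integrable M2 (\<lambda>_. (1::real))"
    using square_integrable_fst[OF square_integrable_one] by (simp add: square_integrable_def)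
  then have "emeasure M2 (space M2) < \<infinity>" by (simp add: integrable_iff_bounded)
  then show ?thesis by (intro finite_measureI) simp
qed

text \<open>
  If \<open>w2 < c\<close> at some point, then \<open>w2 < c' < c\<close> on a symmetric open set \<open>W\<close>.  Symmetric functions supported in
  \<open>W\<close> form an infinite-dimensional space, so one of them satisfies the finitely many conditions under
  which the form is at least \<open>c\<close>, although it is at most \<open>c'\<close> there.
\<close>

lemma w2_lower_bound: "\<exists>c>z. \<forall>p\<in>cube a \<times> cube a. c \<le> w2 p"
proof -
  obtain N :: nat and b c where b: "\<forall>i<N. b i \<in> hcarrier X" and c: "z < c"
    and form: "\<And>g f. \<lbrakk>sq1 g; sq2 f; \<forall>i<N. hinner X (cls1 g, cls2 f) (b i) = 0\<rbrakk> \<Longrightarrow>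
      c * Re (hinner X (cls1 g, cls2 f) (cls1 g, cls2 f)) \<le> Re (hinner X (opA (cls1 g, cls2 f)) (cls1 g, cls2 f))"
    using finite_codimension_bound by blast
  have "c \<le> w2 p0" if p0: "p0 \<in> cube a \<times> cube a" for p0
  proof (rule ccontr)
    assume "\<not> c \<le> w2 p0"
    define c' where "c' = (w2 p0 + c) / 2"
    have c': "w2 p0 < c'" "c' < c" using \<open>\<not> c \<le> w2 p0\<close> by (auto simp: c'_def)
    define W where "W = {p \<in> cube a \<times> cube a. w2 p < c'}"
    have W_open: "open W"
    proof -
      have "open ((cube a \<times> cube a) \<inter> w2 -` {..<c'})"
        using w2_continuous by (rule continuous_open_preimage) (auto simp: open_cube open_Times)
      moreover have "W = (cube a \<times> cube a) \<inter> w2 -` {..<c'}" by (auto simp: W_def)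
      ultimately show ?thesis by simp
    qed
    have W_sub: "W \<subseteq> cube a \<times> cube a" by (auto simp: W_def)
    have W_sets: "W \<in> sets M2"
      using W_open W_sub cube_sets(2) by (subst sets_restrict_space_iff) auto
    have W_pos: "measure M2 W > 0"
    proof -
      have "p0 \<in> W" using p0 c' by (simp add: W_def)
      then have "\<not> negligible W" using W_open open_not_negligible by blast
      moreover have "W \<in> lmeasurable"
        using W_open bounded_subset[OF bounded_Times[OF bounded_cube bounded_cube] W_sub] by (rule lmeasurable_open[rotated])
      ultimately have "measure lebesgue W \<noteq> 0" by (simp add: negligible_iff_measure)
      moreover have "measure M2 W = measure lebesgue W"
        using W_sub cube_sets(2) by (intro measure_restrict_space) auto
      ultimately show ?thesis by (simp add: zero_less_measure_iff)
    qed
    have W_swap: "prod.swap p \<in> W \<longleftrightarrow> p \<in> W" for p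
      using w2_sym[of p] w2_sym[of "prod.swap p"] by (cases p) (auto simp: W_def space_restrict_space)
    obtain e :: "'n pt" where e: "e \<noteq> 0" by (metis axis_eq_0_iff zero_neq_one)
    \<comment> \<open>The functional is invariant under the swap, so the pieces cut out by its levels are symmetric.\<close>
    define \<phi> where "\<phi> = (\<lambda>p. (e, e) \<bullet> (p :: 'n pt2))"
    have \<phi>: "\<phi> \<in> borel_measurable M2" unfolding \<phi>_def by (intro measurable_restrict_space1 measurable_completion) simp
    have levels: "measure M2 {p \<in> space M2. \<phi> p = t} = 0" for t
      unfolding \<phi>_def by (rule hyperplane_null_lebesgue_on) (use e cube_sets in \<open>auto simp: zero_prod_def\<close>)
    obtain V D :: "nat \<Rightarrow> 'n pt2 set" and t :: "nat \<Rightarrow> real" where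
      V: "\<And>n. V n = W \<inter> {x \<in> space M2. \<phi> x \<le> t n}" "\<And>n. V n \<in> sets M2" "\<And>n. V (Suc n) \<subseteq> V n"
      "\<And>n. measure M2 (V n) = measure M2 W / 2 ^ Suc n" and
      D: "\<And>n. D n = V n - V (Suc n)" "\<And>n. D n \<in> sets M2" "\<And>n. measure M2 (D n) > 0"
      "\<And>i j. i \<noteq> j \<Longrightarrow> D i \<inter> D j = {}"
      by (rule shrinking_positive_pieces[OF finite_M2 \<phi> levels W_sets W_pos], rule that) (assumption+)
    have V_swap: "prod.swap p \<in> V n \<longleftrightarrow> p \<in> V n" for p n
      using W_swap[of p] by (cases p) (auto simp: V(1) \<phi>_def add.commute)
    have D_swap: "prod.swap p \<in> D n \<longleftrightarrow> p \<in> D n" for p n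
      using V_swap by (simp add: D(1))
    have D_sq: "sq2 (indicator (D n))" for n
      unfolding sq2_def using square_integrable_indicator(1)[OF finite_M2 D(2)[of n]] D_swap
      by (simp add: indicator_def)
    define L where "L = {cls2 f | f. sq2 f \<and> (AE p in M2. p \<notin> W \<longrightarrow> f p = 0)}"
    have LE: "\<exists>f. u = cls2 f \<and> sq2 f \<and> (AE p in M2. p \<notin> W \<longrightarrow> f p = 0)" if "u \<in> L" for u
      using that by (auto simp: L_def)
    have L: "hsubspace X2 L"
      unfolding hsubspace_def
    proof (intro conjI ballI allI)
      show "L \<subseteq> hcarrier X2" using X2_carrierI by (auto simp: L_def)
      show "hzero X2 \<in> L" unfolding L_def X2_ops L2_zero using zero_sq by (intro CollectI exI[of _ "\<lambda>_. 0"]) simp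
      fix u k assume "u \<in> L"
      then obtain f where f: "u = cls2 f" "sq2 f" "AE p in M2. p \<notin> W \<longrightarrow> f p = 0" using LE by blast
      show "hscale X2 k u \<in> L"
        unfolding f(1) X2_scale[OF f(2)] L_def using f(2,3) sq2_scale[OF f(2), of k]
        by (intro CollectI exI[of _ "\<lambda>x. k * f x"]) (auto elim!: eventually_mono)
      fix w assume "w \<in> L"
      then obtain g where g: "w = cls2 g" "sq2 g" "AE p in M2. p \<notin> W \<longrightarrow> g p = 0" using LE by blast
      have "AE p in M2. p \<notin> W \<longrightarrow> f p + g p = 0" using f(3) g(3) by eventually_elim auto
      then show "hadd X2 u w \<in> L"
        unfolding f(1) g(1) X2_add[OF f(2) g(2)] L_def using sq2_add[OF f(2) g(2)]
        by (intro CollectI exI[of _ "\<lambda>x. f x + g x"]) auto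
    qed
    have "\<exists>x\<in>L. x \<noteq> hzero X2 \<and> (\<forall>i<N. hinner X (hzero X1, x) (b i) = 0)"
    proof (rule exists_annihilated_by_functionals[OF inner_space_X2 inner_space_X L, where u = "\<lambda>n. cls2 (indicator (D n))"])
      show "cls2 (indicator (D n)) \<in> L" for n
        unfolding L_def using D_sq[of n] by (intro CollectI exI[of _ "indicator (D n)"]) (auto simp: D(1) V(1))
      show "cls2 (indicator (D n)) \<noteq> hzero X2" for n
      proof
        assume "cls2 (indicator (D n)) = hzero X2"
        then have "hinner X2 (cls2 (indicator (D n))) (cls2 (indicator (D n))) = 0"
          using X2_carrierI[OF D_sq[of n]] inner_space.inner_zero[OF inner_space_X2] by metis
        then show False
          using D(3)[of n] square_integrable_indicator(2)[OF finite_M2 D(2)[of n]]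
          unfolding X2_inner[OF D_sq D_sq] inner_self2 by simp
      qed
      show "hinner X2 (cls2 (indicator (D i))) (cls2 (indicator (D j))) = 0" if "i \<noteq> j" for i j
        unfolding X2_inner[OF D_sq D_sq] by (rule integral_indicator_disjoint[OF D(4)[OF that]])
      show "(hzero X1, hzero X2) = hzero X" by (simp add: hsum_def)
    next
      fix x y k assume "x \<in> L"
      then obtain f where f: "x = cls2 f" "sq2 f" using LE by blast
      show "(hzero X1, x) \<in> hcarrier X"
        unfolding f X1_zero by (intro X_carrierI zero_sq f)
      have z1: "hscale X1 k (hzero X1) = hzero X1" unfolding X1_eq L2_zero by (simp add: L2_scale)
      then show "(hzero X1, hscale X2 k x) = hscale X k (hzero X1, x)" by (simp add: hsum_def)
      have "hadd X1 (hzero X1) (hzero X1) = hzero X1" unfolding X1_eq L2_zero by (simp add: L2_add)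
      then show "(hzero X1, hadd X2 x y) = hadd X (hzero X1, x) (hzero X1, y)" by (simp add: hsum_def)
    qed (rule b)
    then obtain f where f: "sq2 f" "AE p in M2. p \<notin> W \<longrightarrow> f p = 0" "cls2 f \<noteq> hzero X2"
      "\<forall>i<N. hinner X (cls1 (\<lambda>_. 0), cls2 f) (b i) = 0"
      unfolding X1_zero using LE by blast
    have "0 \<le> (LINT p|M2. (w2 p - c) * (norm (f p))\<^sup>2)"
      using form[OF zero_sq(1) f(1,4)] form_opA[OF zero_sq(1) f(1), of c] by simp
    also have "\<dots> \<le> (LINT p|M2. (c' - c) * (norm (f p))\<^sup>2)"
    proof (rule integral_mono_AE)
      have fi: "integrable M2 (\<lambda>p. (norm (f p))\<^sup>2)" using sq2_D(1)[OF f(1)] by (simp add: square_integrable_def)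
      then show "integrable M2 (\<lambda>p. (c' - c) * (norm (f p))\<^sup>2)" by simp
      show "integrable M2 (\<lambda>p. (w2 p - c) * (norm (f p))\<^sup>2)"
      proof (rule Bochner_Integration.integrable_bound)
        show "integrable M2 (\<lambda>p. (C2 + \<bar>c\<bar>) * (norm (f p))\<^sup>2)" using fi by simp
        show "AE p in M2. norm ((w2 p - c) * (norm (f p))\<^sup>2) \<le> norm ((C2 + \<bar>c\<bar>) * (norm (f p))\<^sup>2)"
          using w2_bound
        proof eventually_elim
          case (elim p)
          then have "\<bar>w2 p - c\<bar> * (norm (f p))\<^sup>2 \<le> \<bar>C2 + \<bar>c\<bar>\<bar> * (norm (f p))\<^sup>2"
            by (intro mult_right_mono) auto
          then show ?case by (simp add: abs_mult)
        qed
        show "(\<lambda>p. (w2 p - c) * (norm (f p))\<^sup>2) \<in> borel_measurable M2"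
          using w2_measurable square_integrable_measurable[OF sq2_D(1)[OF f(1)]] by simp
      qed
      show "AE p in M2. (w2 p - c) * (norm (f p))\<^sup>2 \<le> (c' - c) * (norm (f p))\<^sup>2"
        using f(2)
      proof eventually_elim
        case (elim p)
        then show ?case by (cases "p \<in> W") (auto simp: W_def intro!: mult_right_mono)
      qed
    qed
    also have "\<dots> = (c' - c) * (LINT p|M2. (norm (f p))\<^sup>2)" by simp
    finally have "(LINT p|M2. (norm (f p))\<^sup>2) \<le> 0"
      using c'(2) by (simp add: zero_le_mult_iff)
    then have "cls2 f = hzero X2"
      unfolding X2_ops by (rule L2_class_eq_zero[OF sq2_D(1)[OF f(1)]])
    then show False using f(3) by simp
  qed
  then show ?thesis using c by blast
qed

end

locale cube_schur = cube_model_below a v Cv w1 w2 C1 C2 z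
  for a :: real and v :: "('n::finite) pt2 \<Rightarrow> complex" and Cv w1 w2 C1 C2 z +
  fixes \<delta> :: real
  assumes \<delta>_pos: "0 < \<delta>" and w2_gap: "AE p in cube2_measure a. z + \<delta> \<le> w2 p"
begin

sublocale schur: schur_form "restrict_space lborel (cube a)" "cube_measure a" "cube2_measure a" v Cv w1 w2 z \<delta> C1 C2
  by (intro schur_form.intro section_bounded_axioms schur_form_axioms.intro w1_measurable w1_bound
      w2_measurable w2_bound w2_sym v_cross \<delta>_pos w2_gap)

abbreviation \<Delta> where "\<Delta> \<equiv> Delta a w1 w2 v z"

lemma Delta_eq: "\<Delta> = schur.eff"
  by (simp add: Delta_def schur.eff_def schur.rate_def fun_eq_iff)

lemma kernel_K_eq: "kernel_K w2 v z = schur.ker"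
  by (auto simp: kernel_K_def schur.ker_def fun_eq_iff)

text \<open>
  \<open>lift g\<close> is the minimiser of the form over the second component when the first one is \<open>g\<close>.
\<close>

definition lift :: "('n pt \<Rightarrow> complex) \<Rightarrow> 'n pt2 \<Rightarrow> complex" where
  "lift g p = - creat g p / of_real (w2 p - z)"

lemma sq2_lift:
  assumes "sq1 g" shows "sq2 (lift g)"
  unfolding sq2_def
proof
  have "square_integrable M2 (\<lambda>p. (- 1) * (creat g p / of_real (w2 p - z)))"
    using assms by (intro square_integrable_scale schur.square_integrable_divide_gap sq2_D sq2_creat)
  then show "square_integrable M2 (lift g)" by (simp add: lift_def[abs_def])
  show "AE p in M2. lift g (prod.swap p) = lift g p"
    using AE_M2_in_cube by eventually_elim (simp add: lift_def creat_symmetric w2_sym)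
qed

definition lift_class :: "('n pt \<Rightarrow> complex) set \<Rightarrow> ('n pt2 \<Rightarrow> complex) set" where
  "lift_class u = cls2 (lift (L2_rep u))"

lemma lift_class:
  assumes "sq1 g" shows "lift_class (cls1 g) = cls2 (lift g)"
  unfolding lift_class_def
proof (rule L2_class_cong)
  note r = AE_fst[OF L2_rep_class(2)[OF assms[unfolded sq1_def]]]
  show "AE p in M2. lift (L2_rep (cls1 g)) p = lift g p"
    using r AE_swap[OF r] by eventually_elim (simp add: lift_def creat_def creat0_def)
qed

lemma lift_add: "lift (\<lambda>x. f x + g x) p = lift f p + lift g p"
  by (simp add: lift_def creat_def creat0_def add_divide_distrib[symmetric] algebra_simps)

lemma lift_scale: "lift (\<lambda>x. c * f x) p = c * lift f p"
  by (simp add: lift_def creat_def creat0_def add_divide_distrib[symmetric] algebra_simps)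

text \<open>
  The form of the Schur complement \<open>H\<^sub>1\<^sub>1 - z - H\<^sub>1\<^sub>2 (H\<^sub>2\<^sub>2 - z)\<inverse> H\<^sub>1\<^sub>2\<^sup>*\<close>.
\<close>

definition eff_form :: "('n pt \<Rightarrow> complex) \<Rightarrow> real" where
  "eff_form g = (LINT x|M. \<Delta> x * (norm (g x))\<^sup>2) + Re (LINT p|M2. schur.ker p * (g (snd p) * cnj (g (fst p))))"

lemma form_schur:
  assumes "sq1 g" "sq2 f"
  shows "Re (hinner X (opA (cls1 g, cls2 f)) (cls1 g, cls2 f)) - z * Re (hinner X (cls1 g, cls2 f) (cls1 g, cls2 f))
    = eff_form g + (LINT p|M2. (w2 p - z) * (norm (f p + creat g p / of_real (w2 p - z)))\<^sup>2)"
  unfolding form_opA[OF assms] eff_form_def Delta_eq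
  by (rule schur.schur_identity) (use assms in \<open>simp_all add: sq1_def sq2_def\<close>)

lemma form_schur_ge:
  assumes "sq1 g" "sq2 f"
  shows "eff_form g \<le> Re (hinner X (opA (cls1 g, cls2 f)) (cls1 g, cls2 f)) - z * Re (hinner X (cls1 g, cls2 f) (cls1 g, cls2 f))"
proof -
  have "0 \<le> (LINT p|M2. (w2 p - z) * (norm (f p + creat g p / of_real (w2 p - z)))\<^sup>2)"
    using schur.gap_inverse by (intro integral_nonneg_AE) (auto elim!: eventually_mono)
  then show ?thesis unfolding form_schur[OF assms] by simp
qed

lemma form_schur_lift:
  assumes "sq1 g"
  shows "Re (hinner X (opA (cls1 g, cls2 (lift g))) (cls1 g, cls2 (lift g)))
    - z * Re (hinner X (cls1 g, cls2 (lift g)) (cls1 g, cls2 (lift g))) = eff_form g"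
  unfolding form_schur[OF assms sq2_lift[OF assms]] by (simp add: lift_def)

lemma Delta_measurable: "\<Delta> \<in> borel_measurable M"
  unfolding Delta_eq by (rule schur.eff_measurable)

lemma Delta_bound: "AE x in M. \<bar>\<Delta> x\<bar> \<le> C1 + \<bar>z\<bar> + Cv / \<delta>"
  unfolding Delta_eq by (rule schur.eff_bound)

lemma X1_supported_subspace: "hsubspace X1 {cls1 f | f. sq1 f \<and> (AE x in M. x \<notin> V \<longrightarrow> f x = 0)}"
  (is "hsubspace X1 ?L")
  unfolding hsubspace_def
proof (intro conjI ballI allI)
  have LE: "\<exists>f. u = cls1 f \<and> sq1 f \<and> (AE p in M. p \<notin> V \<longrightarrow> f p = 0)" if "u \<in> ?L" for u
    using that by auto
  show "?L \<subseteq> hcarrier X1" using X1_carrierI by auto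
  show "hzero X1 \<in> ?L" unfolding X1_eq L2_zero using zero_sq by (intro CollectI exI[of _ "\<lambda>_. 0"]) simp
  fix u k assume "u \<in> ?L"
  then obtain f where f: "u = cls1 f" "sq1 f" "AE p in M. p \<notin> V \<longrightarrow> f p = 0" using LE by blast
  show "hscale X1 k u \<in> ?L"
    unfolding f(1) X1_scale[OF f(2)] using f(2,3) sq1_scale[OF f(2), of k]
    by (intro CollectI exI[of _ "\<lambda>x. k * f x"]) (auto elim!: eventually_mono)
  fix w assume "w \<in> ?L"
  then obtain g where g: "w = cls1 g" "sq1 g" "AE p in M. p \<notin> V \<longrightarrow> g p = 0" using LE by blast
  have "AE p in M. p \<notin> V \<longrightarrow> f p + g p = 0" using f(3) g(3) by eventually_elim auto
  then show "hadd X1 u w \<in> ?L"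
    unfolding f(1) g(1) X1_add[OF f(2) g(2)] using sq1_add[OF f(2) g(2)]
    by (intro CollectI exI[of _ "\<lambda>x. f x + g x"]) auto
qed

text \<open>
  Suppose \<open>\<Delta> < \<beta>\<close> on a set of positive measure, with \<open>\<beta> = (c - z) / 2\<close>.  For \<open>f\<close> supported in a piece \<open>V m\<close>
  of it, the form of the Schur complement is at most \<open>\<beta> \<parallel>f\<parallel>\<^sup>2\<close> plus the contribution of \<open>K\<close>, and the
  latter is at most \<open>\<beta>/2 \<parallel>f\<parallel>\<^sup>2\<close> once \<open>V m\<close> is so small that \<open>K\<close> has small \<open>L\<^sup>2\<close> norm over \<open>y \<in> V m\<close>.
  But for a suitable nonzero \<open>f\<close> the vector \<open>(f, lift f)\<close> lies in the subspace of finite codimension, which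
  forces at least \<open>2 \<beta> \<parallel>f\<parallel>\<^sup>2\<close>.
\<close>

lemma Delta_lower_bound: "\<exists>\<beta>>0. AE x in M. \<beta> \<le> \<Delta> x"
proof -
  obtain N :: nat and b c where b: "\<forall>i<N. b i \<in> hcarrier X" and c: "z < c"
    and form: "\<And>g f. \<lbrakk>sq1 g; sq2 f; \<forall>i<N. hinner X (cls1 g, cls2 f) (b i) = 0\<rbrakk> \<Longrightarrow>
      c * Re (hinner X (cls1 g, cls2 f) (cls1 g, cls2 f)) \<le> Re (hinner X (opA (cls1 g, cls2 f)) (cls1 g, cls2 f))"
    using finite_codimension_bound by blast
  interpret FM: finite_measure M by (rule finite_measure_M)
  define \<beta> where "\<beta> = (c - z) / 2"
  have \<beta>: "\<beta> > 0" using c by (simp add: \<beta>_def)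
  have "AE x in M. \<beta> \<le> \<Delta> x"
  proof (rule ccontr)
    assume nAE: "\<not> (AE x in M. \<beta> \<le> \<Delta> x)"
    define W where "W = {x \<in> space M. \<Delta> x < \<beta>}"
    have W_sets: "W \<in> sets M" unfolding W_def using borel_measurable_less[OF Delta_measurable borel_measurable_const] .
    have W_pos: "measure M W > 0"
    proof (rule ccontr)
      assume "\<not> 0 < measure M W"
      then have "emeasure M W = 0" by (simp add: FM.emeasure_eq_measure zero_less_measure_iff)
      then have "AE x in M. x \<notin> W" using W_sets by (intro AE_not_in) auto
      with AE_space have "AE x in M. \<beta> \<le> \<Delta> x" by eventually_elim (auto simp: W_def)
      then show False using nAE by simp
    qed
    obtain e :: "'n pt" where e: "e \<noteq> 0" by (metis axis_eq_0_iff zero_neq_one)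
    define \<phi> where "\<phi> = (\<lambda>x. e \<bullet> (x :: 'n pt))"
    have \<phi>: "\<phi> \<in> borel_measurable M" unfolding \<phi>_def by (intro measurable_restrict_space1 measurable_completion) simp
    have levels: "measure M {p \<in> space M. \<phi> p = t} = 0" for t
      unfolding \<phi>_def by (rule hyperplane_null_lebesgue_on) (use e cube_sets in \<open>auto simp: zero_prod_def\<close>)
    obtain V D :: "nat \<Rightarrow> 'n pt set" and t :: "nat \<Rightarrow> real" where
      V: "\<And>n. V n = W \<inter> {x \<in> space M. \<phi> x \<le> t n}" "\<And>n. V n \<in> sets M" "\<And>n. V (Suc n) \<subseteq> V n"
      "\<And>n. measure M (V n) = measure M W / 2 ^ Suc n" and
      D: "\<And>n. D n = V n - V (Suc n)" "\<And>n. D n \<in> sets M" "\<And>n. measure M (D n) > 0"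
      "\<And>i j. i \<noteq> j \<Longrightarrow> D i \<inter> D j = {}"
      by (rule shrinking_positive_pieces[OF finite_measure_M \<phi> levels W_sets W_pos], rule that) (assumption+)
    have Vmono: "V j \<subseteq> V i" if "i \<le> j" for i j using V(3) that by (rule lift_Suc_antimono_le)
    have null: "AE y in M. \<exists>n. y \<notin> V n"
    proof -
      have m0: "measure M (\<Inter>n. V n) \<le> measure M W / 2 ^ Suc n" for n
        using V(2) V(4)[of n] by (metis FM.finite_measure_mono INT_lower UNIV_I)
      have "(\<lambda>n. measure M W / 2 ^ Suc n) \<longlonglongrightarrow> 0"
        using LIMSEQ_Suc[OF LIMSEQ_divide_realpow_zero[of 2 "measure M W"]] by simp
      then have "measure M (\<Inter>n. V n) \<le> 0" by (rule LIMSEQ_le_const) (use m0 in blast)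
      then have "emeasure M (\<Inter>n. V n) = 0" by (simp add: FM.emeasure_eq_measure measure_le_0_iff)
      then have "AE y in M. y \<notin> (\<Inter>n. V n)" using V(2) by (intro AE_not_in) (auto simp: null_sets_def)
      then show ?thesis by eventually_elim auto
    qed
    let ?k = "\<lambda>n p. schur.ker p * indicator (V n) (snd p)"
    have ind: "(\<lambda>p. indicator (V n) (snd p) :: complex) \<in> borel_measurable M2" for n
      using V(2)[of n] by (intro measurable_snd_M2) simp
    have k_sq: "square_integrable M2 (?k n)" for n
    proof (rule square_integrable_bound)
      show "integrable M2 (\<lambda>p. (norm (schur.ker p))\<^sup>2)" using schur.square_integrable_ker by (simp add: square_integrable_def)
      show "?k n \<in> borel_measurable M2" by (rule borel_measurable_times[OF square_integrable_measurable[OF schur.square_integrable_ker] ind])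
      show "AE p in M2. (norm (?k n p))\<^sup>2 \<le> (norm (schur.ker p))\<^sup>2" by (simp add: indicator_def)
    qed
    have "(\<lambda>n. LINT p|M2. (norm (?k n p))\<^sup>2) \<longlonglongrightarrow> (LINT p|M2. (0::real))"
    proof (rule integral_dominated_convergence)
      show "integrable M2 (\<lambda>p. (norm (schur.ker p))\<^sup>2)" using schur.square_integrable_ker by (simp add: square_integrable_def)
      show "(\<lambda>p. (norm (?k n p))\<^sup>2) \<in> borel_measurable M2" for n using k_sq[of n] by (auto simp: square_integrable_def)
      show "AE p in M2. (\<lambda>n. (norm (?k n p))\<^sup>2) \<longlonglongrightarrow> 0"
        using AE_snd[OF null]
      proof eventually_elim
        case (elim p)
        then obtain n0 where "snd p \<notin> V n0" by blast
        then have "\<forall>n\<ge>n0. (norm (?k n p))\<^sup>2 = 0" using Vmono by (auto simp: indicator_def)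
        then show ?case by (intro tendsto_eventually) (auto simp: eventually_sequentially)
      qed
      show "AE p in M2. norm ((norm (?k n p))\<^sup>2) \<le> (norm (schur.ker p))\<^sup>2" for n by (simp add: indicator_def)
    qed simp
    then have "(\<lambda>n. LINT p|M2. (norm (?k n p))\<^sup>2) \<longlonglongrightarrow> 0" by simp
    then have "\<forall>\<^sub>F n in sequentially. (LINT p|M2. (norm (?k n p))\<^sup>2) < (\<beta> / 2)\<^sup>2"
      using \<beta> by (intro order_tendstoD) auto
    then obtain m where m: "(LINT p|M2. (norm (?k m p))\<^sup>2) < (\<beta> / 2)\<^sup>2"
      by (auto simp: eventually_sequentially)
    define L where "L = {cls1 f | f. sq1 f \<and> (AE x in M. x \<notin> V m \<longrightarrow> f x = 0)}"
    have LE: "\<exists>f. u = cls1 f \<and> sq1 f \<and> (AE p in M. p \<notin> V m \<longrightarrow> f p = 0)" if "u \<in> L" for u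
      using that by (auto simp: L_def)
    have D_sq: "sq1 (indicator (D n))" for n
      unfolding sq1_def by (rule square_integrable_indicator(1)[OF finite_measure_M D(2)])
    have "\<exists>x\<in>L. x \<noteq> hzero X1 \<and> (\<forall>i<N. hinner X (x, lift_class x) (b i) = 0)"
    proof (rule exists_annihilated_by_functionals[OF inner_space_X1 inner_space_X _, where u = "\<lambda>n. cls1 (indicator (D (m + n)))"])
      show "hsubspace X1 L" unfolding L_def by (rule X1_supported_subspace)
      show "cls1 (indicator (D (m + n))) \<in> L" for n
        unfolding L_def using D_sq[of "m + n"] Vmono[of m "m + n"]
        by (intro CollectI exI[of _ "indicator (D (m + n))"])
          (auto simp: D(1) indicator_def intro!: AE_I2)
      show "cls1 (indicator (D (m + n))) \<noteq> hzero X1" for n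
      proof
        assume "cls1 (indicator (D (m + n))) = hzero X1"
        then have "hinner X1 (cls1 (indicator (D (m + n)))) (cls1 (indicator (D (m + n)))) = 0"
          using X1_carrierI[OF D_sq[of "m + n"]] inner_space.inner_zero[OF inner_space_X1] by metis
        then show False
          using D(3)[of "m + n"] square_integrable_indicator(2)[OF finite_measure_M D(2)[of "m + n"]]
          unfolding X1_inner[OF D_sq D_sq] inner_self1[OF D_sq] by simp
      qed
      show "hinner X1 (cls1 (indicator (D (m + i)))) (cls1 (indicator (D (m + j)))) = 0" if "i \<noteq> j" for i j
        unfolding X1_inner[OF D_sq D_sq] by (rule integral_indicator_disjoint[OF D(4)]) (use that in simp)
      show "(hzero X1, lift_class (hzero X1)) = hzero X"
      proof -
        have "lift (\<lambda>_. 0) = (\<lambda>_. 0)" by (simp add: lift_def creat_def creat0_def fun_eq_iff)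
        then show ?thesis unfolding X_zero using lift_class[OF zero_sq(1)] by (simp add: X1_eq L2_zero)
      qed
    next
      fix x y k assume "x \<in> L"
      then obtain f where f: "x = cls1 f" "sq1 f" using LE by blast
      show "(x, lift_class x) \<in> hcarrier X"
        unfolding f(1) lift_class[OF f(2)] by (intro X_carrierI sq2_lift f(2))
      have "lift_class (hscale X1 k x) = hscale X2 k (lift_class x)"
        unfolding f(1) X1_scale[OF f(2)] lift_class[OF f(2)] lift_class[OF sq1_scale[OF f(2)]] X2_scale[OF sq2_lift[OF f(2)]]
        by (simp add: lift_scale[abs_def])
      then show "(hscale X1 k x, lift_class (hscale X1 k x)) = hscale X k (x, lift_class x)" by (simp add: hsum_def)
      assume "y \<in> L"
      then obtain g where g: "y = cls1 g" "sq1 g" using LE by blast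
      have "lift_class (hadd X1 x y) = hadd X2 (lift_class x) (lift_class y)"
        unfolding f(1) g(1) X1_add[OF f(2) g(2)] lift_class[OF f(2)] lift_class[OF g(2)]
          lift_class[OF sq1_add[OF f(2) g(2)]] X2_add[OF sq2_lift[OF f(2)] sq2_lift[OF g(2)]]
        by (simp add: lift_add[abs_def])
      then show "(hadd X1 x y, lift_class (hadd X1 x y)) = hadd X (x, lift_class x) (y, lift_class y)"
        by (simp add: hsum_def)
    qed (rule b)
    then obtain x where x: "x \<in> L" "x \<noteq> hzero X1" "\<forall>i<N. hinner X (x, lift_class x) (b i) = 0" by blast
    obtain f where f0: "x = cls1 f" "sq1 f" "AE p in M. p \<notin> V m \<longrightarrow> f p = 0" using LE[OF x(1)] by blast
    note f = f0(2,3) x(2)[unfolded f0(1)] x(3)[unfolded f0(1) lift_class[OF f0(2)]]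
    define nf where "nf = (LINT x|M. (norm (f x))\<^sup>2)"
    have fs: "square_integrable M f" using f(1) by (simp add: sq1_def)
    have nf0: "0 \<le> nf" by (simp add: nf_def)
    have fi: "integrable M (\<lambda>p. (norm (f p))\<^sup>2)" using fs by (simp add: square_integrable_def)
    have e1: "(LINT x|M. \<Delta> x * (norm (f x))\<^sup>2) \<le> \<beta> * nf"
    proof -
      have "(LINT x|M. \<Delta> x * (norm (f x))\<^sup>2) \<le> (LINT x|M. \<beta> * (norm (f x))\<^sup>2)"
      proof (rule integral_mono_AE)
        show "integrable M (\<lambda>x. \<Delta> x * (norm (f x))\<^sup>2)"
          by (rule schur.bounded_weight_integrable[OF fs Delta_measurable Delta_bound])
        show "AE x in M. \<Delta> x * (norm (f x))\<^sup>2 \<le> \<beta> * (norm (f x))\<^sup>2"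
          using f(2)
        proof eventually_elim
          case (elim x)
          then show ?case by (cases "x \<in> V m") (auto simp: V(1) W_def intro!: mult_right_mono)
        qed
      qed (use fi in simp)
      then show ?thesis by (simp add: nf_def)
    qed
    have e2: "Re (LINT p|M2. schur.ker p * (f (snd p) * cnj (f (fst p)))) \<le> \<beta> / 2 * nf"
    proof -
      let ?I = "\<lambda>x. LINT y|M. ?k m (x, y) * f y"
      note HS = Hilbert_Schmidt_integral[OF k_sq[of m] fs]
      have kt: "integrable M2 (\<lambda>p. k p * (f (snd p) * cnj (f (fst p))))" if "square_integrable M2 k" for k
        using that fs square_integrable_tensor[OF fs, of "\<lambda>x. cnj (f x)"]
        by (intro square_integrable_mult_integrable) (auto simp: square_integrable_cnj)
      have "(LINT p|M2. schur.ker p * (f (snd p) * cnj (f (fst p)))) = (LINT p|M2. ?k m p * (f (snd p) * cnj (f (fst p))))"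
      proof (rule integral_cong_AE)
        show "AE p in M2. schur.ker p * (f (snd p) * cnj (f (fst p))) = ?k m p * (f (snd p) * cnj (f (fst p)))"
          using AE_snd[OF f(2)] by eventually_elim (auto simp: indicator_def)
      qed (use kt[OF k_sq[of m]] kt[OF schur.square_integrable_ker] in auto)
      also have "\<dots> = (LINT x|M. ?I x * cnj (f x))" using HS(4)[OF fs] by simp
      finally have eq: "(LINT p|M2. schur.ker p * (f (snd p) * cnj (f (fst p)))) = (LINT x|M. ?I x * cnj (f x))" .
      have "(norm (LINT x|M. ?I x * cnj (f x)))\<^sup>2 \<le> (LINT x|M. (norm (?I x))\<^sup>2) * nf"
        unfolding nf_def by (rule L2_Cauchy_Schwarz[OF HS(2) fs])
      also have "\<dots> \<le> ((LINT p|M2. (norm (?k m p))\<^sup>2) * nf) * nf"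
        using HS(3) nf0 unfolding nf_def by (intro mult_right_mono) auto
      also have "\<dots> \<le> ((\<beta> / 2)\<^sup>2 * nf) * nf"
        using m nf0 by (intro mult_right_mono) auto
      also have "\<dots> = (\<beta> / 2 * nf)\<^sup>2" by (simp add: power2_eq_square)
      finally have "norm (LINT x|M. ?I x * cnj (f x)) \<le> \<beta> / 2 * nf"
        by (rule power2_le_imp_le) (use \<beta> nf0 in simp)
      then show ?thesis unfolding eq by (rule order_trans[OF complex_Re_le_cmod])
    qed
    have "(c - z) * Re (hinner X (cls1 f, cls2 (lift f)) (cls1 f, cls2 (lift f))) \<le> eff_form f"
      using form[OF f(1) sq2_lift[OF f(1)] f(4)] form_schur_lift[OF f(1)] by (simp add: left_diff_distrib)
    also have "\<dots> \<le> \<beta> * nf + \<beta> / 2 * nf" unfolding eff_form_def using e1 e2 by linarith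
    finally have "(c - z) * Re (hinner X (cls1 f, cls2 (lift f)) (cls1 f, cls2 (lift f))) \<le> \<beta> * nf + \<beta> / 2 * nf" .
    moreover have "Re (hinner X (cls1 f, cls2 (lift f)) (cls1 f, cls2 (lift f))) \<ge> nf"
      unfolding X_inner[OF f(1) sq2_lift[OF f(1)] f(1) sq2_lift[OF f(1)]] inner_self1[OF f(1)] inner_self2
      by (simp add: nf_def)
    then have "(c - z) * nf \<le> (c - z) * Re (hinner X (cls1 f, cls2 (lift f)) (cls1 f, cls2 (lift f)))"
      using c by (intro mult_left_mono) auto
    ultimately have "(c - z) * nf \<le> \<beta> * nf + \<beta> / 2 * nf" by linarith
    moreover have "c - z = 2 * \<beta>" by (simp add: \<beta>_def)
    ultimately have "2 * \<beta> * nf \<le> \<beta> * nf + \<beta> / 2 * nf" by (simp only:)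
    then have "\<beta> * nf \<le> 0" by simp
    then have "nf \<le> 0" using \<beta> by (simp add: mult_le_0_iff)
    then have "cls1 f = hzero X1" unfolding X1_eq nf_def by (rule L2_class_eq_zero[OF fs])
    then show False using f(3) by simp
  qed
  then show ?thesis using \<beta> by blast
qed

end

section \<open>The Birman-Schwinger operator\<close>

locale cube_effective = cube_schur a v Cv w1 w2 C1 C2 z \<delta>
  for a :: real and v :: "('n::finite) pt2 \<Rightarrow> complex" and Cv w1 w2 C1 C2 z \<delta> +
  fixes \<beta> :: real
  assumes \<beta>_pos: "0 < \<beta>" and Delta_ge: "AE x in cube_measure a. \<beta> \<le> Delta a w1 w2 v z x"
begin

abbreviation kT where "kT \<equiv> kernel_T a w1 w2 v z"
abbreviation opT where "opT \<equiv> op_T a w1 w2 v z"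

definition rt :: "'n pt \<Rightarrow> real" where "rt x = \<Delta> x powr (1 / 2)"
definition irt :: "'n pt \<Rightarrow> real" where "irt x = \<Delta> x powr (- 1 / 2)"

lemma rt_irt: "AE x in M. 0 < \<Delta> x \<and> rt x * irt x = 1 \<and> (rt x)\<^sup>2 = \<Delta> x \<and> 0 \<le> irt x \<and> irt x \<le> \<beta> powr (- 1 / 2)"
  using Delta_ge
proof eventually_elim
  case (elim x)
  then have p: "0 < \<Delta> x" using \<beta>_pos by simp
  have "rt x * irt x = \<Delta> x powr (1 / 2 + - 1 / 2)" unfolding rt_def irt_def by (rule powr_add[symmetric])
  then have "rt x * irt x = 1" using p by simp
  moreover have "(rt x)\<^sup>2 = \<Delta> x powr (1 / 2 + 1 / 2)" unfolding rt_def power2_eq_square by (rule powr_add[symmetric])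
  then have "(rt x)\<^sup>2 = \<Delta> x" using p by simp
  moreover have "irt x \<le> \<beta> powr (- 1 / 2)" unfolding irt_def using elim \<beta>_pos by (intro powr_mono2') auto
  ultimately show ?case using p by (simp add: irt_def)
qed

lemma rt_measurable: "rt \<in> borel_measurable M" "irt \<in> borel_measurable M"
  unfolding rt_def[abs_def] irt_def[abs_def] using Delta_measurable by measurable

lemma rt_bound: "AE x in M. \<bar>rt x\<bar> \<le> sqrt (C1 + \<bar>z\<bar> + Cv / \<delta>)"
  using rt_irt Delta_bound
proof eventually_elim
  case (elim x)
  then have "(rt x)\<^sup>2 \<le> C1 + \<bar>z\<bar> + Cv / \<delta>" by auto
  then show ?case by (metis real_sqrt_abs real_sqrt_le_iff)
qed

lemma irt_bound: "AE x in M. \<bar>irt x\<bar> \<le> \<beta> powr (- 1 / 2)"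
  using rt_irt by eventually_elim auto

lemma sq1_rt: "sq1 f \<Longrightarrow> sq1 (\<lambda>x. of_real (rt x) * f x)"
  unfolding sq1_def using rt_measurable(1) rt_bound by (rule square_integrable_bounded_mult[rotated])

lemma sq1_irt: "sq1 f \<Longrightarrow> sq1 (\<lambda>x. of_real (irt x) * f x)"
  unfolding sq1_def using rt_measurable(2) irt_bound by (rule square_integrable_bounded_mult[rotated])

lemma kT_eq: "kT p = - (of_real (irt (fst p)) * schur.ker p * of_real (irt (snd p)))"
  unfolding kernel_T_def kernel_K_eq irt_def by (cases p) simp

lemma square_integrable_kT: "square_integrable M2 kT"
proof -
  have m: "(\<lambda>p. irt (fst p)) \<in> borel_measurable M2" "(\<lambda>p. irt (snd p)) \<in> borel_measurable M2"
    using measurable_fst_M2[of "\<lambda>x. of_real (irt x)"] measurable_snd_M2[of "\<lambda>x. of_real (irt x)"] rt_measurable(2)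
    by (simp_all add: borel_measurable_complex_iff)
  have "square_integrable M2 (\<lambda>p. of_real (- irt (fst p)) * (of_real (irt (snd p)) * schur.ker p))"
  proof (intro square_integrable_bounded_mult schur.square_integrable_ker)
    show "AE p in M2. \<bar>irt (snd p)\<bar> \<le> \<beta> powr (- 1 / 2)" by (rule AE_snd[OF irt_bound])
    show "AE p in M2. \<bar>- irt (fst p)\<bar> \<le> \<beta> powr (- 1 / 2)" using AE_fst[OF irt_bound] by simp
  qed (use m in auto)
  moreover have "kT = (\<lambda>p. of_real (- irt (fst p)) * (of_real (irt (snd p)) * schur.ker p))"
    unfolding kT_eq[abs_def] by (simp add: fun_eq_iff mult_ac)
  ultimately show ?thesis by simp
qed

lemma kernel_integrals_converge: "integral_op_defined M kT"
  unfolding integral_op_defined_def using Hilbert_Schmidt_integral(1)[OF square_integrable_kT] by blast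

definition Tf :: "('n pt \<Rightarrow> complex) \<Rightarrow> 'n pt \<Rightarrow> complex" where
  "Tf f x = (LINT y|M. kT (x, y) * f y)"

lemma sq1_Tf: "sq1 f \<Longrightarrow> sq1 (Tf f)"
  unfolding sq1_def Tf_def[abs_def] by (rule Hilbert_Schmidt_integral(2)[OF square_integrable_kT])

lemma opT_class:
  assumes "sq1 f" shows "opT (cls1 f) = cls1 (Tf f)"
  unfolding op_T_def integral_op_def
proof (rule L2_class_cong)
  note f = assms[unfolded sq1_def]
  note r = L2_rep_class[OF f]
  show "AE x in M. (LINT y|M. kT (x, y) * L2_rep (cls1 f) y) = Tf f x"
    using Hilbert_Schmidt_integral(1)[OF square_integrable_kT f] Hilbert_Schmidt_integral(1)[OF square_integrable_kT r(1)]
  proof eventually_elim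
    case (elim x)
    show ?case
      unfolding Tf_def using elim r(2) by (intro integral_cong_AE borel_measurable_integrable) auto
  qed
qed

lemma bounded_op_opT: "bounded_op X1 X1 opT"
  unfolding bounded_op_def
proof (intro conjI ballI allI)
  fix u assume "u \<in> hcarrier X1"
  then obtain f where f: "sq1 f" "u = cls1 f" by (rule X1_carrierE)
  show "opT u \<in> hcarrier X1" unfolding f opT_class[OF f(1)] by (intro X1_carrierI sq1_Tf f)
  show "opT (hscale X1 k u) = hscale X1 k (opT u)" for k
    unfolding f opT_class[OF f(1)] X1_scale[OF f(1)] X1_scale[OF sq1_Tf[OF f(1)]] opT_class[OF sq1_scale[OF f(1)]]
    by (rule arg_cong[of _ _ cls1]) (simp add: Tf_def mult_ac fun_eq_iff)
  fix w assume "w \<in> hcarrier X1"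
  then obtain g where g: "sq1 g" "w = cls1 g" by (rule X1_carrierE)
  show "opT (hadd X1 u w) = hadd X1 (opT u) (opT w)"
    unfolding f g opT_class[OF f(1)] opT_class[OF g(1)] X1_add[OF f(1) g(1)] X1_add[OF sq1_Tf[OF f(1)] sq1_Tf[OF g(1)]]
      opT_class[OF sq1_add[OF f(1) g(1)]]
  proof (rule L2_class_cong)
    show "AE x in M. Tf (\<lambda>x. f x + g x) x = Tf f x + Tf g x"
      using Hilbert_Schmidt_integral(1)[OF square_integrable_kT f(1)[unfolded sq1_def]]
        Hilbert_Schmidt_integral(1)[OF square_integrable_kT g(1)[unfolded sq1_def]]
      by eventually_elim (simp add: Tf_def distrib_left)
  qed
next
  show "\<exists>K. \<forall>u\<in>hcarrier X1. hnorm X1 (opT u) \<le> K * hnorm X1 u"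
  proof (intro exI ballI)
    fix u assume "u \<in> hcarrier X1"
    then obtain f where f: "sq1 f" "u = cls1 f" by (rule X1_carrierE)
    have "(hnorm X1 (opT u))\<^sup>2 \<le> (LINT p|M2. (norm (kT p))\<^sup>2) * (hnorm X1 u)\<^sup>2"
      unfolding f opT_class[OF f(1)] hnorm_X1[OF f(1)] hnorm_X1[OF sq1_Tf[OF f(1)]] Tf_def
      by (rule Hilbert_Schmidt_integral(3)[OF square_integrable_kT f(1)[unfolded sq1_def]])
    then have "(hnorm X1 (opT u))\<^sup>2 \<le> (sqrt (LINT p|M2. (norm (kT p))\<^sup>2) * hnorm X1 u)\<^sup>2"
      by (simp add: power_mult_distrib)
    then show "hnorm X1 (opT u) \<le> sqrt (LINT p|M2. (norm (kT p))\<^sup>2) * hnorm X1 u"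
      by (rule power2_le_imp_le) (use inner_space.inner_self_nonneg[OF inner_space_X1 X1_carrierI[OF f(1)]] f in \<open>simp add: hnorm_def\<close>)
  qed
qed

lemma hilbert_schmidt_opT: "hilbert_schmidt X1 opT"
  unfolding hilbert_schmidt_def
proof (intro conjI bounded_op_opT)
  obtain E where E: "orthonormal_basis X1 E"
    using inner_space.orthonormal_basis_exists[OF inner_space_X1] by blast
  have EC: "E \<subseteq> hcarrier X1" and on: "\<And>e f. \<lbrakk>e \<in> E; f \<in> E\<rbrakk> \<Longrightarrow> hinner X1 e f = (if e = f then 1 else 0)"
    using E unfolding orthonormal_basis_def by blast+
  have "\<forall>e\<in>E. \<exists>f. sq1 f \<and> e = cls1 f"
    using EC X1_carrierE by (metis subsetD)
  then obtain rep where rep: "\<And>e. e \<in> E \<Longrightarrow> sq1 (rep e)" "\<And>e. e \<in> E \<Longrightarrow> e = cls1 (rep e)" by metis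
  have "(\<lambda>e. (hnorm X1 (opT e))\<^sup>2) summable_on E"
  proof (rule nonneg_bounded_partial_sums_imp_summable_on)
    have "sum (\<lambda>e. (hnorm X1 (opT e))\<^sup>2) F \<le> (LINT p|M2. (norm (kT p))\<^sup>2)" if F: "finite F" "F \<subseteq> E" for F
    proof -
      have "(hnorm X1 (opT e))\<^sup>2 = (LINT x|M. (norm (LINT y|M. kT (x, y) * rep e y))\<^sup>2)" if "e \<in> F" for e
      proof -
        have e: "sq1 (rep e)" "e = cls1 (rep e)" using rep that F by auto
        have "opT e = cls1 (Tf (rep e))" using opT_class[OF e(1)] e(2) by simp
        then show ?thesis using hnorm_X1[OF sq1_Tf[OF e(1)]] by (simp add: Tf_def)
      qed
      then have "sum (\<lambda>e. (hnorm X1 (opT e))\<^sup>2) F = (\<Sum>e\<in>F. LINT x|M. (norm (LINT y|M. kT (x, y) * rep e y))\<^sup>2)"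
        by (intro sum.cong) auto
      also have "\<dots> \<le> (LINT p|M2. (norm (kT p))\<^sup>2)"
      proof (rule Hilbert_Schmidt_basis_sum[OF square_integrable_kT F(1)])
        show "square_integrable M (rep i)" if "i \<in> F" for i using rep(1)[of i] that F by (auto simp: sq1_def)
        show "(LINT x|M. rep i x * cnj (rep j x)) = (if i = j then 1 else 0)" if "i \<in> F" "j \<in> F" for i j
        proof -
          have ij: "i \<in> E" "j \<in> E" using that F by auto
          show ?thesis
            unfolding X1_inner[OF rep(1)[OF ij(1)] rep(1)[OF ij(2)], symmetric] rep(2)[OF ij(1), symmetric] rep(2)[OF ij(2), symmetric]
            by (rule on[OF ij])
        qed
      qed
      finally show ?thesis .
    qed
    then show "\<forall>\<^sub>F F in finite_subsets_at_top E. sum (\<lambda>e. (hnorm X1 (opT e))\<^sup>2) F \<le> (LINT p|M2. (norm (kT p))\<^sup>2)"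
      by (intro eventually_finite_subsets_at_top_weakI) auto
  qed simp
  then show "\<exists>E. orthonormal_basis X1 E \<and> (\<lambda>e. (hnorm X1 (opT e))\<^sup>2) summable_on E"
    using E by blast
qed

definition qT :: "('n pt \<Rightarrow> complex) set \<Rightarrow> real" where
  "qT u = 1 * (hnorm X1 u)\<^sup>2 - Re (hinner X1 (opT u) u)"

definition qA :: "('n pt \<Rightarrow> complex) set \<times> ('n pt2 \<Rightarrow> complex) set \<Rightarrow> real" where
  "qA u = Re (hinner X (opA u) u) - z * (hnorm X u)\<^sup>2"

text \<open>
  The factors \<open>\<Delta>\<^sup>-\<^sup>1\<^sup>/\<^sup>2\<close> in the kernel of \<open>T\<close> cancel the substitution \<open>g = \<Delta>\<^sup>1\<^sup>/\<^sup>2 f\<close>.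
\<close>

lemma qT_rt:
  assumes f: "sq1 f"
  shows "qT (cls1 (\<lambda>x. of_real (rt x) * f x)) = eff_form f"
proof -
  let ?g = "\<lambda>x. of_real (rt x) * f x"
  note g = sq1_rt[OF f] and gs = sq1_rt[OF f, unfolded sq1_def] and fs = f[unfolded sq1_def]
  have n: "(hnorm X1 (cls1 ?g))\<^sup>2 = (LINT x|M. \<Delta> x * (norm (f x))\<^sup>2)"
    unfolding hnorm_X1[OF g]
  proof (rule integral_cong_AE)
    show "AE x in M. (norm (of_real (rt x) * f x))\<^sup>2 = \<Delta> x * (norm (f x))\<^sup>2"
      using rt_irt by eventually_elim (auto simp: norm_mult power_mult_distrib)
    show "(\<lambda>x. (norm (?g x))\<^sup>2) \<in> borel_measurable M" using gs by (auto simp: square_integrable_def)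
    show "(\<lambda>x. \<Delta> x * (norm (f x))\<^sup>2) \<in> borel_measurable M"
      by (rule borel_measurable_integrable[OF schur.bounded_weight_integrable[OF fs Delta_measurable Delta_bound]])
  qed
  have kt: "integrable M2 (\<lambda>p. k p * (h (snd p) * cnj (h (fst p))))" if "square_integrable M2 k" "square_integrable M h" for k h
    using that square_integrable_tensor[OF that(2), of "\<lambda>x. cnj (h x)"]
    by (intro square_integrable_mult_integrable) (auto simp: square_integrable_cnj)
  have "hinner X1 (opT (cls1 ?g)) (cls1 ?g) = (LINT p|M2. kT p * (?g (snd p) * cnj (?g (fst p))))"
    unfolding opT_class[OF g] X1_inner[OF sq1_Tf[OF g] g] Tf_def
    by (rule Hilbert_Schmidt_integral(4)[OF square_integrable_kT gs gs])
  also have "\<dots> = (LINT p|M2. - (schur.ker p * (f (snd p) * cnj (f (fst p)))))"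
  proof (rule integral_cong_AE)
    show "AE p in M2. kT p * (?g (snd p) * cnj (?g (fst p))) = - (schur.ker p * (f (snd p) * cnj (f (fst p))))"
      using AE_fst[OF rt_irt] AE_snd[OF rt_irt]
    proof eventually_elim
      case (elim p)
      have 1: "complex_of_real (rt (fst p)) * of_real (irt (fst p)) = 1" "complex_of_real (rt (snd p)) * of_real (irt (snd p)) = 1"
        using elim by (simp_all flip: of_real_mult)
      have "kT p * (?g (snd p) * cnj (?g (fst p)))
          = - ((of_real (rt (fst p)) * of_real (irt (fst p))) * (of_real (rt (snd p)) * of_real (irt (snd p)))
            * (schur.ker p * (f (snd p) * cnj (f (fst p)))))"
        unfolding kT_eq by (simp add: mult_ac)
      then show ?case unfolding 1 by simp
    qed
    show "(\<lambda>p. kT p * (?g (snd p) * cnj (?g (fst p)))) \<in> borel_measurable M2"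
      by (rule borel_measurable_integrable[OF kt[OF square_integrable_kT gs]])
    show "(\<lambda>p. - (schur.ker p * (f (snd p) * cnj (f (fst p))))) \<in> borel_measurable M2"
      by (rule borel_measurable_integrable[OF Bochner_Integration.integrable_minus[OF kt[OF schur.square_integrable_ker fs]]])
  qed
  finally have "hinner X1 (opT (cls1 ?g)) (cls1 ?g) = - (LINT p|M2. schur.ker p * (f (snd p) * cnj (f (fst p))))"
    by simp
  then show ?thesis unfolding qT_def n eff_form_def by simp
qed

lemma qA_class:
  assumes "sq1 g" "sq2 f"
  shows "qA (cls1 g, cls2 f) = Re (hinner X (opA (cls1 g, cls2 f)) (cls1 g, cls2 f))
    - z * Re (hinner X (cls1 g, cls2 f) (cls1 g, cls2 f))"
  unfolding qA_def using inner_space.hnorm_sq[OF inner_space_X X_carrierI[OF assms]] by simp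

lemma mult_op_linear:
  assumes "\<forall>f. sq1 f \<longrightarrow> sq1 (\<lambda>x. of_real (w x) * f x)" "sq1 f" "sq1 g"
  shows "mult_op M w (cls1 f) = cls1 (\<lambda>x. of_real (w x) * f x)"
    and "mult_op M w (hadd X1 (cls1 f) (cls1 g)) = hadd X1 (mult_op M w (cls1 f)) (mult_op M w (cls1 g))"
    and "mult_op M w (hscale X1 c (cls1 f)) = hscale X1 c (mult_op M w (cls1 f))"
proof -
  have m: "mult_op M w (cls1 f) = cls1 (\<lambda>x. of_real (w x) * f x)" if "sq1 f" for f
    using that unfolding sq1_def by (rule mult_op_class)
  show "mult_op M w (cls1 f) = cls1 (\<lambda>x. of_real (w x) * f x)" by (rule m[OF assms(2)])
  show "mult_op M w (hadd X1 (cls1 f) (cls1 g)) = hadd X1 (mult_op M w (cls1 f)) (mult_op M w (cls1 g))"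
    unfolding X1_add[OF assms(2,3)] m[OF assms(2)] m[OF assms(3)] m[OF sq1_add[OF assms(2,3)]]
      X1_add[OF assms(1)[rule_format, OF assms(2)] assms(1)[rule_format, OF assms(3)]] by (simp add: distrib_left)
  show "mult_op M w (hscale X1 c (cls1 f)) = hscale X1 c (mult_op M w (cls1 f))"
    unfolding X1_scale[OF assms(2)] m[OF assms(2)] m[OF sq1_scale[OF assms(2)]] X1_scale[OF assms(1)[rule_format, OF assms(2)]]
    by (simp add: mult_ac)
qed

text \<open>
  The map \<open>(f, h) \<mapsto> \<Delta>\<^sup>1\<^sup>/\<^sup>2 f\<close> preserves negativity because dropping the square lowers the form.
\<close>

lemma qA_le_qT: "neg_index X qA \<le> neg_index X1 qT"
proof (rule neg_index_le[OF inner_space_X inner_space_X1, where \<Phi> = "\<lambda>u. mult_op M rt (fst u)"])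
  have "\<forall>f. sq1 f \<longrightarrow> sq1 (\<lambda>x. of_real (rt x) * f x)" using sq1_rt by blast
  note lin = mult_op_linear[OF this]
  show "qT (hzero X1) = 0"
    using inner_space.ip_zero_right[OF inner_space_X1] inner_space.zero_closed[OF inner_space_X1] bounded_op_opT
    by (simp add: qT_def hnorm_def bounded_op_def inner_space.inner_zero[OF inner_space_X1])
  show "mult_op M rt (fst (hzero X)) = hzero X1"
    unfolding X_zero using lin(1)[OF zero_sq(1) zero_sq(1)] by (simp add: X1_zero)
  fix u assume "u \<in> hcarrier X"
  then obtain g f where u: "sq1 g" "sq2 f" "u = (cls1 g, cls2 f)" by (rule X_carrierE)
  have fu: "mult_op M rt (fst u) = cls1 (\<lambda>x. of_real (rt x) * g x)" using lin(1)[OF u(1,1)] u(3) by simp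
  show "mult_op M rt (fst u) \<in> hcarrier X1" unfolding fu by (intro X1_carrierI sq1_rt u)
  show "mult_op M rt (fst (hscale X c u)) = hscale X1 c (mult_op M rt (fst u))" for c
    using lin(3)[OF u(1,1)] u(3) by (simp add: hsum_def)
  show "qT (mult_op M rt (fst u)) < 0" if "qA u < 0"
  proof -
    have "qA u = Re (hinner X (opA (cls1 g, cls2 f)) (cls1 g, cls2 f))
        - z * Re (hinner X (cls1 g, cls2 f) (cls1 g, cls2 f))"
      unfolding u(3) by (rule qA_class[OF u(1,2)])
    then show ?thesis using that form_schur_ge[OF u(1,2)] unfolding fu qT_rt[OF u(1)] by linarith
  qed
  fix w assume "w \<in> hcarrier X"
  then obtain g' f' where w: "sq1 g'" "sq2 f'" "w = (cls1 g', cls2 f')" by (rule X_carrierE)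
  show "mult_op M rt (fst (hadd X u w)) = hadd X1 (mult_op M rt (fst u)) (mult_op M rt (fst w))"
    using lin(2)[OF u(1) w(1)] u(3) w(3) by (simp add: hsum_def)
qed

text \<open>
  The map \<open>g \<mapsto> (f, lift f)\<close> with \<open>f = \<Delta>\<^sup>-\<^sup>1\<^sup>/\<^sup>2 g\<close> preserves negativity because \<open>lift f\<close> makes the square vanish.
\<close>

lemma qT_le_qA: "neg_index X1 qT \<le> neg_index X qA"
proof (rule neg_index_le[OF inner_space_X1 inner_space_X, where \<Phi> = "\<lambda>u. (mult_op M irt u, lift_class (mult_op M irt u))"])
  have "\<forall>f. sq1 f \<longrightarrow> sq1 (\<lambda>x. of_real (irt x) * f x)" using sq1_irt by blast
  note lin = mult_op_linear[OF this]
  have lift0: "lift_class (cls1 (\<lambda>_. 0)) = cls2 (\<lambda>_. 0)"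
    unfolding lift_class[OF zero_sq(1)] by (simp add: lift_def[abs_def] creat_def creat0_def)
  show "qA (hzero X) = 0"
    using inner_space.ip_zero_right[OF inner_space_X symm_op.A_closed[OF symm_op_X inner_space.zero_closed[OF inner_space_X]]]
      inner_space.inner_zero[OF inner_space_X inner_space.zero_closed[OF inner_space_X]]
    by (simp add: qA_def hnorm_def)
  show "(mult_op M irt (hzero X1), lift_class (mult_op M irt (hzero X1))) = hzero X"
    unfolding X_zero X1_zero using lin(1)[OF zero_sq(1) zero_sq(1)] lift0 by simp
  fix u assume "u \<in> hcarrier X1"
  then obtain g where u: "sq1 g" "u = cls1 g" by (rule X1_carrierE)
  let ?f = "\<lambda>x. of_real (irt x) * g x"
  have fu: "mult_op M irt u = cls1 ?f" using lin(1)[OF u(1,1)] u(2) by simp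
  note f = sq1_irt[OF u(1)]
  show "(mult_op M irt u, lift_class (mult_op M irt u)) \<in> hcarrier X"
    unfolding fu lift_class[OF f] by (intro X_carrierI f sq2_lift)
  have scale: "lift_class (hscale X1 c (cls1 h)) = hscale X2 c (lift_class (cls1 h))" if "sq1 h" for h c
    unfolding X1_scale[OF that] lift_class[OF that] lift_class[OF sq1_scale[OF that]] X2_scale[OF sq2_lift[OF that]]
    by (simp add: lift_scale[abs_def])
  show "(mult_op M irt (hscale X1 c u), lift_class (mult_op M irt (hscale X1 c u)))
      = hscale X c (mult_op M irt u, lift_class (mult_op M irt u))" for c
    using lin(3)[OF u(1,1), of c] scale[OF f, of c] unfolding u(2)[symmetric] fu by (simp add: hsum_def)
  show "qA (mult_op M irt u, lift_class (mult_op M irt u)) < 0" if "qT u < 0"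
  proof -
    have "cls1 (\<lambda>x. of_real (rt x) * ?f x) = cls1 g"
    proof (rule L2_class_cong)
      show "AE x in M. of_real (rt x) * (of_real (irt x) * g x) = g x"
        using rt_irt
      proof eventually_elim
        case (elim x)
        then have "complex_of_real (rt x) * of_real (irt x) = 1" by (simp flip: of_real_mult)
        then show ?case by (simp add: mult.assoc[symmetric])
      qed
    qed
    then have "eff_form ?f = qT u" using qT_rt[OF f] u(2) by simp
    then show ?thesis
      using that form_schur_lift[OF f] unfolding fu lift_class[OF f] qA_class[OF f sq2_lift[OF f]] by linarith
  qed
  fix w assume "w \<in> hcarrier X1"
  then obtain g' where w: "sq1 g'" "w = cls1 g'" by (rule X1_carrierE)
  let ?f' = "\<lambda>x. of_real (irt x) * g' x"
  have fw: "mult_op M irt w = cls1 ?f'" using lin(1)[OF w(1,1)] w(2) by simp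
  note f' = sq1_irt[OF w(1)]
  have "lift_class (hadd X1 (cls1 ?f) (cls1 ?f')) = hadd X2 (lift_class (cls1 ?f)) (lift_class (cls1 ?f'))"
    unfolding X1_add[OF f f'] lift_class[OF f] lift_class[OF f'] lift_class[OF sq1_add[OF f f']]
      X2_add[OF sq2_lift[OF f] sq2_lift[OF f']]
    by (simp add: lift_add[abs_def])
  then show "(mult_op M irt (hadd X1 u w), lift_class (mult_op M irt (hadd X1 u w)))
      = hadd X (mult_op M irt u, lift_class (mult_op M irt u)) (mult_op M irt w, lift_class (mult_op M irt w))"
    using lin(2)[OF u(1) w(1)] unfolding u(2)[symmetric] w(2)[symmetric] fu fw by (simp add: hsum_def)
qed

lemma eigenvalue_count_eq_form_count:
  "eigenvalue_count X z opA = form_count X1 1 opT"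
proof -
  have "eigenvalue_count X z opA = neg_index X qA"
    using spectral.eigenvalue_count_eq_neg_index unfolding qA_def[abs_def] .
  also have "\<dots> = neg_index X1 qT" using qA_le_qT qT_le_qA by (rule antisym)
  also have "\<dots> = form_count X1 1 opT" unfolding form_count_eq_neg_index qT_def[abs_def] ..
  finally show ?thesis .
qed

end

lemma nn_integral_powr_le_of_Lp_norm:
  assumes "Lp_norm p M f \<le> c" "c < \<infinity>" "0 < p"
  shows "(\<integral>\<^sup>+x. ennreal (norm (f x) powr p) \<partial>M) \<le> ennreal (enn2real c powr p)"
proof -
  let ?I = "\<integral>\<^sup>+x. ennreal (norm (f x) powr p) \<partial>M"
  have "?I \<noteq> \<infinity>" using assms(1,2) by (auto simp: Lp_norm_def Let_def)
  then have I: "?I = ennreal (enn2real ?I)" by (simp add: less_top)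
  have "ennreal (enn2real ?I powr (1 / p)) \<le> ennreal (enn2real c)"
    using assms(1,2) \<open>?I \<noteq> \<infinity>\<close> by (simp add: Lp_norm_def Let_def)
  then have le: "enn2real ?I powr (1 / p) \<le> enn2real c" by (subst (asm) ennreal_le_iff) auto
  have "enn2real ?I = (enn2real ?I powr (1 / p)) powr p" using assms(3) by (simp add: powr_powr)
  also have "\<dots> \<le> enn2real c powr p" using le assms(3) by (intro powr_mono2) auto
  finally show ?thesis using I by (metis ennreal_leI)
qed

lemma AE_section_powr_bound:
  assumes "esssup N (\<lambda>x. Lp_norm p M (f x)) < \<infinity>" "0 < p"
  obtains c where "0 \<le> c" "AE x in N. (\<integral>\<^sup>+y. ennreal (norm (f x y) powr p) \<partial>M) \<le> ennreal c"
proof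
  show "0 \<le> enn2real (esssup N (\<lambda>x. Lp_norm p M (f x))) powr p" by simp
  show "AE x in N. (\<integral>\<^sup>+y. ennreal (norm (f x y) powr p) \<partial>M) \<le> ennreal (enn2real (esssup N (\<lambda>x. Lp_norm p M (f x))) powr p)"
    using esssup_AE[of "\<lambda>x. Lp_norm p M (f x)" N]
    by eventually_elim (rule nn_integral_powr_le_of_Lp_norm[OF _ assms])
qed

text \<open>
  Young's inequality for the conjugate exponents \<open>1 + \<epsilon>/2\<close> and \<open>1 + 2/\<epsilon>\<close>; this is where the two
  integrability exponents of the coupling fit together.
\<close>

lemma square_mult_le_powr:
  fixes s t \<epsilon> :: real
  assumes "0 \<le> s" "0 \<le> t" "0 < \<epsilon>"
  shows "(s * t)\<^sup>2 \<le> s powr (2 + \<epsilon>) + t powr (2 + 4 / \<epsilon>)"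
proof -
  let ?p = "1 + \<epsilon> / 2" and ?q = "1 + 2 / \<epsilon>"
  have conj1: "1 / ?p = 2 / (2 + \<epsilon>)" using assms(3) by (simp add: field_simps)
  have conj2: "1 / ?q = \<epsilon> / (2 + \<epsilon>)" using assms(3) by (simp add: field_simps)
  have conjugate: "1 / ?p + 1 / ?q = 1"
    unfolding conj1 conj2 using assms(3) by (simp add: add_divide_distrib[symmetric])
  have "s\<^sup>2 * t\<^sup>2 \<le> (s\<^sup>2) powr ?p / ?p + (t\<^sup>2) powr ?q / ?q"
    using assms by (intro Youngs_inequality conjugate) auto
  also have "(s\<^sup>2) powr ?p = s powr (2 + \<epsilon>)"
    using assms powr_powr[of s 2 ?p] by (simp add: powr_numeral distrib_left)
  also have "(t\<^sup>2) powr ?q = t powr (2 + 4 / \<epsilon>)"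
    using assms powr_powr[of t 2 ?q] by (simp add: powr_numeral distrib_left)
  also have "s powr (2 + \<epsilon>) / ?p + t powr (2 + 4 / \<epsilon>) / ?q \<le> s powr (2 + \<epsilon>) / 1 + t powr (2 + 4 / \<epsilon>) / 1"
    using assms by (intro add_mono divide_left_mono) (auto intro: add_pos_pos)
  finally show ?thesis by (simp add: power_mult_distrib)
qed

context completed_square
begin

lemma section_square_bound:
  assumes v: "v \<in> borel_measurable M2" and p: "2 \<le> p"
    and bd: "AE x in M. (\<integral>\<^sup>+y. ennreal (norm (v (x, y) :: complex) powr p) \<partial>M) \<le> ennreal c" and c: "0 \<le> c"
  shows "AE x in M. (\<integral>\<^sup>+y. ennreal ((norm (v (x, y)))\<^sup>2) \<partial>M) \<le> ennreal (measure M (space M) + c)"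
  using bd section_measurable[OF v]
proof eventually_elim
  case (elim x)
  have sq: "(norm (v (x, y)))\<^sup>2 \<le> 1 + norm (v (x, y)) powr p" for y
  proof (cases "norm (v (x, y)) \<le> 1")
    case True
    then have "(norm (v (x, y)))\<^sup>2 \<le> 1" by (simp add: power_le_one)
    then show ?thesis by (simp add: add_increasing2)
  next
    case False
    then have "norm (v (x, y)) powr 2 \<le> norm (v (x, y)) powr p" using p by (intro powr_mono) auto
    then show ?thesis using False by (simp add: powr_numeral)
  qed
  have "(\<integral>\<^sup>+y. ennreal ((norm (v (x, y)))\<^sup>2) \<partial>M) \<le> (\<integral>\<^sup>+y. 1 + ennreal (norm (v (x, y)) powr p) \<partial>M)"
    using sq by (intro nn_integral_mono) (simp flip: ennreal_1 ennreal_plus add: ennreal_leI)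
  also have "\<dots> = emeasure M (space M) + (\<integral>\<^sup>+y. ennreal (norm (v (x, y)) powr p) \<partial>M)"
    using elim(2) by (subst nn_integral_add) auto
  also have "\<dots> \<le> ennreal (measure M (space M)) + ennreal c"
    using elim(1) finite_measure.emeasure_eq_measure[OF finite_measure_M] by (intro add_mono) auto
  also have "\<dots> = ennreal (measure M (space M) + c)" using c by (simp add: ennreal_plus)
  finally show ?case .
qed

lemma cross_square_finite:
  assumes v: "v \<in> borel_measurable M2" and \<epsilon>: "0 < \<epsilon>"
    and bd1: "AE x in M. (\<integral>\<^sup>+y. ennreal (norm (v (x, y) :: complex) powr (2 + \<epsilon>)) \<partial>M) \<le> ennreal c1"
    and bd2: "AE y in M. (\<integral>\<^sup>+x. ennreal (norm (v (x, y)) powr (2 + 4 / \<epsilon>)) \<partial>M) \<le> ennreal c2"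
  shows "(\<integral>\<^sup>+p. ennreal ((norm (v p * v (prod.swap p)))\<^sup>2) \<partial>M2) < \<infinity>"
proof -
  note vs = measurable_swap[OF v]
  interpret FM: finite_measure M by (rule finite_measure_M)
  have m1: "(\<lambda>p. ennreal (norm (v p) powr (2 + \<epsilon>))) \<in> borel_measurable M2" using v by simp
  have m2: "(\<lambda>p. ennreal (norm (v (prod.swap p)) powr (2 + 4 / \<epsilon>))) \<in> borel_measurable M2" using vs by simp
  have fin: "(\<integral>\<^sup>+p. g p \<partial>M2) < \<infinity>"
    if g: "g \<in> borel_measurable M2" and le: "AE x in M. (\<integral>\<^sup>+y. g (x, y) \<partial>M) \<le> ennreal c" for g c
  proof -
    have "(\<integral>\<^sup>+p. g p \<partial>M2) \<le> (\<integral>\<^sup>+x. ennreal c \<partial>M)"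
      unfolding Tonelli(2)[OF g] using le by (rule nn_integral_mono_AE)
    also have "\<dots> = ennreal c * ennreal (measure M (space M))"
      by (simp only: nn_integral_const FM.emeasure_eq_measure)
    also have "\<dots> < \<infinity>" by (simp add: ennreal_mult_less_top)
    finally show ?thesis .
  qed
  have "(\<integral>\<^sup>+p. ennreal ((norm (v p * v (prod.swap p)))\<^sup>2) \<partial>M2)
      \<le> (\<integral>\<^sup>+p. ennreal (norm (v p) powr (2 + \<epsilon>)) + ennreal (norm (v (prod.swap p)) powr (2 + 4 / \<epsilon>)) \<partial>M2)"
    using \<epsilon> by (intro nn_integral_mono) (simp add: norm_mult square_mult_le_powr ennreal_leI flip: ennreal_plus)
  also have "\<dots> = (\<integral>\<^sup>+p. ennreal (norm (v p) powr (2 + \<epsilon>)) \<partial>M2) + (\<integral>\<^sup>+p. ennreal (norm (v (prod.swap p)) powr (2 + 4 / \<epsilon>)) \<partial>M2)"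
    using m1 m2 by (rule nn_integral_add)
  also have "\<dots> < \<infinity>"
    using fin[OF m1 bd1] fin[OF m2, of c2] bd2 by simp
  finally show ?thesis .
qed

end

section \<open>Counting eigenvalues below the essential spectrum\<close>

theorem proposition4p3:
  fixes a z :: real
    and w1 :: "real ^ 'n \<Rightarrow> real"
    and w2 :: "(real ^ 'n) \<times> (real ^ 'n) \<Rightarrow> real"
    and v1 :: "(real ^ 'n) \<times> (real ^ 'n) \<Rightarrow> complex"
  assumes "a > 0"
    and "Linfty (cube_measure a) w1"
    and "continuous_on (cube a \<times> cube a) w2"
    and "Linfty (cube2_measure a) w2"
    and "\<forall>x\<in>cube a. \<forall>y\<in>cube a. w2 (x, y) = w2 (y, x)"
    and "v1 \<in> borel_measurable (cube2_measure a)"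
    and "\<exists>\<epsilon>>0.
      esssup (cube_measure a) (\<lambda>x. Lp_norm (2 + \<epsilon>) (cube_measure a) (\<lambda>y. v1 (x, y))) < \<infinity> \<and>
      esssup (cube_measure a) (\<lambda>y. Lp_norm (2 + 4 / \<epsilon>) (cube_measure a) (\<lambda>x. v1 (x, y))) < \<infinity>"
    and "\<forall>\<mu>\<in>essential_spectrum (hsum (space1 a) (space2 a)) (op_matrix a w1 w2 v1). z < Re \<mu>"
  shows "integral_op_defined (cube_measure a) (kernel_T a w1 w2 v1 z) \<and>
    hilbert_schmidt (space1 a) (op_T a w1 w2 v1 z) \<and>
    eigenvalue_count (hsum (space1 a) (space2 a)) z (op_matrix a w1 w2 v1)
      = form_count (space1 a) 1 (op_T a w1 w2 v1 z)"
proof -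
  interpret sq: completed_square "restrict_space lborel (cube a :: 'n pt set)" "cube_measure a" "cube2_measure a"
    by (rule completed_square_cube)
  obtain C1 where C1: "w1 \<in> borel_measurable (cube_measure a)" "AE x in cube_measure a. \<bar>w1 x\<bar> \<le> C1"
    using assms(2) by (auto simp: Linfty_def)
  obtain C2 where C2: "w2 \<in> borel_measurable (cube2_measure a)" "AE p in cube2_measure a. \<bar>w2 p\<bar> \<le> C2"
    using assms(4) by (auto simp: Linfty_def)
  obtain \<epsilon> where \<epsilon>: "\<epsilon> > 0"
    "esssup (cube_measure a) (\<lambda>x. Lp_norm (2 + \<epsilon>) (cube_measure a) (\<lambda>y. v1 (x, y))) < \<infinity>"
    "esssup (cube_measure a) (\<lambda>y. Lp_norm (2 + 4 / \<epsilon>) (cube_measure a) (\<lambda>x. v1 (x, y))) < \<infinity>"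
    using assms(7) by blast
  have pos: "0 < 2 + \<epsilon>" "0 < 2 + 4 / \<epsilon>" using \<epsilon>(1) by (auto intro: add_pos_pos)
  obtain c1 where c1: "0 \<le> c1" "AE x in cube_measure a. (\<integral>\<^sup>+y. ennreal (norm (v1 (x, y)) powr (2 + \<epsilon>)) \<partial>cube_measure a) \<le> ennreal c1"
    using AE_section_powr_bound[OF \<epsilon>(2) pos(1)] .
  obtain c2 where c2: "0 \<le> c2" "AE y in cube_measure a. (\<integral>\<^sup>+x. ennreal (norm (v1 (x, y)) powr (2 + 4 / \<epsilon>)) \<partial>cube_measure a) \<le> ennreal c2"
    using AE_section_powr_bound[OF \<epsilon>(3) pos(2)] .
  define Cv where "Cv = measure (cube_measure a :: 'n pt measure) (space (cube_measure a)) + c1"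
  interpret below: cube_model_below a v1 Cv w1 w2 C1 C2 z
  proof
    show "AE x in cube_measure a. (\<integral>\<^sup>+y. ennreal ((norm (v1 (x, y)))\<^sup>2) \<partial>cube_measure a) \<le> ennreal Cv"
      unfolding Cv_def by (rule sq.section_square_bound[OF assms(6) _ c1(2,1)]) (use \<epsilon>(1) in simp)
    show "(\<integral>\<^sup>+p. ennreal ((norm (v1 p * v1 (prod.swap p)))\<^sup>2) \<partial>cube2_measure a) < \<infinity>"
      by (rule sq.cross_square_finite[OF assms(6) \<epsilon>(1) c1(2) c2(2)])
    show "0 \<le> Cv" using c1(1) by (simp add: Cv_def)
    show "w2 (prod.swap p) = w2 p"
      if "p \<in> space (restrict_space lborel (cube a)) \<times> space (restrict_space lborel (cube a))" for p
      using that assms(5) by (cases p) (auto simp: space_restrict_space)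
  qed (use assms C1 C2 in auto)
  obtain c where c: "z < c" "\<forall>p\<in>cube a \<times> cube a. c \<le> w2 p" using below.w2_lower_bound by blast
  interpret schur: cube_schur a v1 Cv w1 w2 C1 C2 z "c - z"
  proof
    show "AE p in cube2_measure a. z + (c - z) \<le> w2 p"
      using c(2) by (intro AE_I2) (auto simp: space_restrict_space)
  qed (use c in simp)
  obtain \<beta> where \<beta>: "\<beta> > 0" "AE x in cube_measure a. \<beta> \<le> Delta a w1 w2 v1 z x"
    using schur.Delta_lower_bound by blast
  interpret cube_effective a v1 Cv w1 w2 C1 C2 z "c - z" \<beta>
    by unfold_locales (rule \<beta>)+
  show ?thesis
    using kernel_integrals_converge hilbert_schmidt_opT eigenvalue_count_eq_form_count by blast
qed

end
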